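(* Let $(A,\omega)$ be a well-becoming pair with decomposition $H_1(A,\mathbb Z)=\Gamma=\Gamma_1\oplus\Gamma_2$, let $n=\dim A$, and let $(B,\theta)$ be its well-becoming mirror symmetric pair with $H_1(B,\mathbb Z)=\Gamma_1^*\oplus\Gamma_2$ described in the context. Let $T\subset A\times B$ be the real subtorus of dimension $3n$, $j:T\hookrightarrow A\times B$ its embedding, and $L$ the complex line bundle on $T$, all defined in the context. Then the canonical isomorphism of Clifford modules $\beta:H^*(A,\mathbb Z)\to H^*(B,\mathbb Z)$ coincides with the map $$v_\xi(\cdot)=p_{2*}(\xi\cup p_1^*(\cdot)),\qquad \xi=j_*\big(ch(L^{(-1)^{n-1}})\big)\in H^*(A\times B,\mathbb Z),$$ where $p_1,p_2$ are the projections of $A\times B$ onto $A$ and $B$.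
   Context: A complex torus is $A=(V/\Gamma,J)$ with $\Gamma=H_1(A,\mathbb Z)$, $V=\Gamma\otimes\mathbb R$, $J\in\mathrm{End}(V)$, $J^2=-1$; its dual is $\hat A=(V^*/\Gamma^*,\hat J)$, $(\hat Jw)(v)=w(-Jv)$. $NS_A$ is the group of integral skew-symmetric forms $c$ on $\Gamma$ with $c_{\mathbb R}$ $J$-invariant, embedded in $\mathrm{Hom}(A,\hat A)$ by $c\mapsto(v\mapsto c(v,\cdot))$. A weak pair $(A,\omega)$ is a complex torus with $\omega=\varphi_1+i\varphi_2\in NS_A\otimes\mathbb C$, $\varphi_k\in NS_A\otimes\mathbb R$, $\varphi_2$ nondegenerate. Put $$I_\omega=\begin{pmatrix}\varphi_2^{-1}\varphi_1&-\varphi_2^{-1}\\ \varphi_2+\varphi_1\varphi_2^{-1}\varphi_1&-\varphi_1\varphi_2^{-1}\end{pmatrix}$$ on $V\oplus V^*$. Let $\Lambda_A=\Gamma\oplus\Gamma^*$ with $Q_A((a_1,b_1),(a_2,b_2))=b_1(a_2)+b_2(a_1)$ and let $J_{A\times\hat A}=(J,\hat J)$. Weak pairs $(A,\omega_A),(B,\omega_B)$ are mirror symmetric if there is an isomorphism $\alpha:\Lambda_A\to\Lambda_B$ identifying $Q_A$ with $Q_B$ with $\alpha_{\mathbb R}J_{A\times\hat A}=I_{\omega_B}\alpha_{\mathbb R}$ and $\alpha_{\mathbb R}I_{\omega_A}=J_{B\times\hat B}\alpha_{\mathbb R}$. A weak pair $(A,\omega)$ is well-becoming if there is a decomposition $\Gamma=\Gamma_1\oplus\Gamma_2$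 such that $\Gamma_{1\mathbb R},\Gamma_{2\mathbb R}$ are isotropic for $\omega$, and the off-diagonal blocks $J_{21}:\Gamma_{1\mathbb R}\to\Gamma_{2\mathbb R}$, $J_{12}:\Gamma_{2\mathbb R}\to\Gamma_{1\mathbb R}$ of $J$ are invertible. Then put $\Sigma=\Gamma_1^*\oplus\Gamma_2$, $B=(\Sigma_{\mathbb R}/\Sigma,I_\omega|_{\Sigma_{\mathbb R}})$; it is a complex torus, there is $\theta$ with $(B,\theta)$ a well-becoming weak pair mirror symmetric to $(A,\omega)$, the mirror symmetry $\alpha$ being the natural identification $\Gamma\oplus\Gamma^*=\Gamma_1\oplus\Gamma_2\oplus\Gamma_1^*\oplus\Gamma_2^*=\Sigma\oplus\Sigma^*=:\Lambda$, $\Sigma^*=\Gamma_1\oplus\Gamma_2^*$, with common form $Q$. Let $l_1,\dots,l_n$ and $l_{n+1},\dots,l_{2n}$ be bases of $\Gamma_1$, $\Gamma_2$, and $x_1,\dots,x_n$, $x_{n+1},\dots,x_{2n}$ the dual bases of $\Gamma_1^*$, $\Gamma_2^*$. $H^1(A,\mathbb Z)=\Gamma^*=\Gamma_1^*\oplus\Gamma_2^*$ and $H^1(B,\mathbb Z)=\Sigma^*=\Gamma_1\oplus\Gamma_2^*$. The Clifford algebra $Cl(\Lambda,Q)=T(\Lambda)/\langle x\otimes x=\frac12Q(x,x)\rangle$ acts on $H^*(A,\mathbb Z)=\Lambda^\cdot\Gamma^*$ (elements of $\Gamma$ by contraction, elements of $\Gamma^*$ by cup product) and on $H^*(B,\mathbb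 Z)=\Lambda^\cdot\Sigma^*$ (elements of $\Sigma$ by contraction, of $\Sigma^*$ by cup product); $\beta:H^*(A,\mathbb Z)\to H^*(B,\mathbb Z)$ is the isomorphism of $Cl(\Lambda,Q)$-modules, unique up to sign. The sign is fixed so that $$\beta(x_S\cup x_R)=(-1)^{\epsilon}x_R\cup l_{\overline S},\qquad \epsilon=|S||R|+\sum_{i\in S}(i-1),$$ for $S\subset\{1,\dots,n\}$, $R\subset\{n+1,\dots,2n\}$, $\overline S=\{1,\dots,n\}\setminus S$, where $x_S,x_R,l_{\overline S}$ are cup products taken in increasing order of indices. Let $\Pi=\Gamma_1\oplus\Gamma_2\oplus\Gamma_1^*\subset\Lambda$ and $T=\Pi_{\mathbb R}/\Pi$, a real subtorus of $A\times\hat A$ (and of $B\times\hat B$). The projections $\Pi\to\Gamma_1\oplus\Gamma_2$ and $\Pi\to\Gamma_1^*\oplus\Gamma_2$ give projections of $T$ onto $A$ and $B$, hence an embedding $j:T\hookrightarrow A\times B$. $L$ is the restriction to $T$ of the Poincaré line bundle $P_A$ on $A\times\hat A$; $c_1(L)=\sum_{i=1}^n x_i\cup l_i$ in $H^2(T,\mathbb Z)$, where $H^1(T,\mathbb Z)=\Pi^*=\Gamma_1^*\oplus\Gamma_2^*\oplus\Gamma_1$. The map $j_*:H^*(T,\mathbb Z)\to H^{*+n}(A\times B,\mathbb Z)$ is the map on homology transported by Poincaré duality; the orientation of $T$ is chosen so that $\tau=j_*(1)\in H^n(A\times B,\mathbb Z)$ satisfies $p_{2*}(\tau\cup p_1^*(x_R\cup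 x_n\cup x_{n-1}\cup\dots\cup x_1))=x_R$ for all $R\subset\{n+1,\dots,2n\}$, while $p_{2*}(\tau\cup p_1^*(\cdot))$ vanishes on all monomials in the $x_i$ not containing all of $x_1,\dots,x_n$.
   Formalization: With the usual Poincaré duality no orientation of T meets the stated normalisation for odd n, so the theorem is stated for the usual duality and also for the one with the sign (-1)^⌊mk/2⌋ on degree-k classes of an m-dimensional torus, which makes odd n meaningful and changes nothing for even n. *)

theory Defs
  imports
    "HOL-Analysis.Analysis"
    "HOL-Library.Poly_Mapping"
    "HOL-Algebra.QuotRing"
begin

section \<open>Lattices and complex tori\<close>

type_synonym 'v dual = "'v \<Rightarrow>\<^sub>L real"

text \<open>
  A torus is given by its lattice \<open>\<Gamma>\<close>, a subset of a real vector space; \<open>\<Gamma> \<otimes> \<real>\<close> is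
  \<open>span \<Gamma>\<close>. An integral basis is a list because its order also records an orientation.
\<close>

definition zbasis :: "'v::real_vector set \<Rightarrow> 'v list \<Rightarrow> bool" where
  "zbasis \<Gamma> bs \<longleftrightarrow> distinct bs \<and> independent (set bs) \<and>
     \<Gamma> = range (\<lambda>c :: nat \<Rightarrow> int. \<Sum>i<length bs. of_int (c i) *\<^sub>R bs ! i)"

definition is_lattice :: "'v::real_vector set \<Rightarrow> bool" where
  "is_lattice \<Gamma> \<longleftrightarrow> (\<exists>bs. zbasis \<Gamma> bs)"

definition dual_lattice :: "'v::real_normed_vector set \<Rightarrow> 'v dual set" where
  "dual_lattice \<Gamma> = {w. \<forall>v\<in>\<Gamma>. blinfun_apply w v \<in> \<int>}"

text \<open>
  For \<open>\<Gamma> = \<Gamma>1 \<oplus> \<Gamma>2\<close> the summand \<open>\<Gamma>1\<^sup>*\<close> of \<open>\<Gamma>\<^sup>*\<close> is \<open>annihilator \<Gamma> \<Gamma>2\<close>, and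
  \<open>\<Gamma>2\<^sup>*\<close> is \<open>annihilator \<Gamma> \<Gamma>1\<close>.
\<close>

definition annihilator :: "'v::real_normed_vector set \<Rightarrow> 'v set \<Rightarrow> 'v dual set" where
  "annihilator \<Gamma> \<Delta> = {w \<in> dual_lattice \<Gamma>. \<forall>v\<in>\<Delta>. blinfun_apply w v = 0}"

definition complex_torus :: "'v::euclidean_space set \<Rightarrow> ('v \<Rightarrow>\<^sub>L 'v) \<Rightarrow> bool" where
  "complex_torus \<Gamma> J \<longleftrightarrow> is_lattice \<Gamma> \<and> span \<Gamma> = UNIV \<and> J o\<^sub>L J = - id_blinfun"

definition dual_cplx :: "('v::euclidean_space \<Rightarrow>\<^sub>L 'v) \<Rightarrow> 'v dual \<Rightarrow> 'v dual" where
  "dual_cplx J w = w o\<^sub>L (- J)"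

definition prod_cplx ::
  "('v::euclidean_space \<Rightarrow>\<^sub>L 'v) \<Rightarrow> 'v \<times> 'v dual \<Rightarrow> 'v \<times> 'v dual" where
  "prod_cplx J = (\<lambda>(v, w). (blinfun_apply J v, dual_cplx J w))"

section \<open>Weak pairs and mirror symmetry\<close>

type_synonym 'v form2 = "'v \<Rightarrow>\<^sub>L ('v \<Rightarrow>\<^sub>L real)"

definition ev2 :: "'v::euclidean_space form2 \<Rightarrow> 'v \<Rightarrow> 'v \<Rightarrow> real" where
  "ev2 c u v = blinfun_apply (blinfun_apply c u) v"

definition NS :: "'v::euclidean_space set \<Rightarrow> ('v \<Rightarrow>\<^sub>L 'v) \<Rightarrow> 'v form2 set" where
  "NS \<Gamma> J = {c. (\<forall>u v. ev2 c u v = - ev2 c v u) \<and> (\<forall>u\<in>\<Gamma>. \<forall>v\<in>\<Gamma>. ev2 c u v \<in> \<int>) \<and>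
                (\<forall>u v. ev2 c (blinfun_apply J u) (blinfun_apply J v) = ev2 c u v)}"

text \<open>
  The class \<open>\<omega> = \<phi>1 + \<i> \<phi>2\<close> in \<open>NS \<otimes> \<complex>\<close> is given by the pair \<open>(\<phi>1, \<phi>2)\<close>.
\<close>

definition weak_pair ::
  "'v::euclidean_space set \<Rightarrow> ('v \<Rightarrow>\<^sub>L 'v) \<Rightarrow> 'v form2 \<times> 'v form2 \<Rightarrow> bool" where
  "weak_pair \<Gamma> J \<omega> \<longleftrightarrow> complex_torus \<Gamma> J \<and>
     fst \<omega> \<in> span (NS \<Gamma> J) \<and> snd \<omega> \<in> span (NS \<Gamma> J) \<and>
     (\<forall>u. (\<forall>v. ev2 (snd \<omega>) u v = 0) \<longrightarrow> u = 0)"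

definition I_op ::
  "'v::euclidean_space form2 \<times> 'v form2 \<Rightarrow> 'v \<times> 'v dual \<Rightarrow> 'v \<times> 'v dual" where
  "I_op \<omega> = (\<lambda>(v, w).
     let \<phi>1 = blinfun_apply (fst \<omega>); \<phi>2 = blinfun_apply (snd \<omega>); \<psi> = inv_into UNIV \<phi>2
     in (\<psi> (\<phi>1 v) - \<psi> w, \<phi>2 v + \<phi>1 (\<psi> (\<phi>1 v)) - \<phi>1 (\<psi> w)))"

definition Lam :: "'v::real_normed_vector set \<Rightarrow> ('v \<times> 'v dual) set" where
  "Lam \<Gamma> = \<Gamma> \<times> dual_lattice \<Gamma>"

definition Qform :: "'v::real_normed_vector \<times> 'v dual \<Rightarrow> 'v \<times> 'v dual \<Rightarrow> real" where
  "Qform p q = blinfun_apply (snd p) (fst q) + blinfun_apply (snd q) (fst p)"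

text \<open>
  \<open>\<alpha>\<close> is the real extension of the isomorphism of the lattices \<open>\<Lambda>\<close>.
\<close>

definition mirror_symmetry ::
  "'v::euclidean_space set \<Rightarrow> ('v \<Rightarrow>\<^sub>L 'v) \<Rightarrow> 'v form2 \<times> 'v form2 \<Rightarrow>
   'w::euclidean_space set \<Rightarrow> ('w \<Rightarrow>\<^sub>L 'w) \<Rightarrow> 'w form2 \<times> 'w form2 \<Rightarrow>
   ('v \<times> 'v dual \<Rightarrow> 'w \<times> 'w dual) \<Rightarrow> bool" where
  "mirror_symmetry \<Gamma> J \<omega> \<Delta> K \<theta> \<alpha> \<longleftrightarrow> linear \<alpha> \<and> bij_betw \<alpha> (Lam \<Gamma>) (Lam \<Delta>) \<and>
     (\<forall>p\<in>Lam \<Gamma>. \<forall>q\<in>Lam \<Gamma>. Qform (\<alpha> p) (\<alpha> q) = Qform p q) \<and>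
     (\<forall>p. \<alpha> (prod_cplx J p) = I_op \<theta> (\<alpha> p)) \<and>
     (\<forall>p. \<alpha> (I_op \<omega> p) = prod_cplx K (\<alpha> p))"

text \<open>
  \<open>off_diag U W J\<close> is the block \<open>U \<rightarrow> W\<close> of \<open>J\<close> for a vector space \<open>U \<oplus> W\<close>.
\<close>

definition off_diag ::
  "'v::euclidean_space set \<Rightarrow> 'v set \<Rightarrow> ('v \<Rightarrow>\<^sub>L 'v) \<Rightarrow> 'v \<Rightarrow> 'v" where
  "off_diag U W J u = (THE w. w \<in> W \<and> blinfun_apply J u - w \<in> U)"

definition well_becoming ::
  "'v::euclidean_space set \<Rightarrow> ('v \<Rightarrow>\<^sub>L 'v) \<Rightarrow> 'v form2 \<times> 'v form2 \<Rightarrow> 'v set \<Rightarrow> 'v set \<Rightarrow> bool"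
  where
  "well_becoming \<Gamma> J \<omega> \<Gamma>1 \<Gamma>2 \<longleftrightarrow> weak_pair \<Gamma> J \<omega> \<and>
     is_lattice \<Gamma>1 \<and> is_lattice \<Gamma>2 \<and> \<Gamma> = {u + v | u v. u \<in> \<Gamma>1 \<and> v \<in> \<Gamma>2} \<and> \<Gamma>1 \<inter> \<Gamma>2 = {0} \<and>
     (\<forall>U\<in>{span \<Gamma>1, span \<Gamma>2}. \<forall>u\<in>U. \<forall>v\<in>U. ev2 (fst \<omega>) u v = 0 \<and> ev2 (snd \<omega>) u v = 0) \<and>
     bij_betw (off_diag (span \<Gamma>1) (span \<Gamma>2) J) (span \<Gamma>1) (span \<Gamma>2) \<and>
     bij_betw (off_diag (span \<Gamma>2) (span \<Gamma>1) J) (span \<Gamma>2) (span \<Gamma>1)"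

text \<open>
  The torus with lattice \<open>\<Delta>\<close> is \<open>\<Gamma>1\<^sup>* \<oplus> \<Gamma>2\<close> with complex structure \<open>I\<^sub>\<omega>\<close>, and \<open>\<alpha>\<close> is the
  natural identification: the last two conditions say that \<open>\<alpha>\<close> restricts to isomorphisms
  \<open>\<Gamma>1\<^sup>* \<oplus> \<Gamma>2 \<rightarrow> \<Delta>\<close> and \<open>\<Gamma>1 \<oplus> \<Gamma>2\<^sup>* \<rightarrow> \<Delta>\<^sup>*\<close>. The first of these carries \<open>I\<^sub>\<omega>\<close> to \<open>K\<close> because
  \<open>\<alpha>\<close> intertwines \<open>I\<^sub>\<omega>\<close> with \<open>prod_cplx K\<close>; it determines the second because \<open>\<alpha>\<close> preserves \<open>Q\<close>.
\<close>

definition canonical_mirror ::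
  "'v::euclidean_space set \<Rightarrow> ('v \<Rightarrow>\<^sub>L 'v) \<Rightarrow> 'v form2 \<times> 'v form2 \<Rightarrow> 'v set \<Rightarrow> 'v set \<Rightarrow>
   'w::euclidean_space set \<Rightarrow> ('w \<Rightarrow>\<^sub>L 'w) \<Rightarrow> 'w form2 \<times> 'w form2 \<Rightarrow>
   ('v \<times> 'v dual \<Rightarrow> 'w \<times> 'w dual) \<Rightarrow> bool" where
  "canonical_mirror \<Gamma> J \<omega> \<Gamma>1 \<Gamma>2 \<Delta> K \<theta> \<alpha> \<longleftrightarrow>
     weak_pair \<Delta> K \<theta> \<and> mirror_symmetry \<Gamma> J \<omega> \<Delta> K \<theta> \<alpha> \<and>
     \<alpha> ` (\<Gamma>2 \<times> annihilator \<Gamma> \<Gamma>2) = \<Delta> \<times> {0} \<and>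
     \<alpha> ` (\<Gamma>1 \<times> annihilator \<Gamma> \<Gamma>1) = {0} \<times> dual_lattice \<Delta>"

section \<open>Cohomology of tori\<close>

text \<open>
  The exterior algebra of \<open>\<Gamma>\<^sup>*\<close> as alternating forms: \<open>f\<close> is an inhomogeneous form whose
  component of degree \<open>k\<close> is the restriction of \<open>f\<close> to lists of length \<open>k\<close>. Forms
  vanish by convention on lists with an entry outside \<open>\<Gamma>\<close>. Thus \<open>H\<^sup>*(X, \<int>)\<close> is \<open>cohomology \<int> \<Gamma>\<close>,
  a subset of \<open>H\<^sup>*(X, \<rat>) = cohomology \<rat> \<Gamma>\<close>.
\<close>

type_synonym 'v forms = "'v list \<Rightarrow> real"

definition cohomology :: "real set \<Rightarrow> 'v::ab_group_add set \<Rightarrow> 'v forms set" where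
  "cohomology R \<Gamma> = {f. (\<forall>vs. f vs \<in> R) \<and> (\<forall>vs. \<not> set vs \<subseteq> \<Gamma> \<longrightarrow> f vs = 0) \<and>
     (\<forall>vs. \<not> distinct vs \<longrightarrow> f vs = 0) \<and>
     (\<forall>us ws. set us \<subseteq> \<Gamma> \<longrightarrow> set ws \<subseteq> \<Gamma> \<longrightarrow> (\<forall>x\<in>\<Gamma>. \<forall>y\<in>\<Gamma>.
        f (us @ (x + y) # ws) = f (us @ x # ws) + f (us @ y # ws)))}"

text \<open>
  The sum is over shuffles, so that \<open>x\<^sub>1 \<union> \<dots> \<union> x\<^sub>k\<close> sends \<open>v\<^sub>1, \<dots>, v\<^sub>k\<close> to the
  determinant of the matrix with entries \<open>x\<^sub>i(v\<^sub>j)\<close> when the \<open>x\<^sub>i\<close> have degree one.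
\<close>

definition shuffle_sign :: "nat set \<Rightarrow> nat \<Rightarrow> real" where
  "shuffle_sign S n = (-1) ^ card {(i, j). i \<in> S \<and> j \<in> {..<n} - S \<and> j < i}"

definition cup :: "'v forms \<Rightarrow> 'v forms \<Rightarrow> 'v forms" where
  "cup f g = (\<lambda>vs. \<Sum>S\<in>Pow {..<length vs}.
                shuffle_sign S (length vs) * f (nths vs S) * g (nths vs (- S)))"

definition unit_class :: "'v forms" where
  "unit_class = (\<lambda>vs. if vs = [] then 1 else 0)"

definition cups :: "'v forms list \<Rightarrow> 'v forms" where
  "cups fs = foldr cup fs unit_class"

definition class1 :: "'v::real_normed_vector set \<Rightarrow> 'v dual \<Rightarrow> 'v forms" where
  "class1 \<Gamma> w = (\<lambda>vs. case vs of [v] \<Rightarrow> if v \<in> \<Gamma> then blinfun_apply w v else 0 | _ \<Rightarrow> 0)"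

definition monomial :: "(nat \<Rightarrow> 'v forms) \<Rightarrow> nat set \<Rightarrow> 'v forms" where
  "monomial c S = cups (map c (sorted_list_of_set S))"

definition pullback :: "('u \<Rightarrow> 'v) \<Rightarrow> 'u set \<Rightarrow> 'v forms \<Rightarrow> 'u forms" where
  "pullback p \<Xi> f = (\<lambda>vs. if set vs \<subseteq> \<Xi> then f (map p vs) else 0)"

section \<open>Orientations and push-forward\<close>

text \<open>
  An orientation is given by an ordered integral basis \<open>bs\<close> of the lattice, and integration over
  the corresponding fundamental class is evaluation at \<open>bs\<close>. A basis is positive for \<open>J\<close> if a
  volume form positive on \<open>bs\<close> is nonnegative on all \<open>v\<^sub>1, J v\<^sub>1, \<dots>, v\<^sub>n, J v\<^sub>n\<close>.
\<close>

definition complex_oriented :: "'v::euclidean_space set \<Rightarrow> ('v \<Rightarrow>\<^sub>L 'v) \<Rightarrow> 'v list \<Rightarrow> bool" where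
  "complex_oriented \<Gamma> J bs \<longleftrightarrow> zbasis \<Gamma> bs \<and>
     (\<exists>D :: 'v forms. (\<forall>us ws. linear (\<lambda>v. D (us @ v # ws))) \<and>
        (\<forall>vs. \<not> distinct vs \<longrightarrow> D vs = 0) \<and> D bs > 0 \<and>
        (\<forall>vs. 2 * length vs = length bs \<longrightarrow>
           D (concat (map (\<lambda>v. [v, blinfun_apply J v]) vs)) \<ge> 0))"

definition prod_basis :: "'v::zero list \<Rightarrow> 'w::zero list \<Rightarrow> ('v \<times> 'w) list" where
  "prod_basis as bs = map (\<lambda>a. (a, 0)) as @ map (\<lambda>b. (0, b)) bs"

text \<open>
  Rational homology is the dual of rational cohomology. Poincare duality on an oriented
  \<open>m\<close>-dimensional torus is cap product with the fundamental class, up to a sign \<open>\<sigma> m k\<close> in degree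
  \<open>k\<close> that is a matter of convention:
  \<open>\<langle>D(a), b\<rangle> = \<sigma> m k \<integral> a \<union> b\<close> for \<open>a\<close> of degree \<open>k\<close>.
\<close>

definition poincare_dual ::
  "(nat \<Rightarrow> nat \<Rightarrow> real) \<Rightarrow> 'v list \<Rightarrow> 'v forms \<Rightarrow> 'v forms \<Rightarrow> real" where
  "poincare_dual \<sigma> bs a = (\<lambda>b. cup (\<lambda>vs. \<sigma> (length bs) (length vs) * a vs) b bs)"

text \<open>
  \<open>pushforward \<sigma> p \<Xi> ts \<Gamma> bs\<close> is the Gysin map \<open>p\<^sub>*\<close> of the homomorphism of tori given by
  \<open>p : \<Xi> \<rightarrow> \<Gamma>\<close>, where \<open>ts\<close> and \<open>bs\<close> orient source and target: the Poincare dual of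
  \<open>p\<^sub>* a\<close> is the image in homology of the Poincare dual of \<open>a\<close>.
\<close>

definition pushforward ::
  "(nat \<Rightarrow> nat \<Rightarrow> real) \<Rightarrow> ('u \<Rightarrow> 'v::ab_group_add) \<Rightarrow> 'u set \<Rightarrow> 'u list \<Rightarrow> 'v set \<Rightarrow> 'v list \<Rightarrow>
   'u forms \<Rightarrow> 'v forms" where
  "pushforward \<sigma> p \<Xi> ts \<Gamma> bs a = (THE c. c \<in> cohomology \<rat> \<Gamma> \<and>
     (\<forall>b\<in>cohomology \<rat> \<Gamma>. poincare_dual \<sigma> bs c b = poincare_dual \<sigma> ts a (pullback p \<Xi> b)))"

text \<open>
  The first convention is the usual cap product. For even \<open>n\<close> both conventions give the same
  \<open>p\<^sub>2\<^sub>*\<close> and the same \<open>j\<^sub>*\<close> on classes of even degree, for the maps \<open>p\<^sub>2\<close> and \<open>j\<close> of tori of real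
  dimensions \<open>4 n \<rightarrow> 2 n\<close> and \<open>3 n \<rightarrow> 4 n\<close> considered below. For odd \<open>n\<close> the first one yields
  \<open>p\<^sub>2\<^sub>*(\<tau> \<union> x\<^sub>R \<union> x\<^sub>n \<union> \<dots> \<union> x\<^sub>1) = \<plusminus>(-1)\<^bsup>|R|\<^esup> x\<^sub>R\<close> with one sign for all \<open>R\<close>, so that no
  orientation of the real subtorus satisfies the condition \<open>normalised\<close> below; the second one
  admits such an orientation for every \<open>n\<close>.
\<close>

definition duality_signs :: "(nat \<Rightarrow> nat \<Rightarrow> real) set" where
  "duality_signs = {\<lambda>m k. 1, \<lambda>m k. (-1) ^ (m * k div 2)}"

section \<open>Line bundles and Chern character\<close>

text \<open>
  A unitary factor of automorphy \<open>e\<close> for \<open>\<Xi>\<close> acting on \<open>span \<Xi>\<close> describes the line bundle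
  \<open>(span \<Xi> \<times> \<complex>) / \<Xi>\<close> on the torus, where \<open>g\<close> sends \<open>(v, z)\<close> to \<open>(v + g, e g v z)\<close>.
  If \<open>e g = exp(2 \<pi> \<i> f g)\<close> with \<open>f g\<close> continuous, then \<open>c\<^sub>1\<close> is the alternating form
  \<open>(g, h) \<mapsto> f g (v + h) - f g v - f h (v + g) + f h v\<close>, which does not depend on \<open>v\<close> and \<open>f\<close>;
  the sign makes bundles with theta functions as sections positive.
\<close>

definition chern1 ::
  "'u::real_normed_vector set \<Rightarrow> ('u \<Rightarrow> 'u \<Rightarrow> complex) \<Rightarrow> 'u forms" where
  "chern1 \<Xi> e = (\<lambda>us. case us of [g, h] \<Rightarrow>
     if g \<in> \<Xi> \<and> h \<in> \<Xi> then
       (THE r. \<exists>f. (\<forall>g\<in>\<Xi>. continuous_on (span \<Xi>) (f g)) \<and>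
          (\<forall>g\<in>\<Xi>. \<forall>v\<in>span \<Xi>. e g v = cis (2 * pi * f g v)) \<and>
          (\<forall>v\<in>span \<Xi>. r = f g (v + h) - f g v - f h (v + g) + f h v))
     else 0 | _ \<Rightarrow> 0)"

definition chern_character ::
  "'u::real_normed_vector set \<Rightarrow> ('u \<Rightarrow> 'u \<Rightarrow> complex) \<Rightarrow> 'u forms" where
  "chern_character \<Xi> e = (\<lambda>vs. \<Sum>p\<le>length vs. cups (replicate p (chern1 \<Xi> e)) vs / fact p)"

definition tensor_power ::
  "('u \<Rightarrow> 'u \<Rightarrow> complex) \<Rightarrow> int \<Rightarrow> 'u \<Rightarrow> 'u \<Rightarrow> complex" where
  "tensor_power e k = (\<lambda>g v. e g v powi k)"

text \<open>
  The bundle that is trivial on \<open>0 \<times> \<hat>A\<close> and whose restriction to \<open>A \<times> {w}\<close> is the flat bundle with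
  holonomy \<open>a \<mapsto> exp(2 \<pi> \<i> w(a))\<close>. Its Chern class is \<open>((a, b), (a', b')) \<mapsto> b'(a) - b(a')\<close>,
  which restricts to the sum of the \<open>x\<^sub>i \<union> l\<^sub>i\<close>, \<open>i \<le> n\<close>, on the lattice of the real subtorus.
\<close>

definition poincare_bundle ::
  "'v::real_normed_vector \<times> 'v dual \<Rightarrow> 'v \<times> 'v dual \<Rightarrow> complex" where
  "poincare_bundle = (\<lambda>(a, b) (v, w). cis (2 * pi * blinfun_apply w a))"

section \<open>Clifford modules\<close>

text \<open>
  \<open>free_ring \<Lambda>\<close> is the ring of noncommutative integral polynomials in the elements of \<open>\<Lambda>\<close>.
  Modulo the first family of relations below it is the tensor algebra of the abelian group \<open>\<Lambda>\<close>.
\<close>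

definition free_ring :: "'l set \<Rightarrow> ('l list \<Rightarrow>\<^sub>0 int) ring" where
  "free_ring \<Lambda> = \<lparr>carrier = {p. Poly_Mapping.keys p \<subseteq> lists \<Lambda>},
     mult = (\<lambda>p q. frag_extend (\<lambda>xs. frag_extend (\<lambda>ys. frag_of (xs @ ys)) q) p),
     one = frag_of [], zero = 0, add = (+)\<rparr>"

definition clifford_algebra ::
  "'l::ab_group_add set \<Rightarrow> ('l \<Rightarrow> 'l \<Rightarrow> real) \<Rightarrow> ('l list \<Rightarrow>\<^sub>0 int) set ring" where
  "clifford_algebra \<Lambda> Q = free_ring \<Lambda> Quot genideal (free_ring \<Lambda>)
     ({frag_of [x + y] - frag_of [x] - frag_of [y] | x y. x \<in> \<Lambda> \<and> y \<in> \<Lambda>} \<union>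
      {frag_of [x, x] - frag_cmul k (frag_of []) | x k. x \<in> \<Lambda> \<and> of_int k = Q x x / 2})"

text \<open>
  The action on forms of an element of the Clifford algebra, which is a coset \<open>C\<close> in the free
  ring, where \<open>act\<close> is the action of the elements of \<open>\<Lambda>\<close>.
\<close>

definition free_act :: "('l \<Rightarrow> 'v forms \<Rightarrow> 'v forms) \<Rightarrow> ('l list \<Rightarrow>\<^sub>0 int) \<Rightarrow> 'v forms \<Rightarrow> 'v forms" where
  "free_act act p f = (\<lambda>vs. \<Sum>xs\<in>Poly_Mapping.keys p.
     of_int (Poly_Mapping.lookup p xs) * foldr act xs f vs)"

definition clifford_act ::
  "('l \<Rightarrow> 'v forms \<Rightarrow> 'v forms) \<Rightarrow> ('l list \<Rightarrow>\<^sub>0 int) set \<Rightarrow> 'v forms \<Rightarrow> 'v forms" where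
  "clifford_act act C f = (THE g. \<forall>p\<in>C. free_act act p f = g)"

definition clifford_module_iso ::
  "'l::ab_group_add set \<Rightarrow> ('l \<Rightarrow> 'l \<Rightarrow> real) \<Rightarrow>
   ('l \<Rightarrow> 'v forms \<Rightarrow> 'v forms) \<Rightarrow> 'v forms set \<Rightarrow>
   ('l \<Rightarrow> 'w forms \<Rightarrow> 'w forms) \<Rightarrow> 'w forms set \<Rightarrow> ('v forms \<Rightarrow> 'w forms) \<Rightarrow> bool" where
  "clifford_module_iso \<Lambda> Q act M act' N \<beta> \<longleftrightarrow> bij_betw \<beta> M N \<and>
     (\<forall>f\<in>M. \<forall>g\<in>M. \<beta> (\<lambda>vs. f vs + g vs) = (\<lambda>vs. \<beta> f vs + \<beta> g vs)) \<and>
     (\<forall>C\<in>carrier (clifford_algebra \<Lambda> Q). \<forall>f\<in>M.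
        \<beta> (clifford_act act C f) = clifford_act act' C (\<beta> f))"

text \<open>
  Contraction with \<open>v\<close> plus cup product with \<open>w\<close>.
\<close>

definition spin_act ::
  "'v::real_normed_vector set \<Rightarrow> 'v \<times> 'v dual \<Rightarrow> 'v forms \<Rightarrow> 'v forms" where
  "spin_act \<Gamma> = (\<lambda>(v, w) f vs. f (v # vs) + cup (class1 \<Gamma> w) f vs)"

section \<open>The objects in the comparison\<close>

text \<open>
  Bases \<open>l 1, \<dots>, l n\<close> of \<open>\<Gamma>1\<close> and \<open>l (n + 1), \<dots>, l (2 n)\<close> of \<open>\<Gamma>2\<close>, with dual basis \<open>x\<close>.
\<close>

definition adapted_bases ::
  "nat \<Rightarrow> 'v::euclidean_space set \<Rightarrow> 'v set \<Rightarrow> (nat \<Rightarrow> 'v) \<Rightarrow> (nat \<Rightarrow> 'v dual) \<Rightarrow> bool" where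
  "adapted_bases n \<Gamma>1 \<Gamma>2 l x \<longleftrightarrow>
     zbasis \<Gamma>1 (map l [1..<n + 1]) \<and> zbasis \<Gamma>2 (map l [n + 1..<2 * n + 1]) \<and>
     (\<forall>i\<in>{1..2 * n}. \<forall>j\<in>{1..2 * n}. blinfun_apply (x i) (l j) = (if i = j then 1 else 0))"

definition xA :: "'v::euclidean_space set \<Rightarrow> (nat \<Rightarrow> 'v dual) \<Rightarrow> nat \<Rightarrow> 'v forms" where
  "xA \<Gamma> x i = class1 \<Gamma> (x i)"

text \<open>
  In \<open>H\<^sup>1(B) = \<Delta>\<^sup>* = \<Gamma>1 \<oplus> \<Gamma>2\<^sup>*\<close> the class \<open>lB\<close> is meant for \<open>i \<le> n\<close> and the class \<open>xB\<close> for \<open>i > n\<close>.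
\<close>

definition lB ::
  "'w::euclidean_space set \<Rightarrow> ('v::euclidean_space \<times> 'v dual \<Rightarrow> 'w \<times> 'w dual) \<Rightarrow>
   (nat \<Rightarrow> 'v) \<Rightarrow> nat \<Rightarrow> 'w forms" where
  "lB \<Delta> \<alpha> l i = class1 \<Delta> (snd (\<alpha> (l i, 0)))"

definition xB ::
  "'w::euclidean_space set \<Rightarrow> ('v::euclidean_space \<times> 'v dual \<Rightarrow> 'w \<times> 'w dual) \<Rightarrow>
   (nat \<Rightarrow> 'v dual) \<Rightarrow> nat \<Rightarrow> 'w forms" where
  "xB \<Delta> \<alpha> x i = class1 \<Delta> (snd (\<alpha> (0, x i)))"

definition canonical_iso ::
  "nat \<Rightarrow> 'v::euclidean_space set \<Rightarrow> 'w::euclidean_space set \<Rightarrow>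
   ('v \<times> 'v dual \<Rightarrow> 'w \<times> 'w dual) \<Rightarrow> (nat \<Rightarrow> 'v) \<Rightarrow> (nat \<Rightarrow> 'v dual) \<Rightarrow>
   ('v forms \<Rightarrow> 'w forms) \<Rightarrow> bool" where
  "canonical_iso n \<Gamma> \<Delta> \<alpha> l x \<beta> \<longleftrightarrow>
     clifford_module_iso (Lam \<Gamma>) Qform (spin_act \<Gamma>) (cohomology \<int> \<Gamma>)
       (\<lambda>p. spin_act \<Delta> (\<alpha> p)) (cohomology \<int> \<Delta>) \<beta> \<and>
     (\<forall>S R. S \<subseteq> {1..n} \<longrightarrow> R \<subseteq> {n + 1..2 * n} \<longrightarrow>
        \<beta> (cup (monomial (xA \<Gamma> x) S) (monomial (xA \<Gamma> x) R)) =
        (\<lambda>vs. (-1) ^ (card S * card R + (\<Sum>i\<in>S. i - 1)) *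
           cup (monomial (xB \<Delta> \<alpha> x) R) (monomial (lB \<Delta> \<alpha> l) ({1..n} - S)) vs))"

text \<open>
  The lattice \<open>\<Gamma>1 \<oplus> \<Gamma>2 \<oplus> \<Gamma>1\<^sup>*\<close> of the real subtorus, and its map to \<open>\<Gamma> \<oplus> \<Delta>\<close>. The first component
  of \<open>\<alpha>\<close> is the projection along \<open>\<Gamma>1\<close> onto \<open>\<Gamma>1\<^sup>* \<oplus> \<Gamma>2\<close>.
\<close>

definition T_lattice :: "'v::real_normed_vector set \<Rightarrow> 'v set \<Rightarrow> ('v \<times> 'v dual) set" where
  "T_lattice \<Gamma> \<Gamma>2 = \<Gamma> \<times> annihilator \<Gamma> \<Gamma>2"

definition T_embed ::
  "('v \<times> 'v dual \<Rightarrow> 'w \<times> 'w dual) \<Rightarrow> 'v::real_normed_vector \<times> 'v dual \<Rightarrow> 'v \<times> 'w::real_normed_vector"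
  where
  "T_embed \<alpha> p = (fst p, fst (\<alpha> p))"

definition j_push ::
  "(nat \<Rightarrow> nat \<Rightarrow> real) \<Rightarrow> 'v::euclidean_space set \<Rightarrow> 'v set \<Rightarrow> 'w::euclidean_space set \<Rightarrow>
   ('v \<times> 'v dual \<Rightarrow> 'w \<times> 'w dual) \<Rightarrow> 'v list \<Rightarrow> 'w list \<Rightarrow> ('v \<times> 'v dual) list \<Rightarrow>
   ('v \<times> 'v dual) forms \<Rightarrow> ('v \<times> 'w) forms" where
  "j_push \<sigma> \<Gamma> \<Gamma>2 \<Delta> \<alpha> as bs ts =
     pushforward \<sigma> (T_embed \<alpha>) (T_lattice \<Gamma> \<Gamma>2) ts (\<Gamma> \<times> \<Delta>) (prod_basis as bs)"

text \<open>
  The correspondence \<open>h \<mapsto> p\<^sub>2\<^sub>*(\<xi> \<union> p\<^sub>1\<^sup>* h)\<close>.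
\<close>

definition corr ::
  "(nat \<Rightarrow> nat \<Rightarrow> real) \<Rightarrow> 'v::euclidean_space set \<Rightarrow> 'w::euclidean_space set \<Rightarrow>
   'v list \<Rightarrow> 'w list \<Rightarrow> ('v \<times> 'w) forms \<Rightarrow> 'v forms \<Rightarrow> 'w forms" where
  "corr \<sigma> \<Gamma> \<Delta> as bs \<xi> h =
     pushforward \<sigma> snd (\<Gamma> \<times> \<Delta>) (prod_basis as bs) \<Delta> bs (cup \<xi> (pullback fst (\<Gamma> \<times> \<Delta>) h))"

text \<open>
  The condition fixing the orientation \<open>ts\<close> of the real subtorus.
\<close>

definition normalised ::
  "(nat \<Rightarrow> nat \<Rightarrow> real) \<Rightarrow> nat \<Rightarrow> 'v::euclidean_space set \<Rightarrow> 'v set \<Rightarrow> 'w::euclidean_space set \<Rightarrow>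
   ('v \<times> 'v dual \<Rightarrow> 'w \<times> 'w dual) \<Rightarrow> (nat \<Rightarrow> 'v dual) \<Rightarrow>
   'v list \<Rightarrow> 'w list \<Rightarrow> ('v \<times> 'v dual) list \<Rightarrow> bool" where
  "normalised \<sigma> n \<Gamma> \<Gamma>2 \<Delta> \<alpha> x as bs ts \<longleftrightarrow>
     (let \<tau> = j_push \<sigma> \<Gamma> \<Gamma>2 \<Delta> \<alpha> as bs ts unit_class in
      \<forall>R. R \<subseteq> {n + 1..2 * n} \<longrightarrow>
        corr \<sigma> \<Gamma> \<Delta> as bs \<tau>
          (cup (monomial (xA \<Gamma> x) R) (cups (map (xA \<Gamma> x) (rev [1..<n + 1])))) =
        monomial (xB \<Delta> \<alpha> x) R)"

definition kernel_class ::
  "(nat \<Rightarrow> nat \<Rightarrow> real) \<Rightarrow> nat \<Rightarrow> 'v::euclidean_space set \<Rightarrow> 'v set \<Rightarrow> 'w::euclidean_space set \<Rightarrow>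
   ('v \<times> 'v dual \<Rightarrow> 'w \<times> 'w dual) \<Rightarrow> 'v list \<Rightarrow> 'w list \<Rightarrow> ('v \<times> 'v dual) list \<Rightarrow>
   ('v \<times> 'w) forms" where
  "kernel_class \<sigma> n \<Gamma> \<Gamma>2 \<Delta> \<alpha> as bs ts =
     j_push \<sigma> \<Gamma> \<Gamma>2 \<Delta> \<alpha> as bs ts
       (chern_character (T_lattice \<Gamma> \<Gamma>2) (tensor_power poincare_bundle ((-1) ^ (n - 1))))"

end

theory Submission
  imports Defs
begin

text \<open>
  The map \<open>\<beta>\<close> is additive and its values on the monomials \<open>x\<^sub>S \<union> x\<^sub>R\<close> are prescribed. These
  monomials generate \<open>H\<^sup>*(A, \<int>)\<close>, and the correspondence given by \<open>\<xi>\<close> is additive as well, so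
  the two maps have to be compared on the monomials only (\<open>additive_eq_on_cohomology\<close>).

  Let \<open>q\<^sub>1\<close>, \<open>q\<^sub>2\<close> be the projections of the subtorus \<open>T\<close> to \<open>A\<close> and \<open>B\<close>. Poincare duality turns a
  class \<open>c\<close> on \<open>B\<close> into the functional \<open>b \<mapsto> \<integral>\<^sub>B c \<union> b\<close>, and the projection formula gives
  \<open>\<integral>\<^sub>B p\<^sub>2\<^sub>*(j\<^sub>*(a) \<union> p\<^sub>1\<^sup>* h) \<union> b = \<plusminus> \<integral>\<^sub>T a \<union> q\<^sub>1\<^sup>* h \<union> q\<^sub>2\<^sup>* b\<close> (\<open>corr_push\<close>). This replaces
  push-forwards by integrals over \<open>T\<close>.

  Let \<open>X\<^sub>i = q\<^sub>1\<^sup>* x\<^sub>i\<close> for all \<open>i\<close>, and \<open>Y\<^sub>i = q\<^sub>2\<^sup>* l\<^sub>i\<close> for \<open>i \<le> n\<close>. For \<open>i > n\<close> the class \<open>X\<^sub>i\<close> is also the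
  pull-back of \<open>x\<^sub>i\<close> from \<open>B\<close>. The Chern class of \<open>L\<close> is the sum of the \<open>X\<^sub>i Y\<^sub>i\<close>, \<open>i \<le> n\<close>. These products
  have even degree and square zero, so that for \<open>k = (-1)\<^bsup>n - 1\<^esup>\<close> the Chern character of \<open>L\<^sup>k\<close> is the
  sum over all \<open>P \<subseteq> {1, \<dots>, n}\<close> of the terms \<open>k\<^bsup>|P|\<^esup> \<Prod>\<^bsub>i \<in> P\<^esub> X\<^sub>i Y\<^sub>i\<close>
  (\<open>chern_character_eq_sum_oprod\<close>).

  In the integral of such a term against \<open>X\<^sub>S X\<^sub>R q\<^sub>2\<^sup>* b\<close> only \<open>P = {1, \<dots>, n} - S\<close> contributes
  (\<open>integral_wrong_complement\<close>). If \<open>P\<close> meets \<open>S\<close>, a class \<open>X\<^sub>i\<close> occurs twice. If \<open>P\<close> and \<open>S\<close> are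
  disjoint but do not exhaust \<open>{1, \<dots>, n}\<close>, there are fewer than \<open>n\<close> factors \<open>X\<^sub>i\<close> with \<open>i \<le> n\<close>; all
  the other factors come from \<open>B\<close> and have total degree more than \<open>2 n\<close>, which is the rank of \<open>H\<^sub>1(B)\<close>.
  For the surviving \<open>P\<close>,
  \<open>k\<^bsup>|P|\<^esup> (\<Prod>\<^bsub>i \<in> P\<^esub> X\<^sub>i Y\<^sub>i) X\<^sub>S = (-1)\<^bsup>s\<^esup> X\<^sub>n \<dots> X\<^sub>1 Y\<^sub>P\<close>, where \<open>s\<close> is the sum of \<open>i - 1\<close> over \<open>i \<in> S\<close>
  (\<open>complementary_shuffle\<close>); moving \<open>X\<^sub>R\<close> to the front contributes \<open>(-1)\<^bsup>|S| |R|\<^esup>\<close>. Together these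
  are the sign \<open>(-1)\<^sup>\<epsilon>\<close> of \<open>\<beta>\<close>. What is left is the integral over \<open>T\<close> of
  \<open>X\<^sub>R X\<^sub>n \<dots> X\<^sub>1 q\<^sub>2\<^sup>*(l\<^sub>P \<union> b)\<close>, and the condition that fixes the orientation of \<open>T\<close> says exactly that
  it is \<open>\<integral>\<^sub>B x\<^sub>R \<union> l\<^sub>P \<union> b\<close>, up to signs of Poincare duality that cancel (\<open>duality_signs_facts\<close>).

  All sign computations take place in the algebra of all functions on lists with the signed shuffle
  product, which is associative and graded commutative; multilinearity enters through bases and ranks.
\<close>

section \<open>The signed shuffle algebra\<close>

text \<open>
  The recursion for \<open>cup\<close> on the first argument says that contraction with a vector is an
  antiderivation. It makes associativity, graded commutativity and the stability of cohomology under
  \<open>cup\<close> accessible to induction on the list of arguments.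
\<close>

definition contract :: "'v \<Rightarrow> 'v forms \<Rightarrow> 'v forms" where
  "contract v f = (\<lambda>vs. f (v # vs))"

definition parity :: "'v forms \<Rightarrow> 'v forms" where
  "parity f = (\<lambda>vs. (-1) ^ length vs * f vs)"

lemma shuffle_sign_insert_0:
  "shuffle_sign (insert 0 (Suc ` S)) (Suc m) = shuffle_sign S m"
proof -
  have "{(i, j). i \<in> insert 0 (Suc ` S) \<and> j \<in> {..<Suc m} - insert 0 (Suc ` S) \<and> j < i} =
      map_prod Suc Suc ` {(i, j). i \<in> S \<and> j \<in> {..<m} - S \<and> j < i}"
    by (auto simp: lessThan_Suc_eq_insert_0)
  then show ?thesis
    by (simp add: shuffle_sign_def card_image inj_on_def)
qed

lemma shuffle_sign_Suc:
  assumes "S \<subseteq> {..<m}"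
  shows "shuffle_sign (Suc ` S) (Suc m) = (-1) ^ card S * shuffle_sign S m"
proof -
  let ?I = "{(i, j). i \<in> S \<and> j \<in> {..<m} - S \<and> j < i}"
  have fin: "finite S" "finite ?I"
    using assms finite_subset[of S "{..<m}"] finite_subset[of ?I "{..<m} \<times> {..<m}"] by auto
  have "{(i, j). i \<in> Suc ` S \<and> j \<in> {..<Suc m} - Suc ` S \<and> j < i} =
      map_prod Suc Suc ` ?I \<union> (Suc ` S) \<times> {0}"
    using assms by (auto simp: lessThan_Suc_eq_insert_0)
  moreover have "card (map_prod Suc Suc ` ?I \<union> (Suc ` S) \<times> {0}) = card ?I + card S"
    using fin by (subst card_Un_disjoint) (auto simp: card_image inj_on_def card_cartesian_product)
  ultimately show ?thesis
    by (simp add: shuffle_sign_def power_add)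
qed

lemma cup_Nil: "cup f g [] = f [] * g []"
  by (simp add: cup_def shuffle_sign_def)

lemma cup_Cons:
  "cup f g (v # vs) = cup (contract v f) g vs + cup (parity f) (contract v g) vs"
proof -
  let ?m = "length vs"
  let ?t = "\<lambda>S. shuffle_sign S (Suc ?m) * f (nths (v # vs) S) * g (nths (v # vs) (- S))"
  \<comment> \<open>A subset of positions contains the position of \<open>v\<close> or is shifted by one.\<close>
  have Pow: "Pow {..<Suc ?m} = (`) Suc ` Pow {..<?m} \<union> (\<lambda>S. insert 0 (Suc ` S)) ` Pow {..<?m}"
  proof -
    have "Pow (Suc ` {..<?m}) = (`) Suc ` Pow {..<?m}"
      by (rule image_Pow_surj[symmetric]) simp
    then show ?thesis
      by (simp add: lessThan_Suc_eq_insert_0 Pow_insert image_image)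
  qed
  have inj1: "inj_on ((`) Suc) (Pow {..<?m})"
    by (auto intro: inj_onI simp: inj_image_eq_iff)
  have inj2: "inj_on (\<lambda>S. insert 0 (Suc ` S)) (Pow {..<?m})"
    by (auto intro!: inj_onI dest!: insert_ident[THEN iffD1, rotated 2] simp: inj_image_eq_iff)
  have "cup f g (v # vs) = sum ?t (Pow {..<Suc ?m})"
    by (simp add: cup_def)
  also have "\<dots> = (\<Sum>S\<in>Pow {..<?m}. ?t (Suc ` S)) + (\<Sum>S\<in>Pow {..<?m}. ?t (insert 0 (Suc ` S)))"
    unfolding Pow using inj1 inj2
    by (subst sum.union_disjoint) (auto simp: sum.reindex)
  also have "(\<Sum>S\<in>Pow {..<?m}. ?t (insert 0 (Suc ` S))) = cup (contract v f) g vs"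
    unfolding cup_def contract_def
    by (intro sum.cong refl)
      (simp add: shuffle_sign_insert_0 nths_Cons inj_image_mem_iff Compl_eq)
  also have "(\<Sum>S\<in>Pow {..<?m}. ?t (Suc ` S)) = cup (parity f) (contract v g) vs"
    unfolding cup_def contract_def parity_def
  proof (intro sum.cong refl)
    fix S assume "S \<in> Pow {..<?m}"
    then have S: "S \<subseteq> {..<?m}" by simp
    then have "{i. i < ?m \<and> i \<in> S} = S" by auto
    then show "?t (Suc ` S) = shuffle_sign S ?m * ((-1) ^ length (nths vs S) * f (nths vs S)) *
        g (v # nths vs (- S))"
      using S by (simp add: shuffle_sign_Suc nths_Cons length_nths inj_image_mem_iff Compl_eq)
  qed
  finally show ?thesis by simp
qed

lemma cup_add_left: "cup (\<lambda>vs. f vs + g vs) h = (\<lambda>vs. cup f h vs + cup g h vs)"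
  by (simp add: cup_def sum.distrib algebra_simps)

lemma cup_add_right: "cup h (\<lambda>vs. f vs + g vs) = (\<lambda>vs. cup h f vs + cup h g vs)"
  by (simp add: cup_def sum.distrib algebra_simps)

lemma cup_scale_left: "cup (\<lambda>vs. a * f vs) h = (\<lambda>vs. a * cup f h vs)"
  by (simp add: cup_def sum_distrib_left algebra_simps)

lemma cup_scale_right: "cup h (\<lambda>vs. a * f vs) = (\<lambda>vs. a * cup h f vs)"
  by (simp add: cup_def sum_distrib_left algebra_simps)

lemma contract_parity: "contract v (parity f) = (\<lambda>vs. - parity (contract v f) vs)"
  by (simp add: contract_def parity_def)

lemma contract_cup:
  "contract v (cup f g) = (\<lambda>vs. cup (contract v f) g vs + cup (parity f) (contract v g) vs)"
  by (rule ext) (subst contract_def, rule cup_Cons)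

lemma cup_uminus_left: "cup (\<lambda>vs. - f vs) g = (\<lambda>vs. - cup f g vs)"
  using cup_scale_left[of "-1" f g] by simp

lemma cup_uminus_right: "cup g (\<lambda>vs. - f vs) = (\<lambda>vs. - cup g f vs)"
  using cup_scale_right[of g "-1" f] by simp

lemma parity_parity [simp]: "parity (parity f) = f"
  by (simp add: parity_def flip: mult.assoc power_mult_distrib)

lemma cup_parity: "cup (parity f) (parity g) = parity (cup f g)"
proof
  show "cup (parity f) (parity g) vs = parity (cup f g) vs" for vs
  proof (induction vs arbitrary: f g)
    case Nil
    then show ?case by (simp add: cup_Nil parity_def)
  next
    case (Cons v vs)
    have "cup (parity f) (parity g) (v # vs) =
        - (cup (parity (contract v f)) (parity g) vs + cup (parity (parity f)) (parity (contract v g)) vs)"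
      by (simp add: cup_Cons contract_parity cup_uminus_left cup_uminus_right del: parity_parity)
    also have "\<dots> = parity (cup f g) (v # vs)"
      unfolding Cons.IH by (simp add: parity_def cup_Cons algebra_simps)
    finally show ?case .
  qed
qed

lemma cup_assoc: "cup (cup f g) h = cup f (cup g h)"
proof
  show "cup (cup f g) h vs = cup f (cup g h) vs" for vs
    by (induction vs arbitrary: f g h)
      (simp_all add: cup_Nil cup_Cons contract_cup cup_add_left cup_add_right flip: cup_parity)
qed

lemma cup_unit_left: "cup unit_class f = f"
proof
  have z: "cup (\<lambda>vs. 0) g = (\<lambda>vs. 0)" for g :: "'a forms"
    by (simp add: cup_def)
  have u: "parity unit_class = (unit_class :: 'a forms)" "contract v unit_class = (\<lambda>vs. 0)" for v :: 'a
    by (auto simp: parity_def unit_class_def contract_def)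
  show "cup unit_class f vs = f vs" for vs
    by (induction vs arbitrary: f) (simp_all add: cup_Nil cup_Cons u z, simp_all add: unit_class_def contract_def)
qed

lemma cup_unit_right: "cup f unit_class = f"
proof
  have z: "cup g (\<lambda>vs. 0) = (\<lambda>vs. 0)" for g :: "'a forms"
    by (simp add: cup_def)
  have u: "contract v unit_class = (\<lambda>vs. 0)" for v :: 'a
    by (auto simp: unit_class_def contract_def)
  show "cup f unit_class vs = f vs" for vs
    by (induction vs arbitrary: f) (simp_all add: cup_Nil cup_Cons u z, simp_all add: unit_class_def contract_def)
qed

text \<open>
  The type is a copy of the forms on which \<open>cup\<close> is the multiplication, so that the laws of rings and
  the operations \<open>(^)\<close> and \<open>prod_list\<close> are available.
\<close>

typedef 'v shuffle_algebra = "UNIV :: 'v forms set"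
  morphisms form cls by simp

setup_lifting type_definition_shuffle_algebra

lemma form_eqI: "(\<And>vs. form a vs = form b vs) \<Longrightarrow> a = b"
  by (metis ext form_inverse)

instantiation shuffle_algebra :: (type) real_algebra_1
begin

lift_definition zero_shuffle_algebra :: "'a shuffle_algebra" is "\<lambda>vs. 0" .
lift_definition one_shuffle_algebra :: "'a shuffle_algebra" is unit_class .
lift_definition plus_shuffle_algebra :: "'a shuffle_algebra \<Rightarrow> 'a shuffle_algebra \<Rightarrow> 'a shuffle_algebra"
  is "\<lambda>f g vs. f vs + g vs" .
lift_definition minus_shuffle_algebra :: "'a shuffle_algebra \<Rightarrow> 'a shuffle_algebra \<Rightarrow> 'a shuffle_algebra"
  is "\<lambda>f g vs. f vs - g vs" .
lift_definition uminus_shuffle_algebra :: "'a shuffle_algebra \<Rightarrow> 'a shuffle_algebra"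
  is "\<lambda>f vs. - f vs" .
lift_definition times_shuffle_algebra :: "'a shuffle_algebra \<Rightarrow> 'a shuffle_algebra \<Rightarrow> 'a shuffle_algebra"
  is cup .
lift_definition scaleR_shuffle_algebra :: "real \<Rightarrow> 'a shuffle_algebra \<Rightarrow> 'a shuffle_algebra"
  is "\<lambda>r f vs. r * f vs" .

instance
proof
  show "(0 :: 'a shuffle_algebra) \<noteq> 1"
    by transfer (metis unit_class_def zero_neq_one)
qed (transfer; simp add: algebra_simps cup_assoc cup_add_left cup_add_right cup_unit_left
    cup_unit_right cup_scale_left cup_scale_right)+

end

lemmas form_simps = zero_shuffle_algebra.rep_eq plus_shuffle_algebra.rep_eq
  minus_shuffle_algebra.rep_eq uminus_shuffle_algebra.rep_eq scaleR_shuffle_algebra.rep_eq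

lemma form_sum: "form (sum a A) vs = (\<Sum>i\<in>A. form (a i) vs)"
  by (induction A rule: infinite_finite_induct) (simp_all add: form_simps)

lemma cls_cup: "cls (cup f g) = cls f * cls g"
  by (simp add: times_shuffle_algebra.abs_eq)

lemma cls_cups: "cls (cups fs) = prod_list (map cls fs)"
  by (induction fs) (simp_all add: cups_def cls_cup one_shuffle_algebra_def)

lemma form_cls [simp]: "form (cls f) = f"
  by (simp add: cls_inverse)

lemma cls_form [simp]: "cls (form a) = a"
  by (rule form_inverse)

definition homog :: "nat \<Rightarrow> 'v shuffle_algebra \<Rightarrow> bool" where
  "homog d a \<longleftrightarrow> (\<forall>vs. length vs \<noteq> d \<longrightarrow> form a vs = 0)"

lemma length_nths_Compl: "length (nths vs S) + length (nths vs (- S)) = length vs"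
proof -
  have "{i. i < length vs \<and> i \<in> S} \<union> {i. i < length vs \<and> i \<in> - S} = {..<length vs}" by auto
  moreover have "{i. i < length vs \<and> i \<in> S} \<inter> {i. i < length vs \<and> i \<in> - S} = {}" by auto
  ultimately show ?thesis
    unfolding length_nths by (subst card_Un_disjoint[symmetric]) auto
qed

lemma homog_mult:
  assumes "homog d a" "homog e b" shows "homog (d + e) (a * b)"
  unfolding homog_def times_shuffle_algebra.rep_eq cup_def
proof (intro allI impI sum.neutral ballI)
  fix vs :: "'a list" and S assume vs: "length vs \<noteq> d + e"
  note length_nths_Compl[of vs S]
  with vs assms show "shuffle_sign S (length vs) * form a (nths vs S) * form b (nths vs (- S)) = 0"
    unfolding homog_def by (cases "length (nths vs S) = d") auto
qed

lemma homog_1: "homog 0 1"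
  by (simp add: homog_def one_shuffle_algebra.rep_eq unit_class_def)

lemma homog_prod_list:
  "(\<And>i. i \<in> set is \<Longrightarrow> homog (Suc 0) (c i)) \<Longrightarrow> homog (length is) (prod_list (map c is))"
proof (induction "is")
  case (Cons i "is")
  then show ?case using homog_mult[of 1 "c i" "length is" "prod_list (map c is)"] by simp
qed (simp add: homog_1)

text \<open>
  Contracting both sides with the first argument reduces the degree of one of the factors. The two
  terms of the antiderivation rule are exchanged, with the signs \<open>(-1)\<^sup>d\<close> and \<open>(-1)\<^sup>e\<close>.
\<close>

lemma homog_commute:
  assumes "homog d a" "homog e b"
  shows "a * b = (-1) ^ (d * e) *\<^sub>R (b * a)"
proof -
  have cup0: "cup (\<lambda>vs. 0) g = (\<lambda>vs. 0)" "cup g (\<lambda>vs. 0) = (\<lambda>vs. 0)" for g :: "'a forms"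
    by (simp_all add: cup_def)
  have *: "cup f g vs = (-1) ^ (d * e) * cup g f vs"
    if "\<And>vs. length vs \<noteq> d \<Longrightarrow> f vs = 0" "\<And>vs. length vs \<noteq> e \<Longrightarrow> g vs = 0"
    for f g :: "'a forms" and vs
    using that
  proof (induction vs arbitrary: f g d e)
    case Nil
    then show ?case by (cases "d = 0 \<or> e = 0") (auto simp: cup_Nil)
  next
    case (Cons v vs)
    have pf: "parity f = (\<lambda>vs. (-1) ^ d * f vs)" "parity g = (\<lambda>vs. (-1) ^ e * g vs)"
      unfolding parity_def using Cons.prems by (metis mult_zero_right)+
    have c0: "contract v f = (\<lambda>vs. 0)" if "d = 0"
      unfolding contract_def using Cons.prems(1) that by auto
    have c0': "contract v g = (\<lambda>vs. 0)" if "e = 0"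
      unfolding contract_def using Cons.prems(2) that by auto
    have 1: "cup (contract v f) g vs = (-1) ^ (d * e) * ((-1) ^ e * cup g (contract v f) vs)"
    proof (cases d)
      case 0
      then show ?thesis by (simp add: c0 cup0)
    next
      case (Suc d')
      have "cup (contract v f) g vs = (-1) ^ (d' * e) * cup g (contract v f) vs"
        using Cons.prems Suc by (intro Cons.IH) (auto simp: contract_def)
      then show ?thesis by (simp add: Suc power_add flip: mult.assoc power_mult_distrib)
    qed
    have 2: "(-1) ^ d * cup f (contract v g) vs = (-1) ^ (d * e) * cup (contract v g) f vs"
    proof (cases e)
      case 0
      then show ?thesis by (simp add: c0' cup0)
    next
      case (Suc e')
      have "cup f (contract v g) vs = (-1) ^ (d * e') * cup (contract v g) f vs"
        using Cons.prems Suc by (intro Cons.IH) (auto simp: contract_def)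
      then show ?thesis by (simp add: Suc power_add)
    qed
    show ?case
      unfolding cup_Cons pf cup_scale_left using 1 2 by (simp add: algebra_simps)
  qed
  show ?thesis
    using assms
    by (intro form_eqI) (simp add: times_shuffle_algebra.rep_eq scaleR_shuffle_algebra.rep_eq homog_def *)
qed

lemma homog_1_square:
  assumes "homog (Suc 0) a" shows "a * a = 0"
proof -
  have "a * a = - (a * a)" using homog_commute[OF assms assms] by simp
  then have "2 *\<^sub>R (a * a) = 0" by (metis add.right_inverse scaleR_2)
  then show ?thesis by simp
qed

section \<open>Lattices and coefficient rings\<close>

definition add_subgroup :: "'v::ab_group_add set \<Rightarrow> bool" where
  "add_subgroup \<Gamma> \<longleftrightarrow> 0 \<in> \<Gamma> \<and> (\<forall>x\<in>\<Gamma>. \<forall>y\<in>\<Gamma>. x - y \<in> \<Gamma>)"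

text \<open>
  Coefficients \<open>\<int>\<close> and \<open>\<rat>\<close> occur in the cohomology of the tori; \<open>UNIV\<close> serves to compare classes with
  different coefficients.
\<close>

definition coeff_ring :: "real set \<Rightarrow> bool" where
  "coeff_ring R \<longleftrightarrow> add_subgroup R \<and> 1 \<in> R \<and> (\<forall>x\<in>R. \<forall>y\<in>R. x * y \<in> R)"

lemma add_subgroup_uminus: "add_subgroup \<Gamma> \<Longrightarrow> x \<in> \<Gamma> \<Longrightarrow> - x \<in> \<Gamma>"
  unfolding add_subgroup_def by (metis diff_0)

lemma add_subgroup_add: "add_subgroup \<Gamma> \<Longrightarrow> x \<in> \<Gamma> \<Longrightarrow> y \<in> \<Gamma> \<Longrightarrow> x + y \<in> \<Gamma>"
  using add_subgroup_uminus[of \<Gamma> y] unfolding add_subgroup_def by (metis diff_minus_eq_add)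

lemma add_subgroup_sum: "add_subgroup \<Gamma> \<Longrightarrow> (\<And>i. i \<in> A \<Longrightarrow> g i \<in> \<Gamma>) \<Longrightarrow> sum g A \<in> \<Gamma>"
  by (induction A rule: infinite_finite_induct)
    (auto intro: add_subgroup_add simp: add_subgroup_def[THEN iffD1, THEN conjunct1])

lemma zbasis_add_subgroup:
  assumes "zbasis \<Gamma> bs" shows "add_subgroup \<Gamma>"
proof -
  define L where "L = (\<lambda>c :: nat \<Rightarrow> int. \<Sum>i<length bs. of_int (c i) *\<^sub>R bs ! i)"
  have "L (\<lambda>i. 0) = 0" by (simp add: L_def)
  moreover have "L c - L d = L (\<lambda>i. c i - d i)" for c d
    by (simp add: L_def sum_subtractf algebra_simps)
  moreover have "\<Gamma> = range L" using assms by (simp add: zbasis_def L_def)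
  ultimately show ?thesis
    unfolding add_subgroup_def by (auto simp: image_iff)
qed

lemma coeff_rings: "coeff_ring \<int>" "coeff_ring \<rat>" "coeff_ring UNIV"
  by (auto simp: coeff_ring_def add_subgroup_def)

lemma coeff_ring_sign: "coeff_ring R \<Longrightarrow> (-1) ^ k \<in> R"
  by (cases "even k") (auto simp: coeff_ring_def add_subgroup_uminus)

section \<open>The cohomology ring\<close>

lemma cohomology_mono: "R \<subseteq> R' \<Longrightarrow> cohomology R \<Gamma> \<subseteq> cohomology R' \<Gamma>"
  by (auto simp: cohomology_def)

lemma cohomology_val: "f \<in> cohomology R \<Gamma> \<Longrightarrow> f vs \<in> R"
  and cohomology_outside: "f \<in> cohomology R \<Gamma> \<Longrightarrow> \<not> set vs \<subseteq> \<Gamma> \<Longrightarrow> f vs = 0"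
  and cohomology_alternating: "f \<in> cohomology R \<Gamma> \<Longrightarrow> \<not> distinct vs \<Longrightarrow> f vs = 0"
  by (auto simp: cohomology_def)

lemma cohomology_add_arg:
  assumes "add_subgroup \<Gamma>" "f \<in> cohomology R \<Gamma>" "x \<in> \<Gamma>" "y \<in> \<Gamma>"
  shows "f (us @ (x + y) # ws) = f (us @ x # ws) + f (us @ y # ws)"
proof (cases "set us \<subseteq> \<Gamma> \<and> set ws \<subseteq> \<Gamma>")
  case True
  then show ?thesis using assms by (auto simp: cohomology_def)
next
  case False
  then have "f (us @ z # ws) = 0" for z
    by (intro cohomology_outside[OF assms(2)]) auto
  then show ?thesis by simp
qed

text \<open>
  Vanishing on adjacent equal arguments is stable under the recursion for \<open>cup\<close>, whereas vanishing on
  arbitrary repetitions is not visibly so. For additive functions the former gives the latter, because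
  expanding \<open>f(\<dots>, a + b, a + b, \<dots>) = 0\<close> allows adjacent arguments to be exchanged.
\<close>

lemma adjacent_swap:
  fixes f :: "'v::ab_group_add forms"
  assumes G: "add_subgroup \<Gamma>"
    and outside: "\<And>vs. \<not> set vs \<subseteq> \<Gamma> \<Longrightarrow> f vs = 0"
    and adj: "\<And>us v ws. f (us @ v # v # ws) = 0"
    and add: "\<And>us x y ws. x \<in> \<Gamma> \<Longrightarrow> y \<in> \<Gamma> \<Longrightarrow> f (us @ (x + y) # ws) = f (us @ x # ws) + f (us @ y # ws)"
  shows "f (us @ a # b # ws) = - f (us @ b # a # ws)"
proof (cases "a \<in> \<Gamma> \<and> b \<in> \<Gamma>")
  case True
  then have ab: "a \<in> \<Gamma>" "b \<in> \<Gamma>" "a + b \<in> \<Gamma>" using add_subgroup_add[OF G] by auto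
  have "0 = f (us @ (a + b) # (a + b) # ws)" by (simp add: adj)
  also have "\<dots> = f (us @ a # (a + b) # ws) + f (us @ b # (a + b) # ws)"
    using ab add[of a b us] by simp
  also have "\<dots> = f (us @ a # b # ws) + f (us @ b # a # ws)"
    using ab add[of a b "us @ [a]"] add[of a b "us @ [b]"] by (simp add: adj)
  finally show ?thesis by simp
next
  case False
  then show ?thesis by (subst (1 2) outside) auto
qed

lemma cohomologyI:
  assumes G: "add_subgroup \<Gamma>"
    and val: "\<And>vs. f vs \<in> R"
    and outside: "\<And>vs. \<not> set vs \<subseteq> \<Gamma> \<Longrightarrow> f vs = 0"
    and adj: "\<And>us v ws. f (us @ v # v # ws) = 0"
    and add: "\<And>us x y ws. x \<in> \<Gamma> \<Longrightarrow> y \<in> \<Gamma> \<Longrightarrow> f (us @ (x + y) # ws) = f (us @ x # ws) + f (us @ y # ws)"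
  shows "f \<in> cohomology R \<Gamma>"
proof -
  note swap = adjacent_swap[OF G outside adj add]
  have rep: "f (us @ v # ms @ v # ws) = 0" for us v ms ws
  proof (induction ms arbitrary: us)
    case Nil
    then show ?case by (simp add: adj)
  next
    case (Cons m ms)
    have "f (us @ v # (m # ms) @ v # ws) = - f ((us @ [m]) @ v # ms @ v # ws)"
      using swap[of us v m] by simp
    then show ?case using Cons[of "us @ [m]"] by simp
  qed
  have "f vs = 0" if "\<not> distinct vs" for vs
    using not_distinct_decomp[OF that] rep by auto
  then show ?thesis
    using val outside add by (auto simp: cohomology_def)
qed

lemma cohomology_contract:
  assumes "f \<in> cohomology R \<Gamma>" "coeff_ring R"
  shows "contract u f \<in> cohomology R \<Gamma>"
proof (cases "u \<in> \<Gamma>")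
  case True
  have "f (u # us @ (x + y) # ws) = f (u # us @ x # ws) + f (u # us @ y # ws)"
    if "set us \<subseteq> \<Gamma>" "set ws \<subseteq> \<Gamma>" "x \<in> \<Gamma>" "y \<in> \<Gamma>" for us ws x y
  proof -
    have "\<forall>us ws. set us \<subseteq> \<Gamma> \<longrightarrow> set ws \<subseteq> \<Gamma> \<longrightarrow> (\<forall>x\<in>\<Gamma>. \<forall>y\<in>\<Gamma>.
        f (us @ (x + y) # ws) = f (us @ x # ws) + f (us @ y # ws))"
      using assms(1) by (simp add: cohomology_def)
    from this[rule_format, of "u # us" ws x y] that True show ?thesis by simp
  qed
  then show ?thesis using assms(1) by (auto simp: cohomology_def contract_def)
next
  case False
  then have "contract u f = (\<lambda>vs. 0)"
    using assms(1) by (auto simp: cohomology_def contract_def)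
  then show ?thesis using assms(2) by (auto simp: cohomology_def coeff_ring_def add_subgroup_def)
qed

lemma cohomology_parity:
  "f \<in> cohomology R \<Gamma> \<Longrightarrow> coeff_ring R \<Longrightarrow> parity f \<in> cohomology R \<Gamma>"
  using coeff_ring_sign[of R] by (auto simp: cohomology_def parity_def coeff_ring_def algebra_simps)

lemma cup_outside:
  assumes "\<And>vs. \<not> set vs \<subseteq> \<Gamma> \<Longrightarrow> f vs = 0" "\<And>vs. \<not> set vs \<subseteq> \<Gamma> \<Longrightarrow> g vs = 0" "\<not> set vs \<subseteq> \<Gamma>"
  shows "cup f g vs = 0"
  unfolding cup_def
proof (intro sum.neutral ballI)
  fix S
  from assms(3) obtain i where i: "i < length vs" "vs ! i \<notin> \<Gamma>"
    by (metis in_set_conv_nth subsetI)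
  then have "vs ! i \<in> set (nths vs S) \<or> vs ! i \<in> set (nths vs (- S))"
    by (auto simp: set_nths)
  with i have "f (nths vs S) = 0 \<or> g (nths vs (- S)) = 0"
    using assms(1,2) by blast
  then show "shuffle_sign S (length vs) * f (nths vs S) * g (nths vs (- S)) = 0" by auto
qed

lemma cup_adjacent_equal:
  assumes "\<And>us v ws. f (us @ v # v # ws) = 0" "\<And>us v ws. g (us @ v # v # ws) = 0"
  shows "cup f g (us @ v # v # ws) = 0"
  using assms
proof (induction us arbitrary: f g)
  case Nil
  have "contract v (contract v f) = (\<lambda>vs. 0)" "contract v (contract v g) = (\<lambda>vs. 0)"
    using Nil(1)[of "[]"] Nil(2)[of "[]"] by (simp_all add: contract_def)
  then show ?case
    by (simp add: cup_Cons contract_parity cup_uminus_left) (simp add: cup_def)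
next
  case (Cons u us)
  have "cup (contract u f) g (us @ v # v # ws) = 0"
    using Cons.prems(1)[of "u # _"] Cons.prems(2) by (intro Cons.IH) (auto simp: contract_def)
  moreover have "cup (parity f) (contract u g) (us @ v # v # ws) = 0"
    using Cons.prems(1) Cons.prems(2)[of "u # _"]
    by (intro Cons.IH) (auto simp: contract_def parity_def)
  ultimately show ?case by (simp add: cup_Cons)
qed

lemma cohomology_cup:
  assumes G: "add_subgroup \<Gamma>" and R: "coeff_ring R"
    and f: "f \<in> cohomology R \<Gamma>" and g: "g \<in> cohomology R \<Gamma>"
  shows "cup f g \<in> cohomology R \<Gamma>"
proof (rule cohomologyI[OF G])
  show "cup f g vs \<in> R" for vs
    unfolding cup_def
  proof (rule add_subgroup_sum)
    show "add_subgroup R" using R by (simp add: coeff_ring_def)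
    show "shuffle_sign S (length vs) * f (nths vs S) * g (nths vs (- S)) \<in> R" for S
      using coeff_ring_sign[OF R] R cohomology_val[OF f] cohomology_val[OF g]
      unfolding shuffle_sign_def coeff_ring_def by blast
  qed
  show "cup f g vs = 0" if "\<not> set vs \<subseteq> \<Gamma>" for vs
    using that by (rule cup_outside[rotated 2]) (use f g in \<open>auto simp: cohomology_def\<close>)
  show "cup f g (us @ v # v # ws) = 0" for us v ws
    by (rule cup_adjacent_equal) (use f g in \<open>auto simp: cohomology_def\<close>)
  show "cup f g (us @ (x + y) # ws) = cup f g (us @ x # ws) + cup f g (us @ y # ws)"
    if "x \<in> \<Gamma>" "y \<in> \<Gamma>" for us x y ws
    using f g
  proof (induction us arbitrary: f g)
    case Nil
    have *: "contract (x + y) h = (\<lambda>vs. contract x h vs + contract y h vs)"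
      if "h \<in> cohomology R \<Gamma>" for h
      using cohomology_add_arg[OF G that \<open>x \<in> \<Gamma>\<close> \<open>y \<in> \<Gamma>\<close>, of "[]"] by (simp add: contract_def)
    show ?case
      by (simp add: cup_Cons *[OF Nil(1)] *[OF Nil(2)] cup_add_left cup_add_right)
  next
    case (Cons u us)
    show ?case
      using Cons.IH[OF cohomology_contract[OF Cons.prems(1) R] Cons.prems(2)]
        Cons.IH[OF cohomology_parity[OF Cons.prems(1) R] cohomology_contract[OF Cons.prems(2) R]]
      by (simp add: cup_Cons)
  qed
qed

lemma cohomology_unit:
  "coeff_ring R \<Longrightarrow> unit_class \<in> cohomology R \<Gamma>"
  by (auto simp: cohomology_def unit_class_def coeff_ring_def add_subgroup_def)

lemma cohomology_cups:
  assumes "add_subgroup \<Gamma>" "coeff_ring R" "\<And>f. f \<in> set fs \<Longrightarrow> f \<in> cohomology R \<Gamma>"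
  shows "cups fs \<in> cohomology R \<Gamma>"
  using assms(3) by (induction fs) (auto simp: cups_def cohomology_unit cohomology_cup assms(1,2))

lemma cohomology_zero: "coeff_ring R \<Longrightarrow> (\<lambda>vs. 0) \<in> cohomology R \<Gamma>"
  by (auto simp: cohomology_def coeff_ring_def add_subgroup_def)

lemma cohomology_add:
  "coeff_ring R \<Longrightarrow> f \<in> cohomology R \<Gamma> \<Longrightarrow> g \<in> cohomology R \<Gamma> \<Longrightarrow> (\<lambda>vs. f vs + g vs) \<in> cohomology R \<Gamma>"
  by (auto simp: cohomology_def coeff_ring_def add_subgroup_add)

lemma cohomology_scale:
  "coeff_ring R \<Longrightarrow> r \<in> R \<Longrightarrow> f \<in> cohomology R \<Gamma> \<Longrightarrow> (\<lambda>vs. r * f vs) \<in> cohomology R \<Gamma>"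
  by (auto simp: cohomology_def coeff_ring_def algebra_simps)

lemma cohomology_sum:
  "coeff_ring R \<Longrightarrow> (\<And>i. i \<in> A \<Longrightarrow> f i \<in> cohomology R \<Gamma>) \<Longrightarrow>
    (\<lambda>vs. \<Sum>i\<in>A. f i vs) \<in> cohomology R \<Gamma>"
  by (induction A rule: infinite_finite_induct) (auto simp: cohomology_zero cohomology_add)

lemma cohomology_move:
  assumes "f \<in> cohomology R \<Gamma>" "add_subgroup \<Gamma>"
  shows "f (us @ ms @ v # ws) = (-1) ^ length ms * f (us @ v # ms @ ws)"
proof (induction ms arbitrary: us)
  case (Cons m ms)
  have "f (us @ m # v # ms @ ws) = - f (us @ v # m # ms @ ws)"
    by (rule adjacent_swap[OF assms(2) cohomology_outside[OF assms(1)]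
        cohomology_alternating[OF assms(1)] cohomology_add_arg[OF assms(2,1)]]) simp_all
  then show ?case using Cons[of "us @ [m]"] by simp
qed simp

text \<open>
  Permuting the arguments of a class changes at most the sign of its value. This leads from arbitrary
  lists of basis vectors to increasing ones.
\<close>

lemma cohomology_permute_eq_0:
  assumes f: "f \<in> cohomology R \<Gamma>" "add_subgroup \<Gamma>" and "mset vs = mset ws"
  shows "f (us @ vs) = 0 \<longleftrightarrow> f (us @ ws) = 0"
  using assms(3)
proof (induction vs arbitrary: us ws)
  case (Cons v vs)
  then have "v \<in> set ws" by (metis list.set_intros(1) mset_eq_setD)
  then obtain ws1 ws2 where ws: "ws = ws1 @ v # ws2" by (meson split_list)
  have "f (us @ ws) = 0 \<longleftrightarrow> f ((us @ [v]) @ (ws1 @ ws2)) = 0"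
    unfolding ws using cohomology_move[OF f, of us ws1 v ws2] by simp
  also have "\<dots> \<longleftrightarrow> f ((us @ [v]) @ vs) = 0"
    using Cons.prems ws by (intro Cons.IH[symmetric]) simp
  finally show ?case by simp
qed simp

lemma zbasis_subset:
  assumes zb: "zbasis \<Gamma> bs" shows "set bs \<subseteq> \<Gamma>"
proof
  fix b assume "b \<in> set bs"
  then obtain j where j: "j < length bs" "b = bs ! j" by (auto simp: in_set_conv_nth)
  then have "b = (\<Sum>i<length bs. of_int (if i = j then 1 else 0) *\<^sub>R bs ! i)"
    by (simp add: if_distrib[of of_int] if_distrib[of "\<lambda>c. c *\<^sub>R _"] cong: if_cong)
  then have "b \<in> range (\<lambda>c :: nat \<Rightarrow> int. \<Sum>i<length bs. of_int (c i) *\<^sub>R bs ! i)"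
    by (rule range_eqI[where x = "\<lambda>i. if i = j then 1 else 0"])
  then show "b \<in> \<Gamma>" using zb by (simp add: zbasis_def)
qed

lemma additive_zero_on_basis:
  assumes zb: "zbasis \<Gamma> bs" and add: "\<And>x y. x \<in> \<Gamma> \<Longrightarrow> y \<in> \<Gamma> \<Longrightarrow> g (x + y) = g x + (g y :: real)"
    and b0: "\<And>b. b \<in> set bs \<Longrightarrow> g b = 0" and x: "x \<in> \<Gamma>"
  shows "g x = 0"
proof -
  note G = zbasis_add_subgroup[OF zb]
  define L where "L = (\<lambda>c :: nat \<Rightarrow> int. \<Sum>i<length bs. of_int (c i) *\<^sub>R bs ! i)"
  have GL: "\<Gamma> = range L" using zb by (simp add: zbasis_def L_def)
  have 0: "0 \<in> \<Gamma>" "g 0 = 0" using add[of 0 0] G by (auto simp: add_subgroup_def)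
  have uminus: "g (- y) = - g y" if "y \<in> \<Gamma>" for y
    using add[of y "- y"] that 0 add_subgroup_uminus[OF G that] by simp
  have bG: "b \<in> \<Gamma>" if "b \<in> set bs" for b
    using that zbasis_subset[OF zb] by blast
  have nat: "of_nat k *\<^sub>R b \<in> \<Gamma> \<and> g (of_nat k *\<^sub>R b) = 0" if "b \<in> set bs" for b k
    by (induction k) (use that in \<open>auto simp: 0 algebra_simps add bG b0 add_subgroup_add[OF G]\<close>)
  have int: "of_int k *\<^sub>R b \<in> \<Gamma> \<and> g (of_int k *\<^sub>R b) = 0" if "b \<in> set bs" for b and k :: int
    using nat[OF that, of "nat k"] nat[OF that, of "nat (- k)"]
      uminus[of "of_nat (nat (- k)) *\<^sub>R b"] add_subgroup_uminus[OF G, of "of_nat (nat (- k)) *\<^sub>R b"]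
    by (cases "k \<ge> 0") auto
  obtain c where c: "x = L c" using x GL by auto
  have "(\<Sum>i\<in>A. of_int (c i) *\<^sub>R bs ! i) \<in> \<Gamma> \<and> g (\<Sum>i\<in>A. of_int (c i) *\<^sub>R bs ! i) = 0"
    if "A \<subseteq> {..<length bs}" for A
    using that
    by (induction A rule: infinite_finite_induct)
      (auto simp: 0 int add intro!: add_subgroup_add[OF G])
  from this[of "{..<length bs}"] show ?thesis by (simp add: c L_def)
qed

text \<open>
  A class is determined by its values on increasing lists of basis vectors: additivity in each slot
  reduces to lists of basis vectors, and these have a repetition or can be sorted.
\<close>

lemma cohomology_eq_0I:
  fixes e :: "nat \<Rightarrow> 'v::real_vector"
  assumes f: "f \<in> cohomology R \<Gamma>" and zb: "zbasis \<Gamma> (map e is)"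
    and f0: "\<And>qs. sorted_wrt (<) qs \<Longrightarrow> set qs \<subseteq> set is \<Longrightarrow> f (map e qs) = 0"
  shows "f vs = 0"
proof -
  note G = zbasis_add_subgroup[OF zb]
  have basis: "f vs = 0" if vs: "set vs \<subseteq> set (map e is)" for vs
  proof (cases "distinct vs")
    case True
    have dist: "distinct (map e is)" using zb by (simp add: zbasis_def)
    define qs where "qs = sorted_list_of_set {i \<in> set is. e i \<in> set vs}"
    have qs: "sorted_wrt (<) qs" "set qs = {i \<in> set is. e i \<in> set vs}" "distinct qs"
      by (auto simp: qs_def)
    have "distinct (map e qs)" "set (map e qs) = set vs"
      using dist vs qs by (auto simp: distinct_map intro: inj_on_subset)
    then have "mset vs = mset (map e qs)"
      using True set_eq_iff_mset_eq_distinct by metis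
    then show ?thesis
      using cohomology_permute_eq_0[OF f G, of vs "map e qs" "[]"] f0[OF qs(1)] qs(2) by auto
  next
    case False
    then show ?thesis by (rule cohomology_alternating[OF f])
  qed
  \<comment> \<open>From the right to the left, arbitrary arguments are replaced by basis vectors.\<close>
  have "f (us @ ws) = 0" if "set us \<subseteq> \<Gamma>" "set ws \<subseteq> set (map e is)" for us ws
    using that
  proof (induction us arbitrary: ws rule: rev_induct)
    case Nil
    then show ?case by (simp add: basis)
  next
    case (snoc u us)
    have "f (us @ u # ws) = 0"
    proof (rule additive_zero_on_basis[OF zb, of "\<lambda>u. f (us @ u # ws)"])
      show "f (us @ (x + y) # ws) = f (us @ x # ws) + f (us @ y # ws)" if "x \<in> \<Gamma>" "y \<in> \<Gamma>" for x y
        using cohomology_add_arg[OF G f that] .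
      show "f (us @ b # ws) = 0" if "b \<in> set (map e is)" for b
        using snoc.IH[of "b # ws"] snoc.prems that by simp
      show "u \<in> \<Gamma>" using snoc.prems by simp
    qed
    then show ?case by simp
  qed
  from this[of vs "[]"] show ?thesis
    using cohomology_outside[OF f] by (cases "set vs \<subseteq> \<Gamma>") auto
qed

section \<open>Dual bases and monomials\<close>

text \<open>
  The class of degree one given by a function \<open>w\<close> on the lattice, for lattices in spaces without a norm
  as well.
\<close>

definition linear_class :: "'v set \<Rightarrow> ('v \<Rightarrow> real) \<Rightarrow> 'v forms" where
  "linear_class \<Gamma> w = (\<lambda>vs. case vs of [v] \<Rightarrow> if v \<in> \<Gamma> then w v else 0 | _ \<Rightarrow> 0)"

lemma class1_eq_linear_class: "class1 \<Gamma> w = linear_class \<Gamma> (blinfun_apply w)"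
  by (simp add: class1_def linear_class_def)

lemma linear_class_simps [simp]:
  "linear_class \<Gamma> w [] = 0" "linear_class \<Gamma> w (u # v # vs) = 0"
  "linear_class \<Gamma> w [v] = (if v \<in> \<Gamma> then w v else 0)"
  by (simp_all add: linear_class_def)

lemma homog_linear_class: "homog (Suc 0) (cls (linear_class \<Gamma> w))"
  unfolding homog_def by (auto simp: linear_class_def split: list.split)

lemma linear_class_cohomology:
  assumes G: "add_subgroup \<Gamma>" and "coeff_ring R"
    and "\<And>x y. x \<in> \<Gamma> \<Longrightarrow> y \<in> \<Gamma> \<Longrightarrow> w (x + y) = w x + w y" and "\<And>x. x \<in> \<Gamma> \<Longrightarrow> w x \<in> R"
  shows "linear_class \<Gamma> w \<in> cohomology R \<Gamma>"
proof (rule cohomologyI[OF G])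
  have 0: "0 \<in> R" using assms(2) by (simp add: coeff_ring_def add_subgroup_def)
  show "linear_class \<Gamma> w vs \<in> R" for vs
    using assms 0 by (auto simp: linear_class_def split: list.split)
  show "linear_class \<Gamma> w vs = 0" if "\<not> set vs \<subseteq> \<Gamma>" for vs
    using that by (auto simp: linear_class_def split: list.split)
  show "linear_class \<Gamma> w (us @ v # v # ws) = 0" for us v ws
    by (auto simp: linear_class_def Cons_eq_append_conv split: list.split)
  show "linear_class \<Gamma> w (us @ (x + y) # ws) = linear_class \<Gamma> w (us @ x # ws) + linear_class \<Gamma> w (us @ y # ws)"
    if xy: "x \<in> \<Gamma>" "y \<in> \<Gamma>" for us x y ws
  proof (cases "us = [] \<and> ws = []")
    case True
    then show ?thesis using xy assms(3) add_subgroup_add[OF G] by simp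
  next
    case False
    then have "length (us @ z # ws) \<noteq> Suc 0" for z by auto
    then have "linear_class \<Gamma> w (us @ z # ws) = 0" for z
      using homog_linear_class[of \<Gamma> w] unfolding homog_def by simp
    then show ?thesis by simp
  qed
qed

lemma cup_homog_1_Cons:
  assumes "homog (Suc 0) (cls a)"
  shows "cup a f (v # vs) = a [v] * f vs - cup a (contract v f) vs"
proof -
  have len: "a us = 0" if "length us \<noteq> Suc 0" for us
    using assms that by (simp add: homog_def)
  have 1: "contract v a = (\<lambda>us. a [v] * unit_class us)"
    by (auto simp: contract_def unit_class_def len)
  have 2: "parity a = (\<lambda>us. - a us)"
  proof
    show "parity a us = - a us" for us
      by (cases "length us = Suc 0") (auto simp: parity_def len)
  qed
  show ?thesis
    by (simp add: cup_Cons 1 2 cup_uminus_left cup_scale_left cup_unit_left)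
qed

lemma contract_cup_homog_1:
  "homog (Suc 0) (cls a) \<Longrightarrow> contract v (cup a f) = (\<lambda>vs. a [v] * f vs - cup a (contract v f) vs)"
  by (rule ext) (subst contract_def, rule cup_homog_1_Cons)

lemma cup_homog_1_eq_0:
  assumes "homog (Suc 0) (cls a)" "\<And>v. v \<in> set vs \<Longrightarrow> a [v] = 0"
  shows "cup a f vs = 0"
  using assms(2)
proof (induction vs arbitrary: f)
  case Nil
  then show ?case using assms(1) by (simp add: cup_Nil homog_def)
next
  case (Cons v vs)
  then show ?case by (simp add: cup_homog_1_Cons[OF assms(1)])
qed

lemma contract_cups_eq_0:
  assumes "\<And>a. a \<in> set as \<Longrightarrow> homog (Suc 0) (cls a) \<and> a [v] = 0"
  shows "contract v (cups as) = (\<lambda>vs. 0)"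
  using assms
proof (induction as)
  case Nil
  then show ?case by (simp add: cups_def contract_def unit_class_def)
next
  case (Cons a as)
  have "contract v (cup a (cups as)) = (\<lambda>vs. a [v] * cups as vs - cup a (contract v (cups as)) vs)"
    using Cons.prems by (intro contract_cup_homog_1) simp
  also have "\<dots> = (\<lambda>vs. 0)"
  proof -
    have "contract v (cups as) = (\<lambda>vs. 0)" "a [v] = 0"
      using Cons.prems by (auto intro!: Cons.IH)
    then show ?thesis by (simp add: cup_def)
  qed
  finally show ?case by (simp add: cups_def)
qed

text \<open>
  Indices are the entries of an increasing list, so that both the numbering \<open>1, \<dots>, 2 n\<close> of an adapted
  basis and the positions \<open>0, \<dots>, m - 1\<close> in a list are covered.
\<close>

definition dual_basis :: "'v::real_vector set \<Rightarrow> nat list \<Rightarrow> (nat \<Rightarrow> 'v) \<Rightarrow> (nat \<Rightarrow> 'v forms) \<Rightarrow> bool" where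
  "dual_basis \<Gamma> is e y \<longleftrightarrow> zbasis \<Gamma> (map e is) \<and> sorted_wrt (<) is \<and>
     (\<forall>i\<in>set is. y i \<in> cohomology \<int> \<Gamma> \<and> homog (Suc 0) (cls (y i)) \<and>
        (\<forall>j\<in>set is. y i [e j] = (if i = j then 1 else 0)))"

text \<open>
  This is a determinant of zeros and ones. Expanding along the first basis vector \<open>e q\<close>, either \<open>p = q\<close>
  and \<open>e q\<close> is orthogonal to the remaining factors, or one of \<open>y p\<close> and \<open>e q\<close> is orthogonal to everything
  on the other side.
\<close>

lemma cups_dual_basis:
  assumes db: "dual_basis \<Gamma> is e y"
  shows "sorted_wrt (<) ps \<Longrightarrow> sorted_wrt (<) qs \<Longrightarrow> set ps \<subseteq> set is \<Longrightarrow> set qs \<subseteq> set is \<Longrightarrow>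
    cups (map y ps) (map e qs) = (if ps = qs then 1 else 0)"
proof (induction ps arbitrary: qs)
  case Nil
  then show ?case by (auto simp: cups_def unit_class_def)
next
  case (Cons p ps)
  have y: "homog (Suc 0) (cls (y i))" "j \<in> set is \<Longrightarrow> y i [e j] = (if i = j then 1 else 0)"
    if "i \<in> set is" for i j
    using db that by (auto simp: dual_basis_def)
  note yp = y[of p]
  have pi: "p \<in> set is" using Cons.prems by simp
  have cups: "cups (map y (p # ps)) = cup (y p) (cups (map y ps))" by (simp add: cups_def)
  show ?case
  proof (cases qs)
    case Nil
    then show ?thesis unfolding cups using yp(1) pi by (simp add: cup_Nil homog_def)
  next
    case (Cons q qs')
    have q: "q \<in> set is" using Cons.prems Cons by simp
    have exp: "cups (map y (p # ps)) (map e qs) =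
        y p [e q] * cups (map y ps) (map e qs') - cup (y p) (contract (e q) (cups (map y ps))) (map e qs')"
      unfolding cups using cup_homog_1_Cons[OF yp(1)[OF pi]] Cons by simp
    show ?thesis
    proof (cases "q \<le> p")
      case True
      then have "contract (e q) (cups (map y ps)) = (\<lambda>vs. 0)"
        using Cons.prems q by (intro contract_cups_eq_0) (auto simp: y subset_iff)
      then have z: "cup (y p) (contract (e q) (cups (map y ps))) (map e qs') = 0"
        by (simp add: cup_def)
      show ?thesis
        unfolding exp z using Cons.IH[of qs'] Cons.prems Cons yp(2)[OF pi q] by auto
    next
      case False
      then have "cup (y p) (cups (map y ps)) (map e qs) = 0"
        using Cons.prems Cons pi by (intro cup_homog_1_eq_0) (auto simp: y subset_iff)
      then show ?thesis unfolding cups using False Cons by auto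
    qed
  qed
qed

lemma monomial_dual_basis:
  assumes "dual_basis \<Gamma> is e y" "I \<subseteq> set is" "sorted_wrt (<) qs" "set qs \<subseteq> set is"
  shows "monomial y I (map e qs) = (if I = set qs then 1 else 0)"
proof -
  have fin: "finite I" using assms(2) finite_subset by auto
  have "sorted_list_of_set I = qs \<longleftrightarrow> I = set qs"
    using fin assms(3) by (metis sorted_list_of_set.idem_if_sorted_distinct strict_sorted_iff set_sorted_list_of_set)
  then show ?thesis
    unfolding monomial_def using assms fin by (subst cups_dual_basis[OF assms(1)]) auto
qed

lemma monomial_cohomology:
  assumes "dual_basis \<Gamma> is e y" "I \<subseteq> set is" "coeff_ring R" "\<int> \<subseteq> R"
  shows "monomial y I \<in> cohomology R \<Gamma>"
proof -
  have "finite I" using assms(2) finite_subset by auto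
  then show ?thesis
    unfolding monomial_def using assms zbasis_add_subgroup cohomology_mono[OF assms(4), of \<Gamma>]
    by (intro cohomology_cups) (auto simp: dual_basis_def subset_iff)
qed

lemma homog_monomial:
  assumes "finite I" "\<And>i. i \<in> I \<Longrightarrow> homog (Suc 0) (cls (y i))"
  shows "homog (card I) (cls (monomial y I))"
proof -
  have "cls (monomial y I) = prod_list (map (\<lambda>i. cls (y i)) (sorted_list_of_set I))"
    by (simp add: monomial_def cls_cups comp_def)
  moreover have "homog (length (sorted_list_of_set I)) (prod_list (map (\<lambda>i. cls (y i)) (sorted_list_of_set I)))"
    using assms by (intro homog_prod_list) auto
  ultimately show ?thesis by simp
qed

lemma cohomology_expansion:
  assumes db: "dual_basis \<Gamma> is e y" and f: "f \<in> cohomology R \<Gamma>"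
  shows "f vs = (\<Sum>I\<in>Pow (set is). f (map e (sorted_list_of_set I)) * monomial y I vs)"
proof -
  have f': "f \<in> cohomology UNIV \<Gamma>" using f cohomology_mono by blast
  define g where "g vs = (\<Sum>I\<in>Pow (set is). f (map e (sorted_list_of_set I)) * monomial y I vs)" for vs
  have g: "g \<in> cohomology UNIV \<Gamma>"
    unfolding g_def
    by (intro cohomology_sum cohomology_scale coeff_rings monomial_cohomology[OF db]) auto
  have "(\<lambda>vs. f vs + (-1) * g vs) \<in> cohomology UNIV \<Gamma>"
    by (intro cohomology_add cohomology_scale f' g coeff_rings) auto
  then have "f vs + (-1) * g vs = 0"
  proof (rule cohomology_eq_0I)
    show "zbasis \<Gamma> (map e is)" using db by (simp add: dual_basis_def)
    show "f (map e qs) + (-1) * g (map e qs) = 0" if qs: "sorted_wrt (<) qs" "set qs \<subseteq> set is" for qs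
    proof -
      have "g (map e qs) = (\<Sum>I\<in>Pow (set is). if I = set qs then f (map e (sorted_list_of_set I)) else 0)"
        unfolding g_def by (intro sum.cong refl) (simp add: monomial_dual_basis[OF db _ qs])
      also have "\<dots> = f (map e qs)"
        using qs by (simp add: sorted_list_of_set.idem_if_sorted_distinct strict_sorted_iff)
      finally show ?thesis by simp
    qed
  qed
  then have "f vs = g vs" by simp
  then show ?thesis unfolding g_def .
qed

text \<open>
  The coefficients in \<open>cohomology_expansion\<close> are integers here, and an additive map commutes with
  integral linear combinations.
\<close>

lemma additive_eq_on_cohomology:
  fixes F G :: "'v::real_vector forms \<Rightarrow> 'w forms"
  assumes db: "dual_basis \<Gamma> is e y"
    and F: "\<And>f g. f \<in> cohomology \<int> \<Gamma> \<Longrightarrow> g \<in> cohomology \<int> \<Gamma> \<Longrightarrow> F (\<lambda>vs. f vs + g vs) = (\<lambda>vs. F f vs + F g vs)"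
    and G: "\<And>f g. f \<in> cohomology \<int> \<Gamma> \<Longrightarrow> g \<in> cohomology \<int> \<Gamma> \<Longrightarrow> G (\<lambda>vs. f vs + g vs) = (\<lambda>vs. G f vs + G g vs)"
    and eq: "\<And>I. I \<subseteq> set is \<Longrightarrow> F (monomial y I) = G (monomial y I)"
    and h: "h \<in> cohomology \<int> \<Gamma>"
  shows "F h = G h"
proof -
  define A where "A = {f \<in> cohomology \<int> \<Gamma>. F f = G f}"
  have zero: "H (\<lambda>vs. 0) = (\<lambda>vs. 0)"
    if "\<And>f g. f \<in> cohomology \<int> \<Gamma> \<Longrightarrow> g \<in> cohomology \<int> \<Gamma> \<Longrightarrow> H (\<lambda>vs. f vs + g vs) = (\<lambda>vs. H f vs + H g vs)"
    for H :: "'v forms \<Rightarrow> 'w forms"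
  proof
    have "H (\<lambda>vs. 0) = (\<lambda>vs. H (\<lambda>vs. 0) vs + H (\<lambda>vs. 0) vs)"
      using that[OF cohomology_zero cohomology_zero] coeff_rings by simp
    then show "H (\<lambda>vs. 0) vs = 0" for vs by (metis add_cancel_right_right)
  qed
  have F0: "F (\<lambda>vs. 0) = (\<lambda>vs. 0)" by (rule zero) (rule F)
  have G0: "G (\<lambda>vs. 0) = (\<lambda>vs. 0)" by (rule zero) (rule G)
  have A0: "(\<lambda>vs. 0) \<in> A"
    using cohomology_zero[of \<int> \<Gamma>] coeff_rings by (simp add: A_def F0 G0)
  have Aadd: "(\<lambda>vs. f vs + g vs) \<in> A" if "f \<in> A" "g \<in> A" for f g
  proof -
    have "f \<in> cohomology \<int> \<Gamma>" "g \<in> cohomology \<int> \<Gamma>" "F f = G f" "F g = G g"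
      using that by (simp_all add: A_def)
    then show ?thesis
      using F[of f g] G[of f g] cohomology_add[of \<int> f \<Gamma> g] coeff_rings by (simp add: A_def)
  qed
  have Aminus: "(\<lambda>vs. - f vs) \<in> A" if f: "f \<in> A" for f
  proof -
    have f': "f \<in> cohomology \<int> \<Gamma>" "F f = G f" using f by (simp_all add: A_def)
    have mf: "(\<lambda>vs. - f vs) \<in> cohomology \<int> \<Gamma>"
      using cohomology_scale[of \<int> "-1" f \<Gamma>] f' coeff_rings by simp
    have "F (\<lambda>vs. f vs + - f vs) = (\<lambda>vs. F f vs + F (\<lambda>vs. - f vs) vs)" by (rule F[OF f'(1) mf])
    moreover have "G (\<lambda>vs. f vs + - f vs) = (\<lambda>vs. G f vs + G (\<lambda>vs. - f vs) vs)" by (rule G[OF f'(1) mf])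
    ultimately have "(\<lambda>vs. F f vs + F (\<lambda>vs. - f vs) vs) = (\<lambda>vs. G f vs + G (\<lambda>vs. - f vs) vs)"
      by (simp add: F0 G0)
    then have "F (\<lambda>vs. - f vs) = G (\<lambda>vs. - f vs)"
      unfolding f'(2) fun_eq_iff by simp
    then show ?thesis using mf by (simp add: A_def)
  qed
  have Anat: "(\<lambda>vs. of_nat k * f vs) \<in> A" if "f \<in> A" for f and k :: nat
    by (induction k) (use that Aadd A0 in \<open>auto simp: algebra_simps\<close>)
  have Aint: "(\<lambda>vs. r * f vs) \<in> A" if f: "f \<in> A" and r: "r \<in> \<int>" for f r
  proof -
    obtain k where k: "r = of_int k" using r by (auto elim: Ints_cases)
    show ?thesis
      using Anat[OF f, of "nat k"] Aminus[OF Anat[OF f, of "nat (- k)"]]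
      by (cases "k \<ge> 0") (auto simp: k)
  qed
  have Asum: "(\<lambda>vs. \<Sum>I\<in>S. q I vs) \<in> A" if "\<And>I. I \<in> S \<Longrightarrow> q I \<in> A"
    for S :: "nat set set" and q
    using that by (induction S rule: infinite_finite_induct) (auto simp: A0 Aadd)
  have "monomial y I \<in> A" if "I \<subseteq> set is" for I
    using that eq monomial_cohomology[OF db, of I \<int>] coeff_rings by (simp add: A_def)
  then have "(\<lambda>vs. \<Sum>I\<in>Pow (set is). h (map e (sorted_list_of_set I)) * monomial y I vs) \<in> A"
    by (intro Asum Aint cohomology_val[OF h]) auto
  also have "(\<lambda>vs. \<Sum>I\<in>Pow (set is). h (map e (sorted_list_of_set I)) * monomial y I vs) = h"
    by (rule ext) (rule cohomology_expansion[OF db h, symmetric])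
  finally show ?thesis by (simp add: A_def)
qed

lemma cohomology_above_rank:
  assumes db: "dual_basis \<Gamma> is e y" and f: "f \<in> cohomology R \<Gamma>" and "length vs > length is"
  shows "f vs = 0"
proof -
  have "monomial y I vs = 0" if "I \<subseteq> set is" for I
  proof -
    have "homog (card I) (cls (monomial y I))"
      using that db by (intro homog_monomial) (auto simp: dual_basis_def intro: finite_subset)
    moreover have "card I \<le> length is"
      using card_mono[OF finite_set that] card_length[of "is"] by linarith
    ultimately show ?thesis using assms(3) by (simp add: homog_def)
  qed
  then show ?thesis by (subst cohomology_expansion[OF db f]) simp
qed

lemma zbasis_dual_basis:
  assumes zb: "zbasis \<Gamma> bs"
  obtains y where "dual_basis \<Gamma> [0..<length bs] ((!) bs) y"
proof -
  have ind: "independent (set bs)" and dist: "distinct bs"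
    and Gamma: "\<Gamma> = range (\<lambda>c :: nat \<Rightarrow> int. \<Sum>i<length bs. of_int (c i) *\<^sub>R bs ! i)"
    using zb by (auto simp: zbasis_def)
  have span: "v \<in> span (set bs)" if "v \<in> \<Gamma>" for v
    using that unfolding Gamma by (auto intro!: span_sum span_scale[OF span_base])
  define y where "y i = linear_class \<Gamma> (\<lambda>v. representation (set bs) v (bs ! i))" for i
  have rep: "representation (set bs) (bs ! j) (bs ! i) = (if i = j then 1 else 0)"
    if "i < length bs" "j < length bs" for i j
    using that dist by (auto simp: representation_basis[OF ind] nth_eq_iff_index_eq)
  have int: "representation (set bs) v (bs ! i) \<in> \<int>" if "v \<in> \<Gamma>" "i < length bs" for v i
  proof -
    obtain c :: "nat \<Rightarrow> int" where c: "v = (\<Sum>j<length bs. of_int (c j) *\<^sub>R bs ! j)"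
      using \<open>v \<in> \<Gamma>\<close> unfolding Gamma by auto
    have "representation (set bs) v (bs ! i) = (\<Sum>j<length bs. representation (set bs) (of_int (c j) *\<^sub>R bs ! j) (bs ! i))"
      unfolding c by (subst representation_sum[OF ind]) (auto intro!: span_scale[OF span_base])
    also have "\<dots> = (\<Sum>j<length bs. of_int (c j) * (if i = j then 1 else 0))"
      using that(2) by (intro sum.cong refl) (simp add: representation_scale[OF ind] span_base rep)
    finally show ?thesis by (auto intro!: Ints_sum)
  qed
  have bG: "bs ! j \<in> \<Gamma>" if "j < length bs" for j
    using that zbasis_subset[OF zb] by auto
  have "map ((!) bs) [0..<length bs] = bs" by (rule map_nth)
  moreover have "y i \<in> cohomology \<int> \<Gamma>" if "i < length bs" for i
    unfolding y_def using zbasis_add_subgroup[OF zb] that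
    by (intro linear_class_cohomology) (auto simp: coeff_rings int representation_add[OF ind] span)
  ultimately have "dual_basis \<Gamma> [0..<length bs] ((!) bs) y"
    unfolding dual_basis_def using zb homog_linear_class rep bG by (auto simp: y_def)
  then show ?thesis by (rule that)
qed

section \<open>Poincare duality\<close>

lemma nths_upt_eq: "nths [0..<m] S = sorted_list_of_set (S \<inter> {..<m})"
proof -
  have "sorted_wrt (<) (nths [0..<m] S)"
    by (simp add: strict_sorted_iff sorted_nths distinct_nthsI)
  moreover have "set (nths [0..<m] S) = S \<inter> {..<m}"
  proof -
    have "set (nths [0..<m] S) = (\<lambda>i. [0..<m] ! i) ` (S \<inter> {..<m})"
      unfolding set_nths by (auto simp del: nth_upt)
    also have "\<dots> = (\<lambda>i. i) ` (S \<inter> {..<m})"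
      by (intro image_cong) auto
    finally show ?thesis by simp
  qed
  ultimately show ?thesis
    by (metis sorted_list_of_set.idem_if_sorted_distinct strict_sorted_iff)
qed

lemma nths_eq_map_nth: "nths bs S = map ((!) bs) (sorted_list_of_set (S \<inter> {..<length bs}))"
  by (metis nths_upt_eq nths_map map_nth)

text \<open>
  A monomial picks the one term of the shuffle product that puts its own basis vectors last. Hence the
  pairing with the monomial of \<open>J\<close> reads off the coefficient at the complement of \<open>J\<close>, up to sign.
\<close>

lemma cup_monomial_pairing:
  assumes db: "dual_basis \<Gamma> [0..<length bs] ((!) bs) y" and J: "J \<subseteq> {..<length bs}"
  shows "cup c (monomial y J) bs = shuffle_sign ({..<length bs} - J) (length bs) *
    c (map ((!) bs) (sorted_list_of_set ({..<length bs} - J)))"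
proof -
  let ?m = "length bs"
  have "monomial y J (nths bs (- S)) = (if S = {..<?m} - J then 1 else 0)" if "S \<subseteq> {..<?m}" for S
  proof -
    have eq: "nths bs (- S) = map ((!) bs) (sorted_list_of_set (- S \<inter> {..<?m}))"
      by (rule nths_eq_map_nth)
    show ?thesis
      unfolding eq using that J
      by (subst monomial_dual_basis[OF db]) auto
  qed
  then have "cup c (monomial y J) bs = (\<Sum>S\<in>Pow {..<?m}. if S = {..<?m} - J then
      shuffle_sign S ?m * c (nths bs S) else 0)"
    unfolding cup_def by (intro sum.cong refl) auto
  also have "\<dots> = shuffle_sign ({..<?m} - J) ?m * c (nths bs ({..<?m} - J))"
    by simp
  also have "{..<?m} - J \<inter> {..<?m} = {..<?m} - J" by auto
  ultimately show ?thesis by (simp add: nths_eq_map_nth Int_absorb2)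
qed

lemma cup_sum_right:
  "cup f (\<lambda>vs. \<Sum>I\<in>A. r I * g I vs) = (\<lambda>vs. \<Sum>I\<in>A. r I * cup f (g I) vs)"
proof (induction A rule: infinite_finite_induct)
  case (insert a A)
  then show ?case by (simp add: cup_add_right cup_scale_right)
qed (simp_all add: cup_def)

lemma poincare_dual_sum:
  "poincare_dual \<sigma> bs c (\<lambda>vs. \<Sum>I\<in>A. r I * g I vs) = (\<Sum>I\<in>A. r I * poincare_dual \<sigma> bs c (g I))"
  by (simp add: poincare_dual_def cup_sum_right)

lemma poincare_dual_inject:
  assumes zb: "zbasis \<Gamma> bs" and \<sigma>: "\<And>k. \<sigma> (length bs) k \<noteq> 0"
    and c: "c \<in> cohomology R \<Gamma>" "c' \<in> cohomology R' \<Gamma>"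
    and eq: "\<And>b. b \<in> cohomology \<rat> \<Gamma> \<Longrightarrow> poincare_dual \<sigma> bs c b = poincare_dual \<sigma> bs c' b"
  shows "c = c'"
proof -
  let ?m = "length bs"
  obtain y where db: "dual_basis \<Gamma> [0..<?m] ((!) bs) y" by (rule zbasis_dual_basis[OF zb])
  have val: "c (map ((!) bs) (sorted_list_of_set I)) = c' (map ((!) bs) (sorted_list_of_set I))"
    if I: "I \<subseteq> {..<?m}" for I
  proof -
    have "monomial y ({..<?m} - I) \<in> cohomology \<rat> \<Gamma>"
      by (rule monomial_cohomology[OF db]) (auto simp: coeff_rings Ints_subset_Rats)
    moreover have "{..<?m} - ({..<?m} - I) = I" using I by auto
    ultimately show ?thesis
      using eq[of "monomial y ({..<?m} - I)"] cup_monomial_pairing[OF db, of "{..<?m} - I"] \<sigma>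
      by (simp add: poincare_dual_def shuffle_sign_def)
  qed
  show ?thesis
  proof
    show "c vs = c' vs" for vs
      unfolding cohomology_expansion[OF db c(1), of vs] cohomology_expansion[OF db c(2), of vs]
      using val by (intro sum.cong refl) (auto simp: atLeast0LessThan)
  qed
qed

text \<open>
  The pairing is perfect over \<open>\<int>\<close>: the coefficient of \<open>c\<close> at \<open>I\<close> is, up to sign, the value of \<open>\<phi>\<close> at
  the monomial of the complement. This produces the Gysin map with coefficients in the same ring as the
  values of \<open>\<phi>\<close>.
\<close>

lemma poincare_dual_surject:
  assumes zb: "zbasis \<Gamma> bs" and \<sigma>: "\<And>k. \<sigma> (length bs) k \<in> {1, -1}"
    and R: "coeff_ring R" "\<int> \<subseteq> R"
    and lin: "\<And>(A :: nat set set) r f. \<phi> (\<lambda>vs. \<Sum>I\<in>A. r I * f I vs) = (\<Sum>I\<in>A. r I * (\<phi> (f I) :: real))"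
    and \<phi>R: "\<And>b. b \<in> cohomology \<int> \<Gamma> \<Longrightarrow> \<phi> b \<in> R"
  obtains c where "c \<in> cohomology R \<Gamma>"
    and "\<And>b. b \<in> cohomology \<rat> \<Gamma> \<Longrightarrow> poincare_dual \<sigma> bs c b = \<phi> b"
proof -
  let ?m = "length bs"
  obtain y where db: "dual_basis \<Gamma> [0..<?m] ((!) bs) y" by (rule zbasis_dual_basis[OF zb])
  let ?k = "\<lambda>I. shuffle_sign I ?m * \<sigma> ?m (card I) * \<phi> (monomial y ({..<?m} - I))"
  define c where "c vs = (\<Sum>I\<in>Pow {..<?m}. ?k I * monomial y I vs)" for vs
  have monoZ: "monomial y I \<in> cohomology \<int> \<Gamma>" if "I \<subseteq> {..<?m}" for I
    using that by (intro monomial_cohomology[OF db]) (auto simp: coeff_rings)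
  have sgnR: "\<sigma> ?m k \<in> R" for k
    using \<sigma>[of k] R(2) by auto
  have "?k I \<in> R" for I
    using coeff_ring_sign[OF R(1)] sgnR \<phi>R[OF monoZ, of "{..<?m} - I"] R(1)
    unfolding shuffle_sign_def coeff_ring_def by blast
  then have c: "c \<in> cohomology R \<Gamma>"
    unfolding c_def using monoZ cohomology_mono[OF R(2)]
    by (intro cohomology_sum cohomology_scale R(1)) auto
  have cval: "c (map ((!) bs) (sorted_list_of_set I)) = ?k I" if I: "I \<subseteq> {..<?m}" for I
  proof -
    have fin: "finite I" using I finite_subset by auto
    have "c (map ((!) bs) (sorted_list_of_set I)) = (\<Sum>I'\<in>Pow {..<?m}. if I' = I then ?k I' else 0)"
      unfolding c_def using I fin by (intro sum.cong refl) (simp add: monomial_dual_basis[OF db] atLeast0LessThan)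
    then show ?thesis using I by simp
  qed
  have mono: "poincare_dual \<sigma> bs c (monomial y J) = \<phi> (monomial y J)" if J: "J \<subseteq> {..<?m}" for J
  proof -
    let ?I = "{..<?m} - J"
    have J': "{..<?m} - ?I = J" using J by auto
    have "\<sigma> ?m (card ?I) * \<sigma> ?m (card ?I) = 1" using \<sigma>[of "card ?I"] by auto
    moreover have "shuffle_sign ?I ?m * shuffle_sign ?I ?m = 1"
      by (simp add: shuffle_sign_def flip: power_mult_distrib)
    moreover have "poincare_dual \<sigma> bs c (monomial y J) =
        shuffle_sign ?I ?m * (\<sigma> ?m (card ?I) * ?k ?I)"
      unfolding poincare_dual_def cup_monomial_pairing[OF db J] by (simp add: cval)
    then have "poincare_dual \<sigma> bs c (monomial y J) = (shuffle_sign ?I ?m * shuffle_sign ?I ?m) *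
        (\<sigma> ?m (card ?I) * \<sigma> ?m (card ?I)) * \<phi> (monomial y ({..<?m} - ?I))"
      by (simp only: mult_ac)
    ultimately show ?thesis unfolding J' by simp
  qed
  have "poincare_dual \<sigma> bs c b = \<phi> b" if b: "b \<in> cohomology \<rat> \<Gamma>" for b
  proof -
    let ?r = "\<lambda>I. b (map ((!) bs) (sorted_list_of_set I))"
    have b': "b = (\<lambda>vs. \<Sum>I\<in>Pow {..<?m}. ?r I * monomial y I vs)"
      by (rule ext) (subst cohomology_expansion[OF db b], simp add: atLeast0LessThan)
    have "poincare_dual \<sigma> bs c b = poincare_dual \<sigma> bs c (\<lambda>vs. \<Sum>I\<in>Pow {..<?m}. ?r I * monomial y I vs)"
      by (rule arg_cong[where f = "poincare_dual \<sigma> bs c"]) (rule b')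
    also have "\<dots> = (\<Sum>I\<in>Pow {..<?m}. ?r I * poincare_dual \<sigma> bs c (monomial y I))"
      by (rule poincare_dual_sum)
    also have "\<dots> = (\<Sum>I\<in>Pow {..<?m}. ?r I * \<phi> (monomial y I))"
      by (intro sum.cong refl) (simp add: mono)
    also have "\<dots> = \<phi> (\<lambda>vs. \<Sum>I\<in>Pow {..<?m}. ?r I * monomial y I vs)"
      by (rule lin[symmetric])
    also have "\<dots> = \<phi> b"
      by (rule arg_cong[where f = \<phi>]) (rule b'[symmetric])
    finally show ?thesis .
  qed
  with c show ?thesis by (rule that)
qed

lemma pushforward_eqI:
  assumes "zbasis \<Gamma> bs" and "\<And>k. \<sigma> (length bs) k \<noteq> 0" and "c \<in> cohomology \<rat> \<Gamma>"
    and "\<And>b. b \<in> cohomology \<rat> \<Gamma> \<Longrightarrow> poincare_dual \<sigma> bs c b = poincare_dual \<sigma> ts a (pullback p \<Xi> b)"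
  shows "pushforward \<sigma> p \<Xi> ts \<Gamma> bs a = c"
  unfolding pushforward_def
proof (rule the_equality)
  fix c' assume "c' \<in> cohomology \<rat> \<Gamma> \<and> (\<forall>b\<in>cohomology \<rat> \<Gamma>.
    poincare_dual \<sigma> bs c' b = poincare_dual \<sigma> ts a (pullback p \<Xi> b))"
  then show "c' = c"
    using assms by (intro poincare_dual_inject[OF assms(1), of \<sigma> c' \<rat> c \<rat>]) auto
qed (use assms in auto)

text \<open>
  The class constructed in \<open>poincare_dual_surject\<close> is the one selected by the definite description that
  defines the push-forward; its coefficients are as good as those of \<open>a\<close>.
\<close>

lemma pushforward_cohomology:
  assumes zb: "zbasis \<Gamma> bs" and \<sigma>: "\<And>m k. \<sigma> m k \<in> {1, -1}"
    and R: "coeff_ring R" "\<int> \<subseteq> R" "R \<subseteq> \<rat>" and a: "\<And>vs. a vs \<in> R"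
  shows "pushforward \<sigma> p \<Xi> ts \<Gamma> bs a \<in> cohomology R \<Gamma>"
    and "b \<in> cohomology \<rat> \<Gamma> \<Longrightarrow>
      poincare_dual \<sigma> bs (pushforward \<sigma> p \<Xi> ts \<Gamma> bs a) b = poincare_dual \<sigma> ts a (pullback p \<Xi> b)"
proof -
  let ?\<phi> = "\<lambda>b. poincare_dual \<sigma> ts a (pullback p \<Xi> b)"
  obtain c where c: "c \<in> cohomology R \<Gamma>"
    and eq: "\<And>b. b \<in> cohomology \<rat> \<Gamma> \<Longrightarrow> poincare_dual \<sigma> bs c b = ?\<phi> b"
  proof (rule poincare_dual_surject[OF zb _ R(1,2), of \<sigma> ?\<phi>])
    show "\<sigma> (length bs) k \<in> {1, -1}" for k by (rule \<sigma>)
    show "?\<phi> (\<lambda>vs. \<Sum>I\<in>A. r I * f I vs) = (\<Sum>I\<in>A. r I * ?\<phi> (f I))"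
      for A :: "nat set set" and r f
    proof -
      have "pullback p \<Xi> (\<lambda>vs. \<Sum>I\<in>A. r I * f I vs) = (\<lambda>vs. \<Sum>I\<in>A. r I * pullback p \<Xi> (f I) vs)"
        by (auto simp: pullback_def)
      then show ?thesis by (simp add: poincare_dual_sum)
    qed
    show "?\<phi> b \<in> R" if b: "b \<in> cohomology \<int> \<Gamma>" for b
    proof -
      have 0: "0 \<in> R" using R(1) by (simp add: coeff_ring_def add_subgroup_def)
      have "pullback p \<Xi> b vs \<in> R" for vs
        using cohomology_val[OF b] R(2) 0 by (auto simp: pullback_def)
      moreover have "\<sigma> m k \<in> R" for m k using \<sigma>[of m k] R(2) by auto
      ultimately show ?thesis
        unfolding poincare_dual_def cup_def
        using R(1) a coeff_ring_sign[OF R(1)]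
        by (intro add_subgroup_sum) (auto simp: coeff_ring_def shuffle_sign_def)
    qed
  qed (blast intro: that)
  have "pushforward \<sigma> p \<Xi> ts \<Gamma> bs a = c"
  proof (rule pushforward_eqI[OF zb])
    show "\<sigma> (length bs) k \<noteq> 0" for k using \<sigma>[of "length bs" k] by auto
    show "c \<in> cohomology \<rat> \<Gamma>" using c cohomology_mono[OF R(3)] by blast
  qed (rule eq)
  then show "pushforward \<sigma> p \<Xi> ts \<Gamma> bs a \<in> cohomology R \<Gamma>"
    and "b \<in> cohomology \<rat> \<Gamma> \<Longrightarrow>
      poincare_dual \<sigma> bs (pushforward \<sigma> p \<Xi> ts \<Gamma> bs a) b = ?\<phi> b"
    using c eq by auto
qed

section \<open>Pull-back\<close>

lemma pullback_cup: "pullback p \<Xi> (cup f g) = cup (pullback p \<Xi> f) (pullback p \<Xi> g)"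
proof
  show "pullback p \<Xi> (cup f g) vs = cup (pullback p \<Xi> f) (pullback p \<Xi> g) vs" for vs
  proof (cases "set vs \<subseteq> \<Xi>")
    case True
    then have "set (nths vs S) \<subseteq> \<Xi>" for S
      using set_nths_subset by fastforce
    then show ?thesis using True by (simp add: pullback_def cup_def nths_map)
  next
    case False
    then have "cup (pullback p \<Xi> f) (pullback p \<Xi> g) vs = 0"
      by (rule cup_outside[rotated 2]) (auto simp: pullback_def)
    then show ?thesis using False by (simp add: pullback_def)
  qed
qed

lemma pullback_unit: "pullback p \<Xi> unit_class = unit_class"
  by (auto simp: pullback_def unit_class_def)

lemma pullback_cups: "pullback p \<Xi> (cups fs) = cups (map (pullback p \<Xi>) fs)"
  by (induction fs) (simp_all add: cups_def pullback_unit pullback_cup)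

lemma pullback_monomial: "pullback p \<Xi> (monomial c S) = monomial (\<lambda>i. pullback p \<Xi> (c i)) S"
  by (simp add: monomial_def pullback_cups comp_def)

lemma pullback_pullback:
  assumes "q ` \<Xi>' \<subseteq> \<Xi>"
  shows "pullback q \<Xi>' (pullback p \<Xi> f) = pullback (p \<circ> q) \<Xi>' f"
  using assms by (intro ext) (auto simp: pullback_def subset_iff image_subset_iff)

lemma pullback_linear_class:
  "p ` \<Xi> \<subseteq> \<Gamma> \<Longrightarrow> pullback p \<Xi> (linear_class \<Gamma> w) = linear_class \<Xi> (w \<circ> p)"
  by (rule ext) (auto simp: pullback_def linear_class_def split: list.split)

lemma pullback_cohomology:
  assumes G: "add_subgroup \<Xi>" and R: "coeff_ring R" and f: "f \<in> cohomology R \<Gamma>"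
    and "add_subgroup \<Gamma>" "p ` \<Xi> \<subseteq> \<Gamma>"
    and add: "\<And>x y. x \<in> \<Xi> \<Longrightarrow> y \<in> \<Xi> \<Longrightarrow> p (x + y) = p x + p y"
  shows "pullback p \<Xi> f \<in> cohomology R \<Xi>"
proof (rule cohomologyI[OF G])
  show "pullback p \<Xi> f vs \<in> R" for vs
    using cohomology_val[OF f] R by (auto simp: pullback_def coeff_ring_def add_subgroup_def)
  show "pullback p \<Xi> f vs = 0" if "\<not> set vs \<subseteq> \<Xi>" for vs
    using that by (simp add: pullback_def)
  show "pullback p \<Xi> f (us @ v # v # ws) = 0" for us v ws
    by (simp add: pullback_def cohomology_alternating[OF f])
  show "pullback p \<Xi> f (us @ (x + y) # ws) = pullback p \<Xi> f (us @ x # ws) + pullback p \<Xi> f (us @ y # ws)"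
    if xy: "x \<in> \<Xi>" "y \<in> \<Xi>" for us x y ws
  proof -
    have "p x \<in> \<Gamma>" "p y \<in> \<Gamma>" using xy assms(5) by auto
    then show ?thesis
      using xy add_subgroup_add[OF G xy] add[OF xy]
      by (simp add: pullback_def cohomology_add_arg[OF assms(4) f])
  qed
qed

lemma homog_pullback:
  "homog d (cls f) \<Longrightarrow> homog d (cls (pullback p \<Xi> f))"
  by (auto simp: homog_def pullback_def)

section \<open>Ordered products\<close>

definition oprod :: "(nat \<Rightarrow> 'a::monoid_mult) \<Rightarrow> nat set \<Rightarrow> 'a" where
  "oprod Z S = prod_list (map Z (sorted_list_of_set S))"

lemma cls_monomial: "cls (monomial c S) = oprod (\<lambda>i. cls (c i)) S"
  by (simp add: monomial_def oprod_def cls_cups comp_def)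

lemma oprod_cong: "finite S \<Longrightarrow> (\<And>i. i \<in> S \<Longrightarrow> Z i = Z' i) \<Longrightarrow> oprod Z S = oprod Z' S"
  unfolding oprod_def by (intro arg_cong[where f = prod_list] map_cong) auto

lemma sorted_list_of_set_Un:
  assumes "finite A" "finite B" "\<And>a b. a \<in> A \<Longrightarrow> b \<in> B \<Longrightarrow> a < (b :: nat)"
  shows "sorted_list_of_set (A \<union> B) = sorted_list_of_set A @ sorted_list_of_set B"
proof -
  have "sorted_wrt (<) (sorted_list_of_set A @ sorted_list_of_set B)"
    using assms by (simp add: sorted_wrt_append)
  moreover have "set (sorted_list_of_set A @ sorted_list_of_set B) = A \<union> B"
    using assms by simp
  ultimately show ?thesis
    by (metis sorted_list_of_set.idem_if_sorted_distinct strict_sorted_iff)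
qed

lemma oprod_Un:
  assumes "finite A" "finite B" "\<And>a b. a \<in> A \<Longrightarrow> b \<in> B \<Longrightarrow> a < b"
  shows "oprod Z (A \<union> B) = oprod Z A * oprod Z B"
  by (simp add: oprod_def sorted_list_of_set_Un[OF assms])

lemma oprod_empty [simp]: "oprod Z {} = 1"
  by (simp add: oprod_def)

lemma oprod_insert_max:
  assumes "A \<subseteq> {1..n}" shows "oprod Z (insert (Suc n) A) = oprod Z A * Z (Suc n)"
proof -
  have "oprod Z (A \<union> {Suc n}) = oprod Z A * oprod Z {Suc n}"
    using assms by (intro oprod_Un) (auto intro: finite_subset)
  then show ?thesis by (simp add: oprod_def)
qed

lemma homog_oprod:
  assumes "finite S" "\<And>i. i \<in> S \<Longrightarrow> homog d (Z i)"
  shows "homog (d * card S) (oprod Z S)"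
proof -
  have "homog (d * length is) (prod_list (map Z is))" if "set is \<subseteq> S" for "is"
    using that
  proof (induction "is")
    case (Cons i "is")
    then show ?case
      using homog_mult[of d "Z i" "d * length is" "prod_list (map Z is)"] assms by simp
  qed (simp add: homog_1)
  from this[of "sorted_list_of_set S"] show ?thesis using assms(1) by (simp add: oprod_def)
qed

lemma oprod_scaleR:
  fixes Z :: "nat \<Rightarrow> 'a::real_algebra_1"
  assumes "finite S" shows "oprod (\<lambda>i. k *\<^sub>R Z i) S = k ^ card S *\<^sub>R oprod Z S"
proof -
  have "prod_list (map (\<lambda>i. k *\<^sub>R Z i) is) = k ^ length is *\<^sub>R prod_list (map Z is)" for "is"
    by (induction "is") simp_all
  then show ?thesis by (simp add: oprod_def)
qed

lemma monomial_cong: "(\<And>i. i \<in> S \<Longrightarrow> c i = c' i) \<Longrightarrow> finite S \<Longrightarrow> monomial c S = monomial c' S"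
  unfolding monomial_def by (intro arg_cong[where f = cups] map_cong) auto

lemma monomial_Un:
  assumes "finite S" "finite R" "\<And>i k. i \<in> S \<Longrightarrow> k \<in> R \<Longrightarrow> i < k"
  shows "monomial c (S \<union> R) = cup (monomial c S) (monomial c R)"
proof -
  have "cls (monomial c (S \<union> R)) = cls (cup (monomial c S) (monomial c R))"
    by (simp add: cls_monomial cls_cup oprod_Un[OF assms])
  then show ?thesis by (metis form_cls)
qed

lemma prod_list_homog_1_repeat:
  assumes hom: "\<And>i. homog (Suc 0) (Z i)" and "\<not> distinct is"
  shows "prod_list (map Z is) = 0"
proof -
  obtain xs ys zs i where "is": "is = xs @ [i] @ ys @ [i] @ zs"
    using not_distinct_decomp[OF assms(2)] by blast
  have "Z i * prod_list (map Z ys) * Z i = (-1) ^ length ys *\<^sub>R (prod_list (map Z ys) * Z i * Z i)"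
    using homog_commute[OF hom[of i] homog_prod_list[of ys Z]] hom by simp
  also have "\<dots> = 0" by (simp add: mult.assoc homog_1_square hom)
  finally have zero: "Z i * prod_list (map Z ys) * Z i = 0" .
  have "Z i * (prod_list (map Z ys) * (Z i * w)) = (Z i * prod_list (map Z ys) * Z i) * w" for w
    by (simp only: mult.assoc)
  then have "Z i * (prod_list (map Z ys) * (Z i * w)) = 0" for w
    by (simp only: zero mult_zero_left)
  then show ?thesis by (simp add: "is")
qed

text \<open>
  For the terms of the Chern character whose integral vanishes it is enough to know that there is such
  a scalar; \<open>complementary_shuffle\<close> gives the precise sign for the remaining one.
\<close>

lemma oprod_pairs_sign:
  assumes X: "\<And>i. homog (Suc 0) (X i)" and Y: "\<And>i. homog (Suc 0) (Y i)"
  shows "\<exists>s :: real. oprod (\<lambda>i. X i * Y i) P = s *\<^sub>R (oprod X P * oprod Y P)"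
proof -
  have "\<exists>s :: real. prod_list (map (\<lambda>i. X i * Y i) is) = s *\<^sub>R (prod_list (map X is) * prod_list (map Y is))"
    for "is"
  proof (induction "is")
    case (Cons i "is")
    then obtain s :: real where s: "prod_list (map (\<lambda>i. X i * Y i) is) = s *\<^sub>R (prod_list (map X is) * prod_list (map Y is))"
      by blast
    have swap: "Y i * prod_list (map X is) = (-1) ^ length is *\<^sub>R (prod_list (map X is) * Y i)"
      using homog_commute[OF Y[of i] homog_prod_list[of "is" X]] X by simp
    have "Y i * (prod_list (map X is) * w) = (Y i * prod_list (map X is)) * w" for w
      by (simp only: mult.assoc)
    then have "Y i * (prod_list (map X is) * w) = (-1) ^ length is *\<^sub>R (prod_list (map X is) * (Y i * w))" for w
      unfolding swap by (simp add: mult.assoc)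
    then have "prod_list (map (\<lambda>i. X i * Y i) (i # is)) =
        (s * (-1) ^ length is) *\<^sub>R (prod_list (map X (i # is)) * prod_list (map Y (i # is)))"
      by (simp add: s mult.assoc)
    then show ?case by blast
  qed (auto intro: exI[of _ 1])
  then show ?thesis by (simp add: oprod_def)
qed

text \<open>
  The degree \<open>p\<close> part of the product of the exponentials \<open>exp(Z\<^sub>i) = 1 + Z\<^sub>i\<close>. In the induction the new
  element \<open>z\<close> satisfies \<open>(s + z)\<^bsup>q + 1\<^esup> = s\<^bsup>q + 1\<^esup> + (q + 1) s\<^sup>q z\<close>, and the factor \<open>q + 1\<close> cancels in
  the divided power.
\<close>

lemma divided_power_sum:
  fixes Z :: "nat \<Rightarrow> 'a::real_algebra_1"
  assumes comm: "\<And>i j. Z i * Z j = Z j * Z i" and sq: "\<And>i. Z i * Z i = 0"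
  shows "(1 / fact p) *\<^sub>R (\<Sum>i\<in>{1..n}. Z i) ^ p = (\<Sum>P\<in>{P. P \<subseteq> {1..n} \<and> card P = p}. oprod Z P)"
proof (induction n arbitrary: p)
  case 0
  have "{P. P \<subseteq> {1..0::nat} \<and> card P = p} = (if p = 0 then {{}} else {})" by auto
  then show ?case by (cases p) auto
next
  case (Suc n)
  let ?s = "\<Sum>i\<in>{1..n}. Z i" and ?z = "Z (Suc n)"
  have zs: "?z * ?s = ?s * ?z"
    unfolding sum_distrib_left sum_distrib_right by (intro sum.cong refl comm)
  have pow: "(?s + ?z) ^ Suc q = ?s ^ Suc q + of_nat (Suc q) *\<^sub>R (?s ^ q * ?z)" for q
  proof (induction q)
    case (Suc q)
    have "(?s + ?z) ^ Suc (Suc q) = (?s ^ Suc q + of_nat (Suc q) *\<^sub>R (?s ^ q * ?z)) * (?s + ?z)"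
      by (simp only: Suc.IH power_Suc2[of _ "Suc q"])
    also have "\<dots> = ?s ^ Suc (Suc q) + (?s ^ Suc q * ?z + of_nat (Suc q) *\<^sub>R (?s ^ q * (?z * ?s)))
        + of_nat (Suc q) *\<^sub>R (?s ^ q * (?z * ?z))"
      by (simp add: algebra_simps power_Suc2[of _ "Suc q"] power_Suc2[of _ q] del: power_Suc)
    also have "?s ^ q * (?z * ?s) = ?s ^ Suc q * ?z"
      by (simp only: zs power_Suc2 mult.assoc)
    also have "?z * ?z = 0" by (rule sq)
    finally have "(?s + ?z) ^ Suc (Suc q) = ?s ^ Suc (Suc q) +
        (?s ^ Suc q * ?z + of_nat (Suc q) *\<^sub>R (?s ^ Suc q * ?z))"
      by (simp only: mult_zero_right scaleR_zero_right add_0_right)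
    moreover have "of_nat (Suc (Suc q)) = 1 + (of_nat (Suc q) :: real)" by simp
    ultimately show ?case by (simp only: scaleR_left_distrib scaleR_one)
  qed (simp add: algebra_simps)
  have split: "{P. P \<subseteq> {1..Suc n} \<and> card P = Suc q} =
      {P. P \<subseteq> {1..n} \<and> card P = Suc q} \<union> insert (Suc n) ` {P. P \<subseteq> {1..n} \<and> card P = q}" for q
  proof (intro equalityI subsetI)
    fix P assume P: "P \<in> {P. P \<subseteq> {1..Suc n} \<and> card P = Suc q}"
    then have fin: "finite P" by (auto intro: finite_subset)
    show "P \<in> {P. P \<subseteq> {1..n} \<and> card P = Suc q} \<union> insert (Suc n) ` {P. P \<subseteq> {1..n} \<and> card P = q}"
    proof (cases "Suc n \<in> P")
      case True
      then have "P = insert (Suc n) (P - {Suc n})" "P - {Suc n} \<subseteq> {1..n}" "card (P - {Suc n}) = q"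
        using P fin by (auto simp: atLeastAtMostSuc_conv)
      then show ?thesis by blast
    next
      case False
      then show ?thesis using P by (auto simp: atLeastAtMostSuc_conv)
    qed
  next
    fix P assume "P \<in> {P. P \<subseteq> {1..n} \<and> card P = Suc q} \<union> insert (Suc n) ` {P. P \<subseteq> {1..n} \<and> card P = q}"
    then consider "P \<subseteq> {1..n}" "card P = Suc q"
      | Q where "P = insert (Suc n) Q" "Q \<subseteq> {1..n}" "card Q = q" by blast
    then show "P \<in> {P. P \<subseteq> {1..Suc n} \<and> card P = Suc q}"
    proof cases
      case 1
      then show ?thesis by auto
    next
      case 2
      then have "Suc n \<notin> Q" "finite Q" by (auto intro: finite_subset)
      then show ?thesis using 2 by (auto simp: subset_iff)
    qed
  qed
  have fin: "finite {P. P \<subseteq> {1..n} \<and> card P = q}" for q by simp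
  show ?case
  proof (cases p)
    case 0
    have "{P. P \<subseteq> {1..Suc n} \<and> card P = 0} = {{}}" by (auto dest: finite_subset)
    then show ?thesis using 0 by simp
  next
    case p: (Suc q)
    have "(\<Sum>P\<in>{P. P \<subseteq> {1..Suc n} \<and> card P = Suc q}. oprod Z P) =
        (\<Sum>P\<in>{P. P \<subseteq> {1..n} \<and> card P = Suc q}. oprod Z P) +
        (\<Sum>P\<in>{P. P \<subseteq> {1..n} \<and> card P = q}. oprod Z (insert (Suc n) P))"
    proof -
      have inj: "inj_on (insert (Suc n)) {P. P \<subseteq> {1..n} \<and> card P = q}"
      proof (rule inj_onI)
        fix P Q assume "P \<in> {P. P \<subseteq> {1..n} \<and> card P = q}" "Q \<in> {P. P \<subseteq> {1..n} \<and> card P = q}"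
          and eq: "insert (Suc n) P = insert (Suc n) Q"
        then have "Suc n \<notin> P" "Suc n \<notin> Q" by auto
        then show "P = Q" using eq by (simp add: insert_ident)
      qed
      show ?thesis
        unfolding split by (subst sum.union_disjoint) (use sum.reindex[OF inj, of "oprod Z"] in auto)
    qed
    also have "\<dots> = (1 / fact (Suc q)) *\<^sub>R ?s ^ Suc q + (1 / fact q) *\<^sub>R ?s ^ q * ?z"
      unfolding Suc.IH sum_distrib_right
      by (intro arg_cong2[where f = "(+)"] refl sum.cong) (auto simp: oprod_insert_max)
    also have "\<dots> = (1 / fact (Suc q)) *\<^sub>R (?s + ?z) ^ Suc q"
      unfolding pow by (simp add: scaleR_add_right del: power_Suc of_nat_Suc)
    finally show ?thesis unfolding p by simp
  qed
qed

section \<open>Reordering one term of the Chern character\<close>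

text \<open>
  The source of the sign of \<open>\<beta>\<close>, and the reason for the exponent \<open>(-1)\<^bsup>n - 1\<^esup>\<close> of the line bundle. In the induction on
  \<open>n\<close> let \<open>p\<close> be the number of indices outside \<open>S\<close> so far. The new \<open>X\<close> has to be moved to the front past
  \<open>X\<^sub>n \<dots> X\<^sub>1\<close> and \<open>p\<close> factors \<open>Y\<close> if \<open>n + 1 \<in> S\<close>, and otherwise it is the new \<open>Y\<close> that is moved to the
  end past as many factors; the sign changes by \<open>(-1)\<^bsup>n + p\<^esup>\<close> in both cases. The exponent
  \<open>(n - 1) p + \<Sum>(i - 1)\<close> also changes by \<open>n + p\<close> modulo 2 in both cases.
\<close>

lemma complementary_shuffle:
  fixes X Y :: "nat \<Rightarrow> 'v shuffle_algebra"
  assumes X: "\<And>i. homog (Suc 0) (X i)" and Y: "\<And>i. homog (Suc 0) (Y i)"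
  shows "oprod (\<lambda>i. X i * Y i) ({1..n} - S) * oprod X ({1..n} \<inter> S) =
    (-1) ^ ((n - 1) * card ({1..n} - S) + (\<Sum>i\<in>{1..n} \<inter> S. i - 1)) *\<^sub>R
      (prod_list (map X (rev [1..<n + 1])) * oprod Y ({1..n} - S))"
proof (induction n)
  case 0
  then show ?case by simp
next
  case (Suc n)
  let ?P = "{1..n} - S" and ?I = "{1..n} \<inter> S" and ?V = "prod_list (map X (rev [1..<n + 1]))"
  define p where "p = card ?P"
  define s where "s = (\<Sum>i\<in>?I. i - 1)"
  define x where "x = X (Suc n)"
  define y where "y = Y (Suc n)"
  define W where "W = oprod (\<lambda>i. X i * Y i) ?P * oprod X ?I"
  have hx: "homog (Suc 0) x" and hy: "homog (Suc 0) y" by (simp_all add: X Y x_def y_def)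
  have hV: "homog n ?V"
    using homog_prod_list[of "rev [1..<n + 1]" X] X by (simp del: upt_Suc)
  have hU: "homog p (oprod Y ?P)"
    using homog_oprod[of ?P "Suc 0" Y] Y by (simp add: p_def)
  have hVU: "homog (n + p) (?V * oprod Y ?P)"
    by (rule homog_mult[OF hV hU])
  have IH: "W = (-1) ^ ((n - 1) * p + s) *\<^sub>R (?V * oprod Y ?P)"
    using Suc.IH by (simp add: W_def p_def s_def)
  have V: "prod_list (map X (rev [1..<Suc n + 1])) = x * ?V"
    by (simp add: x_def)
  \<comment> \<open>Truncated subtraction is harmless because \<open>p = 0\<close> when \<open>n = 0\<close>.\<close>
  have np: "n * p = (n - 1) * p + p"
    by (cases n) (simp_all add: p_def)
  show ?case
  proof (cases "Suc n \<in> S")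
    case True
    then have sets: "{1..Suc n} - S = ?P" "{1..Suc n} \<inter> S = insert (Suc n) ?I"
      by (auto simp: atLeastAtMostSuc_conv)
    have sum: "(\<Sum>i\<in>insert (Suc n) ?I. i - 1) = n + s"
      by (subst sum.insert) (auto simp: s_def)
    have "oprod (\<lambda>i. X i * Y i) ?P * oprod X (insert (Suc n) ?I) = W * x"
      by (subst oprod_insert_max) (auto simp: W_def x_def mult.assoc)
    also have "\<dots> = (-1) ^ ((n - 1) * p + s) *\<^sub>R ((?V * oprod Y ?P) * x)"
      by (simp add: IH)
    also have "(?V * oprod Y ?P) * x = (-1) ^ (n + p) *\<^sub>R (x * (?V * oprod Y ?P))"
      using homog_commute[OF hVU hx] by simp
    also have "(-1) ^ ((n - 1) * p + s) *\<^sub>R (-1) ^ (n + p) *\<^sub>R (x * (?V * oprod Y ?P)) =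
        ((-1) ^ (n * p + (n + s)) :: real) *\<^sub>R (x * ?V * oprod Y ?P)"
      by (simp add: np power_add mult.assoc mult_ac)
    finally show ?thesis unfolding sets V sum by (simp add: p_def)
  next
    case False
    then have sets: "{1..Suc n} - S = insert (Suc n) ?P" "{1..Suc n} \<inter> S = ?I"
      by (auto simp: atLeastAtMostSuc_conv)
    have card: "card (insert (Suc n) ?P) = Suc p" by (simp add: p_def)
    have hZ: "homog (2 * p) (oprod (\<lambda>i. X i * Y i) ?P)"
      using homog_oprod[of ?P 2 "\<lambda>i. X i * Y i"] homog_mult[OF X Y] by (simp add: p_def numeral_2_eq_2)
    have hxy: "homog 2 (x * y)" using homog_mult[OF hx hy] by (simp add: numeral_2_eq_2)
    have "oprod (\<lambda>i. X i * Y i) (insert (Suc n) ?P) * oprod X ?I =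
        (oprod (\<lambda>i. X i * Y i) ?P * (x * y)) * oprod X ?I"
      by (subst oprod_insert_max) (auto simp: x_def y_def)
    also have "oprod (\<lambda>i. X i * Y i) ?P * (x * y) = x * y * oprod (\<lambda>i. X i * Y i) ?P"
      using homog_commute[OF hZ hxy] by simp
    also have "x * y * oprod (\<lambda>i. X i * Y i) ?P * oprod X ?I = x * (y * W)"
      by (simp add: W_def mult.assoc)
    also have "y * W = (-1) ^ ((n - 1) * p + s) *\<^sub>R (y * (?V * oprod Y ?P))"
      by (simp add: IH)
    also have "y * (?V * oprod Y ?P) = (-1) ^ (n + p) *\<^sub>R (?V * oprod Y ?P * y)"
      using homog_commute[OF hy hVU] by simp
    also have "x * ((-1) ^ ((n - 1) * p + s) *\<^sub>R (-1) ^ (n + p) *\<^sub>R (?V * oprod Y ?P * y)) =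
        ((-1) ^ (n * Suc p + s) :: real) *\<^sub>R (x * ?V * (oprod Y ?P * y))"
      by (simp add: np power_add mult.assoc mult_ac)
    also have "oprod Y ?P * y = oprod Y (insert (Suc n) ?P)"
      by (subst oprod_insert_max) (auto simp: y_def)
    finally show ?thesis unfolding sets V card by (simp add: s_def)
  qed
qed

section \<open>Chern class and Chern character\<close>

lemma cis_eq_imp_diff_Ints:
  assumes "cis (2 * pi * s) = cis (2 * pi * t)"
  shows "s - t \<in> \<int>"
proof -
  have "cis (2 * pi * (s - t)) = cis (2 * pi * s) / cis (2 * pi * t)"
    by (simp add: cis_divide algebra_simps)
  also have "\<dots> = 1" using assms by simp
  finally have "cos (2 * pi * (s - t)) = 1" by (metis cis.sel(1) one_complex.sel(1))
  then obtain k :: int where "2 * pi * (s - t) = of_int k * 2 * pi"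
    using cos_one_2pi_int by blast
  then have "s - t = of_int k" by simp
  then show ?thesis by simp
qed

text \<open>
  Two continuous logarithms of the same factor of automorphy differ by a constant on the connected
  space \<open>span \<Xi>\<close>, and the constants cancel in the alternating sum; so one logarithm \<open>F\<close> determines \<open>c\<^sub>1\<close>.
\<close>

lemma chern1_eqI:
  fixes \<Xi> :: "'u::real_normed_vector set"
  assumes F: "\<And>g. g \<in> \<Xi> \<Longrightarrow> continuous_on (span \<Xi>) (F g)"
    and e: "\<And>g v. g \<in> \<Xi> \<Longrightarrow> e g v = cis (2 * pi * F g v)"
    and c: "\<And>g h v. g \<in> \<Xi> \<Longrightarrow> h \<in> \<Xi> \<Longrightarrow> F g (v + h) - F g v - F h (v + g) + F h v = c g h"
  shows "chern1 \<Xi> e = (\<lambda>us. case us of [g, h] \<Rightarrow> if g \<in> \<Xi> \<and> h \<in> \<Xi> then c g h else 0 | _ \<Rightarrow> 0)"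
proof -
  have the: "(THE r. \<exists>f. (\<forall>g\<in>\<Xi>. continuous_on (span \<Xi>) (f g)) \<and>
          (\<forall>g\<in>\<Xi>. \<forall>v\<in>span \<Xi>. e g v = cis (2 * pi * f g v)) \<and>
          (\<forall>v\<in>span \<Xi>. r = f g (v + h) - f g v - f h (v + g) + f h v)) = c g h"
    if gh: "g \<in> \<Xi>" "h \<in> \<Xi>" for g h
  proof (rule the_equality)
    show "\<exists>f. (\<forall>g\<in>\<Xi>. continuous_on (span \<Xi>) (f g)) \<and>
          (\<forall>g\<in>\<Xi>. \<forall>v\<in>span \<Xi>. e g v = cis (2 * pi * f g v)) \<and>
          (\<forall>v\<in>span \<Xi>. c g h = f g (v + h) - f g v - f h (v + g) + f h v)"
      using F e c[OF gh] by (intro exI[of _ F]) auto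
  next
    fix r assume "\<exists>f. (\<forall>g\<in>\<Xi>. continuous_on (span \<Xi>) (f g)) \<and>
          (\<forall>g\<in>\<Xi>. \<forall>v\<in>span \<Xi>. e g v = cis (2 * pi * f g v)) \<and>
          (\<forall>v\<in>span \<Xi>. r = f g (v + h) - f g v - f h (v + g) + f h v)"
    then obtain f where f: "\<And>g. g \<in> \<Xi> \<Longrightarrow> continuous_on (span \<Xi>) (f g)"
      "\<And>g v. g \<in> \<Xi> \<Longrightarrow> v \<in> span \<Xi> \<Longrightarrow> e g v = cis (2 * pi * f g v)"
      "\<And>v. v \<in> span \<Xi> \<Longrightarrow> r = f g (v + h) - f g v - f h (v + g) + f h v"
      by blast
    have const: "f g' v - F g' v = f g' 0 - F g' 0" if g': "g' \<in> \<Xi>" and v: "v \<in> span \<Xi>" for g' v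
    proof -
      have int: "f g' w - F g' w \<in> \<int>" if "w \<in> span \<Xi>" for w
        using f(2)[OF g' that] e[OF g'] by (intro cis_eq_imp_diff_Ints) simp
      have "(\<lambda>w. f g' w - F g' w) constant_on span \<Xi>"
      proof (rule continuous_discrete_range_constant)
        show "connected (span \<Xi>)"
          by (intro convex_connected subspace_imp_convex subspace_span)
        show "continuous_on (span \<Xi>) (\<lambda>w. f g' w - F g' w)"
          by (intro continuous_on_diff f(1) F g')
        show "\<exists>\<delta>>0. \<forall>y. y \<in> span \<Xi> \<and> f g' y - F g' y \<noteq> f g' x - F g' x \<longrightarrow>
            \<delta> \<le> norm ((f g' y - F g' y) - (f g' x - F g' x))" if x: "x \<in> span \<Xi>" for x
        proof (intro exI[of _ 1] conjI allI impI)
          fix y assume y: "y \<in> span \<Xi> \<and> f g' y - F g' y \<noteq> f g' x - F g' x"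
          then have "(f g' y - F g' y) - (f g' x - F g' x) \<in> \<int>"
            using Ints_diff[OF int[of y] int[OF x]] by blast
          then show "1 \<le> norm ((f g' y - F g' y) - (f g' x - F g' x))"
            using y by (auto intro!: Ints_nonzero_abs_ge1)
        qed simp
      qed
      then obtain k where "\<And>w. w \<in> span \<Xi> \<Longrightarrow> f g' w - F g' w = k"
        unfolding constant_on_def by blast
      then show ?thesis using v span_zero by metis
    qed
    have "r = f g h - f g 0 - f h g + f h 0" using f(3)[OF span_zero] by simp
    moreover have "F g h - F g 0 - F h g + F h 0 = c g h" using c[OF gh, of 0] by simp
    ultimately show "r = c g h"
      using const[OF gh(1) span_base[OF gh(2)]] const[OF gh(2) span_base[OF gh(1)]] by linarith
  qed
  show ?thesis
    unfolding chern1_def using the by (intro ext) (auto split: list.split)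
qed

lemma chern1_poincare_power:
  fixes \<Xi> :: "('v::real_normed_vector \<times> 'v dual) set"
  shows "chern1 \<Xi> (tensor_power poincare_bundle k) = (\<lambda>us. case us of [g, h] \<Rightarrow>
    if g \<in> \<Xi> \<and> h \<in> \<Xi> then of_int k * (blinfun_apply (snd h) (fst g) - blinfun_apply (snd g) (fst h))
    else 0 | _ \<Rightarrow> 0)"
proof (rule chern1_eqI)
  show "continuous_on (span \<Xi>) (\<lambda>v. of_int k * blinfun_apply (snd v) (fst g))" for g :: "'v \<times> 'v dual"
    by (intro continuous_intros)
  show "tensor_power poincare_bundle k g v = cis (2 * pi * (of_int k * blinfun_apply (snd v) (fst g)))"
    for g v :: "'v \<times> 'v dual"
    by (simp add: tensor_power_def poincare_bundle_def case_prod_beta cis_power_int mult_ac)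
qed (simp add: blinfun.bilinear_simps algebra_simps)

lemma cup_linear_class_pair:
  "cup (linear_class \<Xi> a) (linear_class \<Xi> b) = (\<lambda>us. case us of [g, h] \<Rightarrow>
    if g \<in> \<Xi> \<and> h \<in> \<Xi> then a g * b h - a h * b g else 0 | _ \<Rightarrow> 0)"
proof
  fix us
  have hom: "homog (Suc 0 + Suc 0) (cls (linear_class \<Xi> a) * cls (linear_class \<Xi> b))"
    by (intro homog_mult homog_linear_class)
  show "cup (linear_class \<Xi> a) (linear_class \<Xi> b) us = (case us of [g, h] \<Rightarrow>
    if g \<in> \<Xi> \<and> h \<in> \<Xi> then a g * b h - a h * b g else 0 | _ \<Rightarrow> 0)"
  proof (cases "length us = 2")
    case True
    then obtain g h where "us = [g, h]" by (auto simp: numeral_2_eq_2 length_Suc_conv)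
    then show ?thesis
      by (simp add: cup_homog_1_Cons[OF homog_linear_class] cup_Nil) (simp add: contract_def)
  next
    case False
    then show ?thesis using hom
      by (auto simp: homog_def cls_cup[symmetric] split: list.split)
  qed
qed

text \<open>
  The upper bound \<open>length vs\<close> in the definition of the Chern character cuts off no term: the product
  over \<open>P\<close> lives in degree \<open>2 |P|\<close>.
\<close>

lemma chern_character_eq_sum_oprod:
  fixes Z :: "nat \<Rightarrow> 'u::real_normed_vector shuffle_algebra"
  assumes c: "cls (chern1 \<Xi> e) = (\<Sum>i\<in>{1..n}. Z i)"
    and hom: "\<And>i. homog 2 (Z i)" and sq: "\<And>i. Z i * Z i = 0"
  shows "cls (chern_character \<Xi> e) = (\<Sum>P\<in>Pow {1..n}. oprod Z P)"
proof (rule form_eqI)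
  fix vs
  have comm: "Z i * Z j = Z j * Z i" for i j
    using homog_commute[OF hom hom] by simp
  have hP: "form (oprod Z P) vs = 0" if "P \<in> Pow {1..n}" "length vs < card P" for P
  proof -
    have "homog (2 * card P) (oprod Z P)"
      using that by (intro homog_oprod hom) (auto intro: finite_subset)
    then show ?thesis using that by (simp add: homog_def)
  qed
  have "form (cls (chern_character \<Xi> e)) vs =
      (\<Sum>p\<le>length vs. form ((1 / fact p) *\<^sub>R (\<Sum>i\<in>{1..n}. Z i) ^ p) vs)"
    unfolding form_cls chern_character_def
  proof (intro sum.cong refl)
    fix p
    have "cups (replicate p (chern1 \<Xi> e)) = form (cls (chern1 \<Xi> e) ^ p)"
      by (metis cls_cups form_cls map_replicate prod_list_replicate)
    then show "cups (replicate p (chern1 \<Xi> e)) vs / fact p =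
        form ((1 / fact p) *\<^sub>R (\<Sum>i\<in>{1..n}. Z i) ^ p) vs"
      by (simp add: c form_simps)
  qed
  also have "\<dots> = (\<Sum>p\<le>length vs. \<Sum>P\<in>{P. P \<subseteq> {1..n} \<and> card P = p}. form (oprod Z P) vs)"
    unfolding divided_power_sum[OF comm sq] form_sum ..
  also have "\<dots> = (\<Sum>P\<in>{P \<in> Pow {1..n}. card P \<le> length vs}. form (oprod Z P) vs)"
  proof -
    have "(\<Sum>p\<le>length vs. \<Sum>P\<in>{P \<in> {P \<in> Pow {1..n}. card P \<le> length vs}. card P = p}. form (oprod Z P) vs) =
        (\<Sum>P\<in>{P \<in> Pow {1..n}. card P \<le> length vs}. form (oprod Z P) vs)"
      by (rule sum.group) auto
    moreover have "{P \<in> {P \<in> Pow {1..n}. card P \<le> length vs}. card P = p} = {P. P \<subseteq> {1..n} \<and> card P = p}"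
      if "p \<le> length vs" for p using that by auto
    ultimately show ?thesis by simp
  qed
  also have "\<dots> = (\<Sum>P\<in>Pow {1..n}. form (oprod Z P) vs)"
    using hP by (intro sum.mono_neutral_left) (auto simp: not_le)
  finally show "form (cls (chern_character \<Xi> e)) vs = form (\<Sum>P\<in>Pow {1..n}. oprod Z P) vs"
    by (simp add: form_sum)
qed

section \<open>Integral bases\<close>

text \<open>
  The length of an integral basis is the dimension of the real span of the lattice.
\<close>

lemma zbasis_length_eq:
  assumes "zbasis \<Gamma> bs" "zbasis \<Gamma> cs" shows "length bs = length cs"
proof -
  have "length bs = dim \<Gamma>" if zb: "zbasis \<Gamma> bs" for bs
  proof -
    have "\<Gamma> \<subseteq> span (set bs)"
      using zb unfolding zbasis_def by (auto intro!: span_sum span_scale[OF span_base])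
    then have "dim \<Gamma> = card (set bs)"
      using zbasis_subset[OF zb] zb by (intro dim_unique) (auto simp: zbasis_def)
    then show ?thesis using zb by (simp add: zbasis_def distinct_card)
  qed
  then show ?thesis using assms by metis
qed

definition zspan :: "'v::real_vector list \<Rightarrow> 'v set" where
  "zspan bs = range (\<lambda>c :: nat \<Rightarrow> int. \<Sum>i<length bs. of_int (c i) *\<^sub>R bs ! i)"

lemma zbasis_zspan: "zbasis \<Gamma> bs \<longleftrightarrow> distinct bs \<and> independent (set bs) \<and> \<Gamma> = zspan bs"
  by (simp add: zbasis_def zspan_def)

lemma zspan_Nil: "zspan [] = {0}"
  by (simp add: zspan_def)

lemma zspan_Cons: "zspan (b # bs) = {of_int k *\<^sub>R b + v | k v. v \<in> zspan bs}"
proof (intro equalityI subsetI)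
  fix u assume "u \<in> zspan (b # bs)"
  then obtain c :: "nat \<Rightarrow> int" where "u = (\<Sum>i<Suc (length bs). of_int (c i) *\<^sub>R (b # bs) ! i)"
    by (auto simp: zspan_def)
  also have "\<dots> = of_int (c 0) *\<^sub>R b + (\<Sum>i<length bs. of_int ((c \<circ> Suc) i) *\<^sub>R bs ! i)"
    by (simp only: sum.lessThan_Suc_shift nth_Cons_0 nth_Cons_Suc comp_def)
  finally show "u \<in> {of_int k *\<^sub>R b + v | k v. v \<in> zspan bs}" unfolding zspan_def by blast
next
  fix u assume "u \<in> {of_int k *\<^sub>R b + v | k v. v \<in> zspan bs}"
  then obtain k and c :: "nat \<Rightarrow> int" where "u = of_int k *\<^sub>R b + (\<Sum>i<length bs. of_int (c i) *\<^sub>R bs ! i)"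
    by (auto simp: zspan_def)
  then have "u = (\<Sum>i<length (b # bs). of_int (case_nat k c i) *\<^sub>R (b # bs) ! i)"
    by (simp add: sum.lessThan_Suc_shift del: sum.lessThan_Suc)
  then show "u \<in> zspan (b # bs)" unfolding zspan_def by blast
qed

lemma zspan_append: "zspan (as @ bs) = {u + v | u v. u \<in> zspan as \<and> v \<in> zspan bs}"
proof (induction as)
  case Nil
  then show ?case by (simp add: zspan_Nil)
next
  case (Cons a as)
  show ?case
  proof (intro equalityI subsetI)
    fix x assume "x \<in> zspan ((a # as) @ bs)"
    then obtain k u w where "x = of_int k *\<^sub>R a + (u + w)" "u \<in> zspan as" "w \<in> zspan bs"
      by (auto simp: zspan_Cons Cons.IH)
    then have "x = (of_int k *\<^sub>R a + u) + w" "of_int k *\<^sub>R a + u \<in> zspan (a # as)" "w \<in> zspan bs"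
      by (auto simp: zspan_Cons)
    then show "x \<in> {u + v | u v. u \<in> zspan (a # as) \<and> v \<in> zspan bs}" by blast
  next
    fix x assume "x \<in> {u + v | u v. u \<in> zspan (a # as) \<and> v \<in> zspan bs}"
    then obtain k u w where "x = (of_int k *\<^sub>R a + u) + w" "u \<in> zspan as" "w \<in> zspan bs"
      by (auto simp: zspan_Cons)
    then have "x = of_int k *\<^sub>R a + (u + w)" "u + w \<in> zspan (as @ bs)"
      by (auto simp: Cons.IH)
    then show "x \<in> zspan ((a # as) @ bs)" by (auto simp: zspan_Cons)
  qed
qed

lemma zspan_image:
  assumes "linear f" shows "zspan (map f bs) = f ` zspan bs"
  by (simp add: zspan_def image_image linear_sum[OF assms] linear_scale[OF assms])

text \<open>
  All integral bases below come with dual functionals, which is the quickest way to see that they are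
  independent.
\<close>

lemma independent_if_dual:
  fixes bs :: "'v::real_vector list"
  assumes lin: "\<And>i. i < length bs \<Longrightarrow> linear (\<phi> i :: 'v \<Rightarrow> real)"
    and dual: "\<And>i k. i < length bs \<Longrightarrow> k < length bs \<Longrightarrow> \<phi> i (bs ! k) = (if i = k then 1 else 0)"
  shows "distinct bs" "independent (set bs)"
proof -
  show dist: "distinct bs"
    unfolding distinct_conv_nth
  proof (intro allI impI notI)
    fix i k assume ik: "i < length bs" "k < length bs" "i \<noteq> k" "bs ! i = bs ! k"
    then have "\<phi> i (bs ! i) = 1" "\<phi> i (bs ! i) = 0" using dual[of i i] dual[of i k] by auto
    then show False by simp
  qed
  show "independent (set bs)"
  proof
    assume "dependent (set bs)"
    then obtain u where u: "\<exists>v\<in>set bs. u v \<noteq> 0" "(\<Sum>v\<in>set bs. u v *\<^sub>R v) = 0"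
      by (auto simp: dependent_finite)
    then obtain i where i: "i < length bs" "u (bs ! i) \<noteq> 0" by (auto simp: in_set_conv_nth)
    have "0 = \<phi> i (\<Sum>v\<in>set bs. u v *\<^sub>R v)" by (simp add: u(2) linear_0[OF lin[OF i(1)]])
    also have "\<dots> = (\<Sum>v\<in>set bs. u v * \<phi> i v)"
      by (simp add: linear_sum[OF lin[OF i(1)]] linear_scale[OF lin[OF i(1)]])
    also have "\<dots> = (\<Sum>k<length bs. u (bs ! k) * \<phi> i (bs ! k))"
      using dist by (intro sum.reindex_bij_betw[symmetric]) (simp add: bij_betw_nth)
    also have "\<dots> = (\<Sum>k<length bs. if k = i then u (bs ! k) else 0)"
      by (intro sum.cong refl) (simp add: dual i)
    finally show False using i by simp
  qed
qed

lemma zbasis_prod_basis: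
  assumes as: "zbasis \<Gamma> as" and bs: "zbasis \<Delta> bs"
  shows "zbasis (\<Gamma> \<times> \<Delta>) (prod_basis as bs)"
proof -
  have ext: "\<exists>\<phi>. \<forall>i<length cs. linear (\<phi> i) \<and> (\<forall>k<length cs. \<phi> i (cs ! k) = (if i = k then 1 else (0::real)))"
    if cs: "distinct cs" "independent (set cs)" for cs :: "'c::real_vector list"
  proof -
    have "\<exists>g. linear g \<and> (\<forall>k<length cs. g (cs ! k) = (if i = k then 1 else (0::real)))" if "i < length cs" for i
    proof -
      obtain g where "linear g" "\<forall>x\<in>set cs. g x = (if x = cs ! i then 1 else (0::real))"
        using linear_independent_extend[OF cs(2), of "\<lambda>x. if x = cs ! i then 1 else (0::real)"] by blast
      then show ?thesis using cs(1) that by (intro exI[of _ g]) (auto simp: nth_eq_iff_index_eq)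
    qed
    then show ?thesis by metis
  qed
  obtain \<phi> where \<phi>: "\<And>i. i < length as \<Longrightarrow> linear (\<phi> i)"
    "\<And>i k. i < length as \<Longrightarrow> k < length as \<Longrightarrow> \<phi> i (as ! k) = (if i = k then 1 else (0::real))"
    using ext[of as] as by (auto simp: zbasis_def)
  obtain \<psi> where \<psi>: "\<And>i. i < length bs \<Longrightarrow> linear (\<psi> i)"
    "\<And>i k. i < length bs \<Longrightarrow> k < length bs \<Longrightarrow> \<psi> i (bs ! k) = (if i = k then 1 else (0::real))"
    using ext[of bs] bs by (auto simp: zbasis_def)
  define \<eta> where "\<eta> i = (if i < length as then \<phi> i \<circ> fst else \<psi> (i - length as) \<circ> snd)" for i
  have len: "length (prod_basis as bs) = length as + length bs" by (simp add: prod_basis_def)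
  have nth: "prod_basis as bs ! k = (if k < length as then (as ! k, 0) else (0, bs ! (k - length as)))"
    if "k < length as + length bs" for k
    using that by (auto simp: prod_basis_def nth_append)
  have lin: "linear (\<eta> i)" if "i < length (prod_basis as bs)" for i
    using that \<phi>(1)[of i] \<psi>(1)[of "i - length as"]
    by (auto simp: \<eta>_def len intro!: linear_compose linear_fst linear_snd)
  have dual: "\<eta> i (prod_basis as bs ! k) = (if i = k then 1 else 0)"
    if "i < length (prod_basis as bs)" "k < length (prod_basis as bs)" for i k
  proof (cases "i < length as")
    case True
    then show ?thesis using that \<phi>(2)[of i k] linear_0[OF \<phi>(1)[of i]] by (auto simp: \<eta>_def len nth)
  next
    case False
    then show ?thesis
      using that \<psi>(2)[of "i - length as" "k - length as"] linear_0[OF \<psi>(1)[of "i - length as"]]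
      by (auto simp: \<eta>_def len nth)
  qed
  have "zspan (prod_basis as bs) = {u + v | u v. u \<in> (\<lambda>a. (a, 0)) ` \<Gamma> \<and> v \<in> (\<lambda>b. (0, b)) ` \<Delta>}"
  proof -
    have "linear (\<lambda>a :: 'a. (a, 0 :: 'b))" "linear (\<lambda>b :: 'b. (0 :: 'a, b))"
      by (auto intro!: linearI simp: scaleR_prod_def)
    then show ?thesis
      using as bs by (simp add: prod_basis_def zspan_append zspan_image zbasis_zspan)
  qed
  also have "\<dots> = \<Gamma> \<times> \<Delta>" by (force simp: image_iff)
  finally show ?thesis
    unfolding zbasis_zspan using independent_if_dual[of "prod_basis as bs" \<eta>] lin dual by simp
qed

section \<open>The correspondence defined by a subtorus\<close>

text \<open>
  For the sign \<open>(-1)\<^bsup>m k div 2\<^esup>\<close> the values at \<open>m = 2 n\<close> and \<open>m = 3 n\<close> are \<open>(-1)\<^bsup>n k\<^esup>\<close> and, in even degree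
  \<open>k = 2 p\<close>, \<open>(-1)\<^bsup>3 n p\<^esup>\<close>. The last equation is the balance between the component of degree \<open>2 p\<close> of the
  Chern character on \<open>T\<close>, the class of degree \<open>p + r\<close> on \<open>B\<close> that it contributes to, and the class of
  degree \<open>r\<close> in the normalisation of the orientation of \<open>T\<close>.
\<close>

lemma duality_signs_facts:
  assumes "\<sigma> \<in> duality_signs"
  shows "\<sigma> m k \<in> {1, -1}" and "\<sigma> (4 * n) k = 1" and "\<sigma> (3 * n) 0 = 1"
    and "\<sigma> (2 * n) (p + r) * \<sigma> (2 * n) r = \<sigma> (3 * n) (2 * p)"
proof -
  show "\<sigma> m k \<in> {1, -1}"
    using assms by (cases "even (m * k div 2)") (auto simp: duality_signs_def)
  have half: "4 * n * k div 2 = 2 * (n * k)" "2 * n * k div 2 = n * k" "3 * n * (2 * k) div 2 = 3 * (n * k)" for k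
    by auto
  show "\<sigma> (4 * n) k = 1" "\<sigma> (3 * n) 0 = 1"
    using assms half by (auto simp: duality_signs_def)
  have "(-1) ^ (n * (p + r)) * (-1) ^ (n * r) = ((-1) ^ (3 * (n * p)) :: real)"
    unfolding power_add[symmetric] minus_one_power_iff by simp
  moreover have "\<sigma> = (\<lambda>m k. 1) \<or> \<sigma> = (\<lambda>m k. (-1) ^ (m * k div 2))"
    using assms by (simp add: duality_signs_def)
  ultimately show "\<sigma> (2 * n) (p + r) * \<sigma> (2 * n) r = \<sigma> (3 * n) (2 * p)"
    by (elim disjE) (simp_all only: half mult_1)
qed

text \<open>
  The computation is carried out for a lattice \<open>\<Xi>\<close> of rank \<open>3 n\<close> with a homomorphism \<open>j\<close> to \<open>\<Gamma> \<times> \<Delta>\<close>, and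
  for dual bases whose second halves agree on \<open>\<Xi>\<close>. The agreement expresses that \<open>\<Gamma>\<close> and \<open>\<Delta>\<close> share the
  summand \<open>\<Gamma>2\<close>.
\<close>

locale torus_correspondence =
  fixes n :: nat and \<Gamma> :: "'v::euclidean_space set" and \<Delta> :: "'w::euclidean_space set"
    and \<Xi> :: "'u::real_normed_vector set" and j :: "'u \<Rightarrow> 'v \<times> 'w"
    and l :: "nat \<Rightarrow> 'v" and X :: "nat \<Rightarrow> 'v forms" and d :: "nat \<Rightarrow> 'w" and Y :: "nat \<Rightarrow> 'w forms"
    and as :: "'v list" and bs :: "'w list" and ts :: "'u list" and \<sigma> :: "nat \<Rightarrow> nat \<Rightarrow> real"
  assumes as: "zbasis \<Gamma> as" and bs: "zbasis \<Delta> bs" and ts: "zbasis \<Xi> ts"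
    and length_ts: "length ts = 3 * n"
    and X: "dual_basis \<Gamma> [1..<2 * n + 1] l X" and Y: "dual_basis \<Delta> [1..<2 * n + 1] d Y"
    and j_in: "j ` \<Xi> \<subseteq> \<Gamma> \<times> \<Delta>"
    and j_add: "\<And>u v. u \<in> \<Xi> \<Longrightarrow> v \<in> \<Xi> \<Longrightarrow> j (u + v) = j u + j v"
    and X_eq_Y: "\<And>i. i \<in> {n + 1..2 * n} \<Longrightarrow> pullback (fst \<circ> j) \<Xi> (X i) = pullback (snd \<circ> j) \<Xi> (Y i)"
    and \<sigma>: "\<sigma> \<in> duality_signs"
begin

abbreviation "ABs \<equiv> prod_basis as bs"
abbreviation "push a \<equiv> pushforward \<sigma> j \<Xi> ts (\<Gamma> \<times> \<Delta>) ABs a"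
abbreviation "q1 \<equiv> pullback (fst \<circ> j) \<Xi>"
abbreviation "q2 \<equiv> pullback (snd \<circ> j) \<Xi>"

text \<open>
  The integral of \<open>a \<union> q\<^sub>1\<^sup>* h \<union> q\<^sub>2\<^sup>* b\<close> over \<open>T\<close>, with the duality sign of \<open>a\<close>.
\<close>

definition transfer :: "'u forms \<Rightarrow> 'v forms \<Rightarrow> 'w forms \<Rightarrow> real" where
  "transfer a h b = cup (\<lambda>vs. \<sigma> (3 * n) (length vs) * a vs) (cup (q1 h) (q2 b)) ts"

lemma groups: "add_subgroup \<Gamma>" "add_subgroup \<Delta>" "add_subgroup \<Xi>" "add_subgroup (\<Gamma> \<times> \<Delta>)"
  using as bs ts zbasis_prod_basis[OF as bs] by (auto intro: zbasis_add_subgroup)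

lemma lengths: "length as = 2 * n" "length bs = 2 * n" "length ABs = 4 * n"
proof -
  have "zbasis \<Gamma> (map l [1..<2 * n + 1])" "zbasis \<Delta> (map d [1..<2 * n + 1])"
    using X Y by (simp_all add: dual_basis_def)
  then show "length as = 2 * n" "length bs = 2 * n"
    using zbasis_length_eq[OF as] zbasis_length_eq[OF bs] by fastforce+
  then show "length ABs = 4 * n" by (simp add: prod_basis_def)
qed

lemma \<sigma>_pm: "\<sigma> m k \<in> {1, -1}" and \<sigma>_nz: "\<sigma> m k \<noteq> 0"
  using duality_signs_facts(1)[OF \<sigma>, of m k] by auto

lemma push_cohomology:
  assumes "a \<in> cohomology \<int> \<Xi>" shows "push a \<in> cohomology \<int> (\<Gamma> \<times> \<Delta>)"
  using cohomology_val[OF assms] Ints_subset_Rats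
  by (intro pushforward_cohomology(1) zbasis_prod_basis as bs \<sigma>_pm coeff_rings) auto

lemma projection_cohomology:
  "h \<in> cohomology \<rat> \<Gamma> \<Longrightarrow> pullback fst (\<Gamma> \<times> \<Delta>) h \<in> cohomology \<rat> (\<Gamma> \<times> \<Delta>)"
  "b \<in> cohomology \<rat> \<Delta> \<Longrightarrow> pullback snd (\<Gamma> \<times> \<Delta>) b \<in> cohomology \<rat> (\<Gamma> \<times> \<Delta>)"
  by (rule pullback_cohomology; use groups coeff_rings in auto)+

text \<open>
  The projection formula. No sign arises on \<open>A \<times> B\<close>, whose real dimension \<open>4 n\<close> makes all duality
  signs trivial, so the adjunction defining \<open>j\<^sub>*\<close> can be applied to \<open>p\<^sub>1\<^sup>* h \<union> p\<^sub>2\<^sup>* b\<close>.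
\<close>

lemma push_cup_pairing:
  assumes a: "a \<in> cohomology \<int> \<Xi>" and h: "h \<in> cohomology \<rat> \<Gamma>" and b: "b \<in> cohomology \<rat> \<Delta>"
  shows "poincare_dual \<sigma> ABs (cup (push a) (pullback fst (\<Gamma> \<times> \<Delta>) h)) (pullback snd (\<Gamma> \<times> \<Delta>) b) =
    transfer a h b"
proof -
  let ?hb = "cup (pullback fst (\<Gamma> \<times> \<Delta>) h) (pullback snd (\<Gamma> \<times> \<Delta>) b)"
  have pd: "poincare_dual \<sigma> ABs c e = cup c e ABs" for c e
    by (simp add: poincare_dual_def lengths(3) duality_signs_facts(2)[OF \<sigma>])
  have hb: "?hb \<in> cohomology \<rat> (\<Gamma> \<times> \<Delta>)"
    by (intro cohomology_cup groups coeff_rings projection_cohomology h b)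
  have "poincare_dual \<sigma> ABs (cup (push a) (pullback fst (\<Gamma> \<times> \<Delta>) h)) (pullback snd (\<Gamma> \<times> \<Delta>) b) =
      poincare_dual \<sigma> ABs (push a) ?hb"
    by (simp add: pd cup_assoc)
  also have "\<dots> = poincare_dual \<sigma> ts a (pullback j \<Xi> ?hb)"
    using cohomology_val[OF a] Ints_subset_Rats hb
    by (intro pushforward_cohomology(2)[where R = \<int>] zbasis_prod_basis as bs \<sigma>_pm coeff_rings) auto
  also have "pullback j \<Xi> ?hb = cup (q1 h) (q2 b)"
    by (simp add: pullback_cup pullback_pullback[OF j_in])
  finally show ?thesis by (simp add: poincare_dual_def transfer_def length_ts)
qed

lemma corr_push:
  assumes a: "a \<in> cohomology \<int> \<Xi>" and h: "h \<in> cohomology \<rat> \<Gamma>"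
  shows "corr \<sigma> \<Gamma> \<Delta> as bs (push a) h \<in> cohomology \<rat> \<Delta>"
    and "b \<in> cohomology \<rat> \<Delta> \<Longrightarrow> poincare_dual \<sigma> bs (corr \<sigma> \<Gamma> \<Delta> as bs (push a) h) b = transfer a h b"
proof -
  have "push a \<in> cohomology \<rat> (\<Gamma> \<times> \<Delta>)"
    using push_cohomology[OF a] cohomology_mono[OF Ints_subset_Rats] by blast
  then have "cup (push a) (pullback fst (\<Gamma> \<times> \<Delta>) h) \<in> cohomology \<rat> (\<Gamma> \<times> \<Delta>)"
    by (intro cohomology_cup groups coeff_rings projection_cohomology h)
  then have val: "cup (push a) (pullback fst (\<Gamma> \<times> \<Delta>) h) vs \<in> \<rat>" for vs
    by (rule cohomology_val)
  show "corr \<sigma> \<Gamma> \<Delta> as bs (push a) h \<in> cohomology \<rat> \<Delta>"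
    unfolding corr_def
    by (intro pushforward_cohomology(1) bs \<sigma>_pm coeff_rings Ints_subset_Rats subset_refl val)
  show "poincare_dual \<sigma> bs (corr \<sigma> \<Gamma> \<Delta> as bs (push a) h) b = transfer a h b" if b: "b \<in> cohomology \<rat> \<Delta>"
    unfolding corr_def push_cup_pairing[OF a h b, symmetric]
    by (intro pushforward_cohomology(2)[where R = \<rat>] bs \<sigma>_pm coeff_rings Ints_subset_Rats subset_refl val b)
qed

lemma corr_push_eqI:
  assumes a: "a \<in> cohomology \<int> \<Xi>" and h: "h \<in> cohomology \<rat> \<Gamma>" and c: "c \<in> cohomology \<rat> \<Delta>"
    and eq: "\<And>b. b \<in> cohomology \<rat> \<Delta> \<Longrightarrow> poincare_dual \<sigma> bs c b = transfer a h b"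
  shows "corr \<sigma> \<Gamma> \<Delta> as bs (push a) h = c"
  using corr_push[OF a h] c eq \<sigma>_nz by (intro poincare_dual_inject[OF bs, of \<sigma>]) auto

lemma corr_push_add:
  assumes a: "a \<in> cohomology \<int> \<Xi>" and h: "h \<in> cohomology \<rat> \<Gamma>" "h' \<in> cohomology \<rat> \<Gamma>"
  shows "corr \<sigma> \<Gamma> \<Delta> as bs (push a) (\<lambda>vs. h vs + h' vs) =
    (\<lambda>vs. corr \<sigma> \<Gamma> \<Delta> as bs (push a) h vs + corr \<sigma> \<Gamma> \<Delta> as bs (push a) h' vs)"
proof (rule corr_push_eqI[OF a])
  show "(\<lambda>vs. h vs + h' vs) \<in> cohomology \<rat> \<Gamma>"
    by (intro cohomology_add coeff_rings h)
  show "(\<lambda>vs. corr \<sigma> \<Gamma> \<Delta> as bs (push a) h vs + corr \<sigma> \<Gamma> \<Delta> as bs (push a) h' vs) \<in> cohomology \<rat> \<Delta>"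
    by (intro cohomology_add coeff_rings corr_push a h)
  show "poincare_dual \<sigma> bs (\<lambda>vs. corr \<sigma> \<Gamma> \<Delta> as bs (push a) h vs + corr \<sigma> \<Gamma> \<Delta> as bs (push a) h' vs) b =
      transfer a (\<lambda>vs. h vs + h' vs) b" if b: "b \<in> cohomology \<rat> \<Delta>" for b
  proof -
    have "poincare_dual \<sigma> bs (\<lambda>vs. c vs + c' vs) b = poincare_dual \<sigma> bs c b + poincare_dual \<sigma> bs c' b" for c c'
      by (simp add: poincare_dual_def cup_add_left distrib_left)
    moreover have "q1 (\<lambda>vs. h vs + h' vs) = (\<lambda>vs. q1 h vs + q1 h' vs)"
      by (auto simp: pullback_def)
    then have "transfer a (\<lambda>vs. h vs + h' vs) b = transfer a h b + transfer a h' b"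
      by (simp add: transfer_def cup_add_left cup_add_right)
    ultimately show ?thesis using corr_push(2)[OF a _ b] h by simp
  qed
qed

text \<open>
  The classes are extended by zero to all indices, which keeps them homogeneous of degree one and so
  lets the lemmas on ordered products apply.
\<close>

definition XT :: "nat \<Rightarrow> 'u shuffle_algebra" where
  "XT i = (if i \<in> {1..2 * n} then cls (q1 (X i)) else 0)"

definition YT :: "nat \<Rightarrow> 'u shuffle_algebra" where
  "YT i = (if i \<in> {1..2 * n} then cls (q2 (Y i)) else 0)"

lemma homog_XT: "homog (Suc 0) (XT i)" and homog_YT: "homog (Suc 0) (YT i)"
proof -
  have "homog (Suc 0) (0 :: 'u shuffle_algebra)" by (simp add: homog_def form_simps)
  then show "homog (Suc 0) (XT i)" "homog (Suc 0) (YT i)"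
    using X Y unfolding XT_def YT_def dual_basis_def by (auto intro!: homog_pullback)
qed

lemma XT_eq_YT: "i \<in> {n + 1..2 * n} \<Longrightarrow> XT i = YT i"
  by (simp add: XT_def YT_def X_eq_Y)

lemma q1_monomial: "S \<subseteq> {1..2 * n} \<Longrightarrow> cls (q1 (monomial X S)) = oprod XT S"
  and q2_monomial: "S \<subseteq> {1..2 * n} \<Longrightarrow> cls (q2 (monomial Y S)) = oprod YT S"
  unfolding pullback_monomial cls_monomial
  by (intro oprod_cong; auto simp: XT_def YT_def intro: finite_subset)+

lemma monomial_Y_cohomology: "S \<subseteq> {1..2 * n} \<Longrightarrow> monomial Y S \<in> cohomology \<rat> \<Delta>"
  by (rule monomial_cohomology[OF Y]) (auto simp: coeff_rings Ints_subset_Rats)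

lemma monomial_X_cohomology: "S \<subseteq> {1..2 * n} \<Longrightarrow> \<int> \<subseteq> R \<Longrightarrow> coeff_ring R \<Longrightarrow> monomial X S \<in> cohomology R \<Gamma>"
  by (rule monomial_cohomology[OF X]) auto

text \<open>
  If \<open>P\<close> and \<open>S\<close> overlap, some \<open>XT i\<close> is repeated. Otherwise the factors \<open>XT\<close> take fewer than \<open>n\<close> of the
  \<open>3 n\<close> arguments, and \<open>c\<close> vanishes on the remaining ones, which are more than \<open>2 n\<close>.
\<close>

lemma integral_wrong_complement:
  assumes P: "P \<subseteq> {1..n}" and S: "S \<subseteq> {1..n}" and neq: "P \<noteq> {1..n} - S"
    and c: "c \<in> cohomology R \<Delta>"
  shows "form (oprod XT P * oprod XT S * cls (q2 c)) ts = 0"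
proof -
  have fin: "finite P" "finite S" using P S finite_subset by auto
  show ?thesis
  proof (cases "P \<inter> S = {}")
    case False
    then have "\<not> distinct (sorted_list_of_set P @ sorted_list_of_set S)"
      using fin by simp
    then have "prod_list (map XT (sorted_list_of_set P @ sorted_list_of_set S)) = 0"
      by (rule prod_list_homog_1_repeat[rotated]) (rule homog_XT)
    then have "oprod XT P * oprod XT S = 0" by (simp add: oprod_def)
    then show ?thesis by (simp add: form_simps)
  next
    case True
    then have "P \<union> S \<noteq> {1..n}" using neq by auto
    then have "card (P \<union> S) < card {1..n}"
      using P S by (intro psubset_card_mono) auto
    then have less: "card P + card S < n"
      using True fin by (simp add: card_Un_disjoint)
    have hom: "homog (card P + card S) (oprod XT P * oprod XT S)"
      using homog_oprod[OF fin(1) homog_XT] homog_oprod[OF fin(2) homog_XT] by (simp add: homog_mult)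
    have "cup (form (oprod XT P * oprod XT S)) (q2 c) ts = 0"
      unfolding cup_def
    proof (intro sum.neutral ballI)
      fix A
      have "form (oprod XT P * oprod XT S) (nths ts A) = 0 \<or> q2 c (nths ts (- A)) = 0"
      proof (cases "length (nths ts A) = card P + card S")
        case True
        then have "length (nths ts (- A)) > length [1..<2 * n + 1]"
          using length_nths_Compl[of ts A] length_ts less by simp
        then have "c (map (snd \<circ> j) (nths ts (- A))) = 0"
          by (intro cohomology_above_rank[OF Y c]) simp
        then show ?thesis by (simp add: pullback_def)
      next
        case False
        then show ?thesis using hom by (simp add: homog_def)
      qed
      then show "shuffle_sign A (length ts) * form (oprod XT P * oprod XT S) (nths ts A) * q2 c (nths ts (- A)) = 0"
        by auto
    qed
    then show ?thesis by (simp add: times_shuffle_algebra.rep_eq)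
  qed
qed

text \<open>
  Summing over the terms of the Chern character, only \<open>P = {1..n} - S\<close> survives. Its factors are put into
  the order that occurs in the normalisation of the orientation of \<open>T\<close>.
\<close>

lemma transfer_monomials:
  assumes ch: "cls ch = (\<Sum>P\<in>Pow {1..n}. oprod (\<lambda>i. ((-1) ^ (n - 1)) *\<^sub>R (XT i * YT i)) P)"
    and S: "S \<subseteq> {1..n}" and R: "R \<subseteq> {n + 1..2 * n}" and b: "b \<in> cohomology \<rat> \<Delta>"
  shows "transfer ch (cup (monomial X S) (monomial X R)) b =
    \<sigma> (3 * n) (2 * card ({1..n} - S)) * (-1) ^ (card S * card R + (\<Sum>i\<in>S. i - 1)) *
    form (oprod XT R * prod_list (map XT (rev [1..<n + 1])) * (oprod YT ({1..n} - S) * cls (q2 b))) ts"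
proof -
  let ?Z = "\<lambda>i. ((-1) ^ (n - 1)) *\<^sub>R (XT i * YT i)"
  let ?C = "{1..n} - S" and ?B = "cls (q2 b)" and ?V = "prod_list (map XT (rev [1..<n + 1]))"
  have fin: "finite S" "finite R" "\<And>P. P \<in> Pow {1..n} \<Longrightarrow> finite P"
    using S R by (auto intro: finite_subset)
  have Z: "homog 2 (?Z i)" for i
    using homog_mult[OF homog_XT[of i] homog_YT[of i]] by (simp add: homog_def form_simps numeral_2_eq_2)
  \<comment> \<open>The duality sign depends on the degree, so it acts on each term separately.\<close>
  have twist: "cls (\<lambda>vs. \<sigma> (3 * n) (length vs) * ch vs) =
      (\<Sum>P\<in>Pow {1..n}. \<sigma> (3 * n) (2 * card P) *\<^sub>R oprod ?Z P)"
  proof (rule form_eqI)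
    fix vs
    have "ch vs = (\<Sum>P\<in>Pow {1..n}. form (oprod ?Z P) vs)"
      using arg_cong[OF ch, of "\<lambda>c. form c vs"] by (simp add: form_sum)
    then have "form (cls (\<lambda>vs. \<sigma> (3 * n) (length vs) * ch vs)) vs =
        (\<Sum>P\<in>Pow {1..n}. \<sigma> (3 * n) (length vs) * form (oprod ?Z P) vs)"
      by (simp add: sum_distrib_left)
    also have "\<dots> = (\<Sum>P\<in>Pow {1..n}. \<sigma> (3 * n) (2 * card P) * form (oprod ?Z P) vs)"
    proof (intro sum.cong refl)
      fix P assume "P \<in> Pow {1..n}"
      then have "homog (2 * card P) (oprod ?Z P)" using fin(3) Z by (intro homog_oprod)
      then show "\<sigma> (3 * n) (length vs) * form (oprod ?Z P) vs = \<sigma> (3 * n) (2 * card P) * form (oprod ?Z P) vs"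
        by (cases "length vs = 2 * card P") (auto simp: homog_def)
    qed
    finally show "form (cls (\<lambda>vs. \<sigma> (3 * n) (length vs) * ch vs)) vs =
        form (\<Sum>P\<in>Pow {1..n}. \<sigma> (3 * n) (2 * card P) *\<^sub>R oprod ?Z P) vs"
      by (simp add: form_sum form_simps)
  qed
  have XR: "oprod XT R = oprod YT R"
    using R fin by (intro oprod_cong) (auto simp: XT_eq_YT)
  have h: "cls (q1 (cup (monomial X S) (monomial X R))) = oprod XT S * oprod XT R"
  proof -
    have "S \<subseteq> {1..2 * n}" "R \<subseteq> {1..2 * n}" using S R by auto
    then show ?thesis unfolding pullback_cup cls_cup by (simp only: q1_monomial)
  qed
  have "transfer ch (cup (monomial X S) (monomial X R)) b =
      form (cls (\<lambda>vs. \<sigma> (3 * n) (length vs) * ch vs) * (oprod XT S * oprod XT R * ?B)) ts"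
    by (simp add: transfer_def times_shuffle_algebra.rep_eq flip: h)
  also have "\<dots> = (\<Sum>P\<in>Pow {1..n}. \<sigma> (3 * n) (2 * card P) *
      form (oprod ?Z P * (oprod XT S * oprod XT R * ?B)) ts)"
    by (simp add: twist sum_distrib_right form_sum form_simps)
  also have "\<dots> = (\<Sum>P\<in>Pow {1..n}. if P = ?C then \<sigma> (3 * n) (2 * card P) *
      form (oprod ?Z P * (oprod XT S * oprod XT R * ?B)) ts else 0)"
  proof (intro sum.cong refl)
    fix P assume P: "P \<in> Pow {1..n}"
    have "form (oprod ?Z P * (oprod XT S * oprod XT R * ?B)) ts = 0" if "P \<noteq> ?C"
    proof -
      obtain s :: real where s: "oprod (\<lambda>i. XT i * YT i) P = s *\<^sub>R (oprod XT P * oprod YT P)"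
        using oprod_pairs_sign[of XT YT P, OF homog_XT homog_YT] by blast
      have Z': "oprod ?Z P = (((-1) ^ (n - 1)) ^ card P * s) *\<^sub>R (oprod XT P * oprod YT P)"
        using oprod_scaleR[OF fin(3)[OF P], of "(-1) ^ (n - 1)" "\<lambda>i. XT i * YT i"] s by simp
      have YS: "oprod YT P * oprod XT S = (-1) ^ (card P * card S) *\<^sub>R (oprod XT S * oprod YT P)"
        using homog_commute[OF homog_oprod[OF fin(3)[OF P] homog_YT] homog_oprod[OF fin(1) homog_XT]]
        by simp
      \<comment> \<open>Everything except the \<open>X\<^sub>i\<close> with \<open>i \<le> n\<close> is pulled back from \<open>\<Delta>\<close>.\<close>
      have c: "oprod YT P * (oprod XT R * ?B) = cls (q2 (cup (monomial Y P) (cup (monomial Y R) b)))"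
      proof -
        have "P \<subseteq> {1..2 * n}" "R \<subseteq> {1..2 * n}" using P R by auto
        then show ?thesis unfolding XR pullback_cup cls_cup by (simp only: q2_monomial)
      qed
      have "oprod ?Z P * (oprod XT S * oprod XT R * ?B) =
          (((-1) ^ (n - 1)) ^ card P * s) *\<^sub>R (oprod XT P * (oprod YT P * oprod XT S) * (oprod XT R * ?B))"
        unfolding Z' by (simp add: mult.assoc)
      also have "\<dots> = (((-1) ^ (n - 1)) ^ card P * s * (-1) ^ (card P * card S)) *\<^sub>R
          (oprod XT P * oprod XT S * (oprod YT P * (oprod XT R * ?B)))"
        unfolding YS by (simp add: mult.assoc)
      also have "form \<dots> ts = 0"
        unfolding c scaleR_shuffle_algebra.rep_eq
        using P R S b that
        by (subst integral_wrong_complement[of P S _ \<rat>])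
          (auto intro!: cohomology_cup groups coeff_rings monomial_Y_cohomology)
      finally show ?thesis .
    qed
    then show "\<sigma> (3 * n) (2 * card P) * form (oprod ?Z P * (oprod XT S * oprod XT R * ?B)) ts =
        (if P = ?C then \<sigma> (3 * n) (2 * card P) * form (oprod ?Z P * (oprod XT S * oprod XT R * ?B)) ts else 0)"
      by simp
  qed
  also have "\<dots> = \<sigma> (3 * n) (2 * card ?C) * form (oprod ?Z ?C * (oprod XT S * oprod XT R * ?B)) ts"
    by simp
  also have "oprod ?Z ?C * (oprod XT S * oprod XT R * ?B) =
      (-1) ^ (card S * card R + (\<Sum>i\<in>S. i - 1)) *\<^sub>R (oprod XT R * ?V * (oprod YT ?C * ?B))"
  proof -
    have S': "{1..n} \<inter> S = S" using S by auto
    have k: "oprod ?Z ?C = (-1) ^ ((n - 1) * card ?C) *\<^sub>R oprod (\<lambda>i. XT i * YT i) ?C"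
      by (simp add: oprod_scaleR power_mult)
    have "oprod ?Z ?C * oprod XT S = (-1) ^ (\<Sum>i\<in>S. i - 1) *\<^sub>R (?V * oprod YT ?C)"
    proof -
      have "oprod ?Z ?C * oprod XT S = ((-1) ^ ((n - 1) * card ?C) * (-1) ^ ((n - 1) * card ?C + (\<Sum>i\<in>S. i - 1))) *\<^sub>R
          (?V * oprod YT ?C)"
        using complementary_shuffle[of XT YT n S, OF homog_XT homog_YT]
        unfolding S' k by (simp only: mult_scaleR_left scaleR_scaleR)
      moreover have "(-1) ^ ((n - 1) * card ?C) * (-1) ^ ((n - 1) * card ?C + (\<Sum>i\<in>S. i - 1)) =
          ((-1) ^ (\<Sum>i\<in>S. i - 1) :: real)"
        unfolding power_add[symmetric] minus_one_power_iff by simp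
      ultimately show ?thesis by simp
    qed
    moreover have "?V * oprod YT ?C * oprod XT R = (-1) ^ (card S * card R) *\<^sub>R (oprod XT R * (?V * oprod YT ?C))"
    proof -
      have hV: "homog n ?V"
        using homog_prod_list[of "rev [1..<n + 1]" XT] homog_XT by (simp del: upt_Suc)
      have hC: "homog (card ?C) (oprod YT ?C)" and hR: "homog (card R) (oprod XT R)"
        using homog_oprod[OF _ homog_YT, of ?C] homog_oprod[OF fin(2) homog_XT] by simp_all
      have "card ?C = n - card S" "card S \<le> n"
        using S card_mono[OF _ S] by (simp_all add: card_Diff_subset fin)
      then have "even ((n + card ?C) * card R) \<longleftrightarrow> even (card S * card R)" by auto
      then have "(-1) ^ ((n + card ?C) * card R) = ((-1) ^ (card S * card R) :: real)"
        by (simp add: minus_one_power_iff)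
      then show ?thesis using homog_commute[OF homog_mult[OF hV hC] hR] by simp
    qed
    ultimately have "oprod ?Z ?C * oprod XT S * oprod XT R * ?B =
        ((-1) ^ (\<Sum>i\<in>S. i - 1) * (-1) ^ (card S * card R)) *\<^sub>R (oprod XT R * (?V * oprod YT ?C) * ?B)"
      by simp
    then show ?thesis by (simp add: mult.assoc power_add mult_ac(2))
  qed
  finally show ?thesis by (simp add: form_simps)
qed

lemma pair_square: "(XT i * YT i) * (XT i * YT i) = 0"
proof -
  have swap: "YT i * XT i = - (XT i * YT i)"
    using homog_commute[OF homog_YT homog_XT] by simp
  have "(XT i * YT i) * (XT i * YT i) = XT i * (YT i * XT i) * YT i" by (simp only: mult.assoc)
  also have "\<dots> = - (XT i * XT i * (YT i * YT i))" unfolding swap by (simp add: mult.assoc)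
  finally show ?thesis by (simp add: homog_1_square[OF homog_XT])
qed

lemma exponential_cohomology:
  assumes "k \<in> \<int>"
  shows "form (\<Sum>P\<in>Pow {1..n}. oprod (\<lambda>i. k *\<^sub>R (XT i * YT i)) P) \<in> cohomology \<int> \<Xi>"
proof -
  let ?Z = "\<lambda>i. k *\<^sub>R (XT i * YT i)"
  have q: "q1 f \<in> cohomology \<int> \<Xi>" if "f \<in> cohomology \<int> \<Gamma>" for f
    using j_in j_add by (intro pullback_cohomology[OF groups(3) coeff_rings(1) that groups(1)]) auto
  have q': "q2 f \<in> cohomology \<int> \<Xi>" if "f \<in> cohomology \<int> \<Delta>" for f
    using j_in j_add by (intro pullback_cohomology[OF groups(3) coeff_rings(1) that groups(2)]) auto
  have "form (XT i) \<in> cohomology \<int> \<Xi>" "form (YT i) \<in> cohomology \<int> \<Xi>" for i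
    using X Y cohomology_zero[OF coeff_rings(1)]
    by (auto simp: XT_def YT_def dual_basis_def form_simps simp del: upt_Suc intro!: q q')
  then have Z: "form (?Z i) \<in> cohomology \<int> \<Xi>" for i
    unfolding scaleR_shuffle_algebra.rep_eq times_shuffle_algebra.rep_eq
    by (intro cohomology_scale cohomology_cup groups coeff_rings assms)
  have "form (oprod ?Z P) \<in> cohomology \<int> \<Xi>" for P
  proof -
    have "oprod ?Z P = cls (cups (map (\<lambda>i. form (?Z i)) (sorted_list_of_set P)))"
      by (simp add: cls_cups oprod_def comp_def)
    then have "form (oprod ?Z P) = cups (map (\<lambda>i. form (?Z i)) (sorted_list_of_set P))"
      by simp
    then show ?thesis using Z by (auto intro!: cohomology_cups groups coeff_rings)
  qed
  then have "(\<lambda>vs. \<Sum>P\<in>Pow {1..n}. form (oprod ?Z P) vs) \<in> cohomology \<int> \<Xi>"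
    by (intro cohomology_sum coeff_rings)
  moreover have "form (\<Sum>P\<in>Pow {1..n}. oprod ?Z P) = (\<lambda>vs. \<Sum>P\<in>Pow {1..n}. form (oprod ?Z P) vs)"
    by (rule ext) (rule form_sum)
  ultimately show ?thesis by simp
qed

text \<open>
  The normalisation hypothesis is used with the test class \<open>l\<^sub>P \<union> b\<close>, for \<open>P = {1..n} - S\<close>, in place of \<open>b\<close>.
\<close>

lemma corr_monomials:
  assumes ch: "cls ch = (\<Sum>P\<in>Pow {1..n}. oprod (\<lambda>i. ((-1) ^ (n - 1)) *\<^sub>R (XT i * YT i)) P)"
    and chZ: "ch \<in> cohomology \<int> \<Xi>"
    and norm: "\<And>R. R \<subseteq> {n + 1..2 * n} \<Longrightarrow> corr \<sigma> \<Gamma> \<Delta> as bs (push unit_class)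
      (cup (monomial X R) (cups (map X (rev [1..<n + 1])))) = monomial Y R"
    and S: "S \<subseteq> {1..n}" and R: "R \<subseteq> {n + 1..2 * n}"
  shows "corr \<sigma> \<Gamma> \<Delta> as bs (push ch) (cup (monomial X S) (monomial X R)) =
    (\<lambda>vs. (-1) ^ (card S * card R + (\<Sum>i\<in>S. i - 1)) * cup (monomial Y R) (monomial Y ({1..n} - S)) vs)"
proof (rule corr_push_eqI[OF chZ])
  let ?C = "{1..n} - S" and ?V = "prod_list (map XT (rev [1..<n + 1]))"
  let ?\<epsilon> = "(-1) ^ (card S * card R + (\<Sum>i\<in>S. i - 1)) :: real"
  have sub: "S \<subseteq> {1..2 * n}" "R \<subseteq> {1..2 * n}" "?C \<subseteq> {1..2 * n}" using S R by auto
  have fin: "finite S" "finite R" using S R by (auto intro: finite_subset)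
  note Ycoh = monomial_Y_cohomology[OF sub(2)] monomial_Y_cohomology[OF sub(3)]
  show "cup (monomial X S) (monomial X R) \<in> cohomology \<rat> \<Gamma>"
    using sub by (intro cohomology_cup groups coeff_rings monomial_X_cohomology Ints_subset_Rats)
  show "(\<lambda>vs. ?\<epsilon> * cup (monomial Y R) (monomial Y ?C) vs) \<in> cohomology \<rat> \<Delta>"
    using coeff_ring_sign[OF coeff_rings(2)]
    by (intro cohomology_scale cohomology_cup groups coeff_rings Ycoh) auto
  fix b assume b: "b \<in> cohomology \<rat> \<Delta>"
  let ?b = "cup (monomial Y ?C) b"
  let ?I = "cup (monomial Y R) ?b bs"
  let ?J = "form (oprod XT R * ?V * (oprod YT ?C * cls (q2 b))) ts"
  have scale: "poincare_dual \<sigma> bs c b' = \<sigma> (2 * n) k * cup c b' bs" if "homog k (cls c)" for c k b'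
  proof -
    have "(\<lambda>vs. \<sigma> (length bs) (length vs) * c vs) = (\<lambda>vs. \<sigma> (2 * n) k * c vs)"
    proof
      show "\<sigma> (length bs) (length vs) * c vs = \<sigma> (2 * n) k * c vs" for vs
        using that by (cases "length vs = k") (auto simp: homog_def lengths)
    qed
    then show ?thesis by (simp add: poincare_dual_def cup_scale_left)
  qed
  have homY: "homog (card A) (cls (monomial Y A))" if "A \<subseteq> {1..2 * n}" for A
  proof (rule homog_monomial)
    show "finite A" using that finite_subset by blast
    show "homog (Suc 0) (cls (Y i))" if "i \<in> A" for i
      using Y \<open>i \<in> A\<close> \<open>A \<subseteq> {1..2 * n}\<close> by (auto simp: dual_basis_def simp del: upt_Suc)
  qed
  let ?h = "cup (monomial X R) (cups (map X (rev [1..<n + 1])))"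
  have "cups (map X (rev [1..<n + 1])) \<in> cohomology \<int> \<Gamma>"
    using X by (intro cohomology_cups groups coeff_rings) (auto simp: dual_basis_def)
  then have "cups (map X (rev [1..<n + 1])) \<in> cohomology \<rat> \<Gamma>"
    by (rule subsetD[OF cohomology_mono[OF Ints_subset_Rats]])
  then have h: "?h \<in> cohomology \<rat> \<Gamma>"
    by (intro cohomology_cup groups coeff_rings monomial_X_cohomology Ints_subset_Rats sub)
  have "\<sigma> (2 * n) (card R) * ?I = poincare_dual \<sigma> bs (monomial Y R) ?b"
    by (simp add: scale[OF homY[OF sub(2)]])
  also have "\<dots> = transfer unit_class ?h ?b"
    unfolding norm[OF R, symmetric]
    by (intro corr_push(2) cohomology_unit coeff_rings h cohomology_cup groups Ycoh b)
  also have "\<dots> = ?J"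
  proof -
    have unit: "(\<lambda>vs. \<sigma> (3 * n) (length vs) * unit_class vs) = (unit_class :: 'u forms)"
      by (auto simp: unit_class_def duality_signs_facts(3)[OF \<sigma>])
    have q1h: "cls (q1 ?h) = oprod XT R * ?V"
    proof -
      have V: "map cls (map q1 (map X (rev [1..<n + 1]))) = map XT (rev [1..<n + 1])"
        unfolding map_map by (intro map_cong refl) (auto simp: XT_def)
      show ?thesis
        by (simp only: pullback_cup cls_cup q1_monomial[OF sub(2)] pullback_cups cls_cups V)
    qed
    have q2b: "cls (q2 ?b) = oprod YT ?C * cls (q2 b)"
      by (simp only: pullback_cup cls_cup q2_monomial[OF sub(3)])
    have "cup (q1 ?h) (q2 ?b) = form (cls (q1 ?h) * cls (q2 ?b))"
      by (simp only: times_shuffle_algebra.rep_eq form_cls)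
    then show ?thesis
      by (simp only: transfer_def unit cup_unit_left q1h q2b)
  qed
  finally have IJ: "\<sigma> (2 * n) (card R) * ?I = ?J" .
  have "poincare_dual \<sigma> bs (\<lambda>vs. r * c vs) b = r * poincare_dual \<sigma> bs c b" for r c
    by (simp add: poincare_dual_def mult.left_commute[of _ r] cup_scale_left)
  then have "poincare_dual \<sigma> bs (\<lambda>vs. ?\<epsilon> * cup (monomial Y R) (monomial Y ?C) vs) b =
      ?\<epsilon> * poincare_dual \<sigma> bs (cup (monomial Y R) (monomial Y ?C)) b" .
  also have "poincare_dual \<sigma> bs (cup (monomial Y R) (monomial Y ?C)) b = \<sigma> (2 * n) (card ?C + card R) * ?I"
    using homog_mult[OF homY[OF sub(2)] homY[OF sub(3)]]
    by (subst scale[of "card ?C + card R"]) (simp_all add: cls_cup cup_assoc add.commute)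
  also have "\<sigma> (2 * n) (card ?C + card R) * ?I = \<sigma> (3 * n) (2 * card ?C) * ?J"
  proof -
    have "\<sigma> (2 * n) (card R) * \<sigma> (2 * n) (card R) = 1" using \<sigma>_pm[of "2 * n" "card R"] by auto
    then have "\<sigma> (2 * n) (card ?C + card R) * ?I =
        (\<sigma> (2 * n) (card ?C + card R) * \<sigma> (2 * n) (card R)) * (\<sigma> (2 * n) (card R) * ?I)"
      by (simp add: mult.assoc)
    then show ?thesis unfolding duality_signs_facts(4)[OF \<sigma>] IJ .
  qed
  finally show "poincare_dual \<sigma> bs (\<lambda>vs. ?\<epsilon> * cup (monomial Y R) (monomial Y ?C) vs) b =
      transfer ch (cup (monomial X S) (monomial X R)) b"
    by (simp add: transfer_monomials[OF ch S R b] mult_ac)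
qed

end

section \<open>The lattices of the mirror pair\<close>

lemma zspan_linear_Ints:
  assumes "linear (\<phi> :: 'v::real_vector \<Rightarrow> real)" "\<And>b. b \<in> set bs \<Longrightarrow> \<phi> b \<in> \<int>" "v \<in> zspan bs"
  shows "\<phi> v \<in> \<int>"
proof -
  obtain c :: "nat \<Rightarrow> int" where "v = (\<Sum>i<length bs. of_int (c i) *\<^sub>R bs ! i)"
    using assms(3) by (auto simp: zspan_def)
  then have "\<phi> v = (\<Sum>i<length bs. of_int (c i) * \<phi> (bs ! i))"
    by (simp add: linear_sum[OF assms(1)] linear_scale[OF assms(1)])
  then show ?thesis using assms(2) by (auto intro!: Ints_sum)
qed

lemma zspan_linear_zero:
  assumes "linear (\<phi> :: 'v::real_vector \<Rightarrow> real)" "\<And>b. b \<in> set bs \<Longrightarrow> \<phi> b = 0" "v \<in> zspan bs"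
  shows "\<phi> v = 0"
proof -
  obtain c :: "nat \<Rightarrow> int" where "v = (\<Sum>i<length bs. of_int (c i) *\<^sub>R bs ! i)"
    using assms(3) by (auto simp: zspan_def)
  then have "\<phi> v = (\<Sum>i<length bs. of_int (c i) * \<phi> (bs ! i))"
    by (simp add: linear_sum[OF assms(1)] linear_scale[OF assms(1)])
  then show ?thesis using assms(2) by auto
qed

lemma linear_blinfun_apply: "linear (blinfun_apply w)"
  by (intro linearI) (simp_all add: blinfun.bilinear_simps)

lemma linear_blinfun_eval: "linear (\<lambda>w. blinfun_apply w v)"
  by (intro linearI) (simp_all add: blinfun.bilinear_simps)

lemma set_map_upt: "set (map f [a..<b + 1]) = f ` {a..b}"
  by (simp add: atLeastLessThanSuc_atLeastAtMost del: upt_Suc)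

lemma upt_split: "[1..<2 * n + 1] = [1..<n + 1] @ [n + 1..<2 * n + 1]"
  using upt_add_eq_append[of 1 "n + 1" n] by (simp add: mult_2 add.assoc del: upt_Suc)

locale adapted_decomposition =
  fixes n :: nat and \<Gamma> \<Gamma>1 \<Gamma>2 :: "'v::euclidean_space set"
    and l :: "nat \<Rightarrow> 'v" and x :: "nat \<Rightarrow> 'v dual"
  assumes Gamma: "\<Gamma> = {u + v | u v. u \<in> \<Gamma>1 \<and> v \<in> \<Gamma>2}" and span: "span \<Gamma> = UNIV"
    and adapted: "adapted_bases n \<Gamma>1 \<Gamma>2 l x"
begin

lemma zb1: "zbasis \<Gamma>1 (map l [1..<n + 1])" and zb2: "zbasis \<Gamma>2 (map l [n + 1..<2 * n + 1])"
  and dual: "i \<in> {1..2 * n} \<Longrightarrow> k \<in> {1..2 * n} \<Longrightarrow> blinfun_apply (x i) (l k) = (if i = k then 1 else 0)"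
  using adapted by (simp_all add: adapted_bases_def)

lemma zbasis_Gamma: "zbasis \<Gamma> (map l [1..<2 * n + 1])"
  unfolding zbasis_zspan
proof (intro conjI)
  have "distinct (map l [1..<2 * n + 1]) \<and> independent (set (map l [1..<2 * n + 1]))"
  proof (intro conjI independent_if_dual[where \<phi> = "\<lambda>i. blinfun_apply (x (Suc i))"] linear_blinfun_apply)
  qed (simp_all add: dual nth_append del: upt_Suc)
  then show "distinct (map l [1..<2 * n + 1])" "independent (set (map l [1..<2 * n + 1]))" by auto
  show "\<Gamma> = zspan (map l [1..<2 * n + 1])"
    using zb1 zb2 unfolding zbasis_zspan upt_split map_append zspan_append Gamma by simp
qed

lemma l_in: "i \<in> {1..n} \<Longrightarrow> l i \<in> \<Gamma>1" "i \<in> {n + 1..2 * n} \<Longrightarrow> l i \<in> \<Gamma>2" "i \<in> {1..2 * n} \<Longrightarrow> l i \<in> \<Gamma>"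
  using zbasis_subset[OF zb1] zbasis_subset[OF zb2] zbasis_subset[OF zbasis_Gamma]
  by (auto simp del: upt_Suc)

lemma zero_in: "0 \<in> \<Gamma>" "0 \<in> \<Gamma>1" "0 \<in> \<Gamma>2"
  using zbasis_add_subgroup[OF zbasis_Gamma] zbasis_add_subgroup[OF zb1] zbasis_add_subgroup[OF zb2]
  by (simp_all add: add_subgroup_def)

lemma Gamma_subset: "\<Gamma>1 \<subseteq> \<Gamma>" "\<Gamma>2 \<subseteq> \<Gamma>"
proof -
  show "\<Gamma>1 \<subseteq> \<Gamma>"
  proof
    show "u \<in> \<Gamma>" if "u \<in> \<Gamma>1" for u
      unfolding Gamma using that zero_in(3) by (intro CollectI exI[of _ u] exI[of _ 0]) simp
  qed
  show "\<Gamma>2 \<subseteq> \<Gamma>"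
  proof
    show "u \<in> \<Gamma>" if "u \<in> \<Gamma>2" for u
      unfolding Gamma using that zero_in(2) by (intro CollectI exI[of _ 0] exI[of _ u]) simp
  qed
qed

lemma in_zspan:
  "v \<in> \<Gamma> \<Longrightarrow> v \<in> zspan (map l [1..<2 * n + 1])"
  "v \<in> \<Gamma>1 \<Longrightarrow> v \<in> zspan (map l [1..<n + 1])"
  "v \<in> \<Gamma>2 \<Longrightarrow> v \<in> zspan (map l [n + 1..<2 * n + 1])"
  using zbasis_Gamma zb1 zb2 unfolding zbasis_zspan by blast+

lemma x_dual_lattice:
  assumes i: "i \<in> {1..2 * n}" shows "x i \<in> dual_lattice \<Gamma>"
proof -
  have "blinfun_apply (x i) v \<in> \<int>" if "v \<in> \<Gamma>" for v
  proof (rule zspan_linear_Ints[OF linear_blinfun_apply _ in_zspan(1)[OF that]])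
    fix b assume "b \<in> set (map l [1..<2 * n + 1])"
    then obtain k where k: "k \<in> {1..2 * n}" "b = l k" unfolding set_map_upt by blast
    then show "blinfun_apply (x i) b \<in> \<int>" using dual[OF i k(1)] by simp
  qed
  then show ?thesis by (simp add: dual_lattice_def)
qed

lemma x_annihilator:
  "i \<in> {1..n} \<Longrightarrow> x i \<in> annihilator \<Gamma> \<Gamma>2" "i \<in> {n + 1..2 * n} \<Longrightarrow> x i \<in> annihilator \<Gamma> \<Gamma>1"
proof -
  show "x i \<in> annihilator \<Gamma> \<Gamma>2" if i: "i \<in> {1..n}"
  proof -
    have "blinfun_apply (x i) v = 0" if "v \<in> \<Gamma>2" for v
    proof (rule zspan_linear_zero[OF linear_blinfun_apply _ in_zspan(3)[OF that]])
      fix b assume "b \<in> set (map l [n + 1..<2 * n + 1])"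
      then obtain k where k: "k \<in> {n + 1..2 * n}" "b = l k" unfolding set_map_upt by blast
      then show "blinfun_apply (x i) b = 0" using dual[of i k] i by auto
    qed
    then show ?thesis using x_dual_lattice[of i] i by (simp add: annihilator_def)
  qed
  show "x i \<in> annihilator \<Gamma> \<Gamma>1" if i: "i \<in> {n + 1..2 * n}"
  proof -
    have "blinfun_apply (x i) v = 0" if "v \<in> \<Gamma>1" for v
    proof (rule zspan_linear_zero[OF linear_blinfun_apply _ in_zspan(2)[OF that]])
      fix b assume "b \<in> set (map l [1..<n + 1])"
      then obtain k where k: "k \<in> {1..n}" "b = l k" unfolding set_map_upt by blast
      then show "blinfun_apply (x i) b = 0" using dual[of i k] i by auto
    qed
    then show ?thesis using x_dual_lattice[of i] i by (simp add: annihilator_def)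
  qed
qed

text \<open>
  Both sides agree on \<open>l\<^sub>1, \<dots>, l\<^bsub>2 n\<^esub>\<close>, which span the whole space: this is where it matters that \<open>\<Gamma>\<close>
  has full rank.
\<close>

lemma annihilator_expansion:
  assumes "w \<in> annihilator \<Gamma> \<Gamma>2"
  shows "w = (\<Sum>i\<in>{1..n}. blinfun_apply w (l i) *\<^sub>R x i)"
proof (rule blinfun_eqI)
  fix v
  let ?w = "\<Sum>i\<in>{1..n}. blinfun_apply w (l i) *\<^sub>R x i"
  have "\<Gamma> \<subseteq> span (set (map l [1..<2 * n + 1]))"
    using zbasis_Gamma unfolding zbasis_def by (auto intro!: span_sum span_scale[OF span_base] simp del: upt_Suc)
  then have "v \<in> span (set (map l [1..<2 * n + 1]))"
    using span_minimal[OF _ subspace_span, of \<Gamma> "set (map l [1..<2 * n + 1])"] span by blast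
  then show "blinfun_apply w v = blinfun_apply ?w v"
  proof (rule linear_eq_on[OF linear_blinfun_apply linear_blinfun_apply])
    fix b assume "b \<in> set (map l [1..<2 * n + 1])"
    then obtain k where k: "k \<in> {1..2 * n}" "b = l k" unfolding set_map_upt by blast
    have "blinfun_apply ?w b = (\<Sum>i\<in>{1..n}. if i = k then blinfun_apply w (l i) else 0)"
      unfolding blinfun.sum_left k(2) using k(1)
      by (intro sum.cong refl) (simp add: dual blinfun.scaleR_left)
    also have "\<dots> = blinfun_apply w b"
      using assms k l_in(2)[of k] by (auto simp: annihilator_def)
    finally show "blinfun_apply w b = blinfun_apply ?w b" by simp
  qed
qed

lemma zbasis_annihilator: "zbasis (annihilator \<Gamma> \<Gamma>2) (map x [1..<n + 1])"
  unfolding zbasis_zspan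
proof (intro conjI)
  have "distinct (map x [1..<n + 1]) \<and> independent (set (map x [1..<n + 1]))"
  proof (intro conjI independent_if_dual[where \<phi> = "\<lambda>i w. blinfun_apply w (l (Suc i))"] linear_blinfun_eval)
  qed (auto simp: dual simp del: upt_Suc)
  then show "distinct (map x [1..<n + 1])" "independent (set (map x [1..<n + 1]))" by auto
  show "annihilator \<Gamma> \<Gamma>2 = zspan (map x [1..<n + 1])"
  proof (intro equalityI subsetI)
    fix w assume w: "w \<in> annihilator \<Gamma> \<Gamma>2"
    have int: "blinfun_apply w (l i) = of_int \<lfloor>blinfun_apply w (l i)\<rfloor>" if "i \<in> {1..n}" for i
      using w l_in(3)[of i] that by (auto simp: annihilator_def dual_lattice_def)
    have "w = (\<Sum>i\<in>{1..n}. of_int \<lfloor>blinfun_apply w (l i)\<rfloor> *\<^sub>R x i)"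
      using annihilator_expansion[OF w] int by simp
    also have "\<dots> = (\<Sum>i<n. of_int \<lfloor>blinfun_apply w (l (Suc i))\<rfloor> *\<^sub>R x (Suc i))"
      by (rule sum.reindex_bij_witness[of _ Suc "\<lambda>i. i - 1"]) auto
    also have "\<dots> = (\<Sum>i<length (map x [1..<n + 1]). of_int \<lfloor>blinfun_apply w (l (Suc i))\<rfloor> *\<^sub>R map x [1..<n + 1] ! i)"
      by (simp del: upt_Suc)
    finally show "w \<in> zspan (map x [1..<n + 1])"
      unfolding zspan_def by (rule range_eqI[where x = "\<lambda>i. \<lfloor>blinfun_apply w (l (Suc i))\<rfloor>"])
  next
    fix w assume w: "w \<in> zspan (map x [1..<n + 1])"
    have "blinfun_apply w v \<in> \<int>" if "v \<in> \<Gamma>" for v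
      using that x_dual_lattice
      by (intro zspan_linear_Ints[OF linear_blinfun_eval _ w]) (auto simp: dual_lattice_def simp del: upt_Suc)
    moreover have "blinfun_apply w v = 0" if "v \<in> \<Gamma>2" for v
      using that x_annihilator(1)
      by (intro zspan_linear_zero[OF linear_blinfun_eval _ w]) (auto simp: annihilator_def simp del: upt_Suc)
    ultimately show "w \<in> annihilator \<Gamma> \<Gamma>2" by (simp add: annihilator_def dual_lattice_def)
  qed
qed

lemma zbasis_T: "zbasis (T_lattice \<Gamma> \<Gamma>2) (prod_basis (map l [1..<2 * n + 1]) (map x [1..<n + 1]))"
  unfolding T_lattice_def by (rule zbasis_prod_basis[OF zbasis_Gamma zbasis_annihilator])

lemma dual_basis_Gamma: "dual_basis \<Gamma> [1..<2 * n + 1] l (xA \<Gamma> x)"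
  unfolding dual_basis_def xA_def class1_eq_linear_class
proof (intro conjI ballI)
  show "zbasis \<Gamma> (map l [1..<2 * n + 1])" by (rule zbasis_Gamma)
  show "sorted_wrt (<) [1..<2 * n + 1]" by (simp del: upt_Suc)
  fix i assume "i \<in> set [1..<2 * n + 1]"
  then have i: "i \<in> {1..2 * n}" by auto
  show "linear_class \<Gamma> (blinfun_apply (x i)) \<in> cohomology \<int> \<Gamma>"
    using x_dual_lattice[OF i]
    by (intro linear_class_cohomology zbasis_add_subgroup[OF zbasis_Gamma] coeff_rings)
      (auto simp: dual_lattice_def blinfun.add_right)
  show "homog (Suc 0) (cls (linear_class \<Gamma> (blinfun_apply (x i))))" by (rule homog_linear_class)
  show "linear_class \<Gamma> (blinfun_apply (x i)) [l k] = (if i = k then 1 else 0)" if "k \<in> set [1..<2 * n + 1]" for k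
    using that i by (auto simp: dual l_in(3) simp del: upt_Suc)
qed

end

text \<open>
  The mirror lattice is known only through the identification \<open>\<alpha>\<close>. That \<open>\<alpha>\<close> preserves \<open>Q\<close> is what makes
  the images of \<open>x\<^sub>1, \<dots>, x\<^sub>n, l\<^bsub>n + 1\<^esub>, \<dots>, l\<^bsub>2 n\<^esub>\<close> a basis of \<open>\<Delta>\<close>, with dual basis the images of
  \<open>l\<^sub>1, \<dots>, l\<^sub>n, x\<^bsub>n + 1\<^esub>, \<dots>, x\<^bsub>2 n\<^esub>\<close>, and what identifies the classes pulled back from \<open>B\<close> to \<open>T\<close>.
\<close>

locale mirror_decomposition = adapted_decomposition n \<Gamma> \<Gamma>1 \<Gamma>2 l x
  for n :: nat and \<Gamma> \<Gamma>1 \<Gamma>2 :: "'v::euclidean_space set"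
    and l :: "nat \<Rightarrow> 'v" and x :: "nat \<Rightarrow> 'v dual" +
  fixes \<Delta> :: "'w::euclidean_space set" and \<alpha> :: "'v \<times> 'v dual \<Rightarrow> 'w \<times> 'w dual"
  assumes linear: "linear \<alpha>"
    and Q: "\<And>p q. p \<in> Lam \<Gamma> \<Longrightarrow> q \<in> Lam \<Gamma> \<Longrightarrow> Qform (\<alpha> p) (\<alpha> q) = Qform p q"
    and Lam_Delta: "\<alpha> ` Lam \<Gamma> \<subseteq> Lam \<Delta>"
    and image_Delta: "\<alpha> ` (\<Gamma>2 \<times> annihilator \<Gamma> \<Gamma>2) = \<Delta> \<times> {0}"
    and image_dual_Delta: "\<alpha> ` (\<Gamma>1 \<times> annihilator \<Gamma> \<Gamma>1) = {0} \<times> dual_lattice \<Delta>"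
begin

definition d :: "nat \<Rightarrow> 'w" where
  "d i = (if i \<le> n then fst (\<alpha> (0, x i)) else fst (\<alpha> (l i, 0)))"

definition y :: "nat \<Rightarrow> 'w forms" where
  "y i = (if i \<le> n then lB \<Delta> \<alpha> l i else xB \<Delta> \<alpha> x i)"

text \<open>
  The element of \<open>\<Lambda>\<close> that \<open>\<alpha>\<close> turns into the covector underlying the class \<open>y i\<close>.
\<close>

definition ybar :: "nat \<Rightarrow> 'v \<times> 'v dual" where
  "ybar i = (if i \<le> n then (l i, 0) else (0, x i))"

lemma y_eq: "y i = linear_class \<Delta> (blinfun_apply (snd (\<alpha> (ybar i))))"
  by (simp add: y_def ybar_def lB_def xB_def class1_eq_linear_class)

lemma zero_annihilator: "0 \<in> annihilator \<Gamma> A"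
  by (simp add: annihilator_def dual_lattice_def)

lemma ybar_in: "i \<in> {1..2 * n} \<Longrightarrow> ybar i \<in> \<Gamma>1 \<times> annihilator \<Gamma> \<Gamma>1"
  using l_in(1)[of i] x_annihilator(2)[of i] zero_in zero_annihilator by (auto simp: ybar_def)

lemma \<alpha>_ybar_in: "i \<in> {1..2 * n} \<Longrightarrow> \<alpha> (ybar i) \<in> {0} \<times> dual_lattice \<Delta>"
  unfolding image_dual_Delta[symmetric] by (intro imageI ybar_in)

text \<open>
  The first component of \<open>\<alpha> (ybar i)\<close> vanishes, so evaluating its second component is the same as
  pairing with \<open>Q\<close>, which can be computed before applying \<open>\<alpha>\<close>.
\<close>

lemma snd_\<alpha>_ybar:
  assumes i: "i \<in> {1..2 * n}" and p: "p \<in> Lam \<Gamma>"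
  shows "blinfun_apply (snd (\<alpha> (ybar i))) (fst (\<alpha> p)) = Qform (ybar i) p"
proof -
  have "fst (\<alpha> (ybar i)) = 0" using \<alpha>_ybar_in[OF i] by auto
  moreover have "ybar i \<in> Lam \<Gamma>"
    using ybar_in[OF i] Gamma_subset by (auto simp: Lam_def annihilator_def)
  ultimately show ?thesis
    using Q[OF _ p, of "ybar i"] unfolding Qform_def[of "\<alpha> (ybar i)"] by simp
qed

lemma snd_\<alpha>_d:
  assumes i: "i \<in> {1..2 * n}" and k: "k \<in> {1..2 * n}"
  shows "blinfun_apply (snd (\<alpha> (ybar i))) (d k) = (if i = k then 1 else 0)"
proof (cases "k \<le> n")
  case True
  then have "(0, x k) \<in> Lam \<Gamma>" using k zero_in x_dual_lattice by (simp add: Lam_def)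
  then show ?thesis
    using snd_\<alpha>_ybar[OF i, of "(0, x k)"] dual[OF k i] True
    by (auto simp: d_def ybar_def Qform_def blinfun.zero_right)
next
  case False
  then have "(l k, 0) \<in> Lam \<Gamma>" using k l_in(3) by (simp add: Lam_def dual_lattice_def)
  then show ?thesis
    using snd_\<alpha>_ybar[OF i, of "(l k, 0)"] dual[OF i k] False
    by (auto simp: d_def ybar_def Qform_def blinfun.zero_left)
qed

lemma zbasis_Delta: "zbasis \<Delta> (map d [1..<2 * n + 1])"
  unfolding zbasis_zspan
proof (intro conjI)
  have "distinct (map d [1..<2 * n + 1]) \<and> independent (set (map d [1..<2 * n + 1]))"
  proof (intro conjI independent_if_dual[where \<phi> = "\<lambda>i. blinfun_apply (snd (\<alpha> (ybar (Suc i))))"] linear_blinfun_apply)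
  qed (auto simp: snd_\<alpha>_d simp del: upt_Suc)
  then show "distinct (map d [1..<2 * n + 1])" "independent (set (map d [1..<2 * n + 1]))" by auto
  have lin: "linear (\<lambda>w. fst (\<alpha> (0, w)))" "linear (\<lambda>g. fst (\<alpha> (g, 0)))"
  proof -
    have "linear (\<lambda>w :: 'v dual. (0 :: 'v, w))" "linear (\<lambda>g :: 'v. (g, 0 :: 'v dual))"
      by (auto intro!: linearI simp: scaleR_prod_def)
    then show "linear (\<lambda>w. fst (\<alpha> (0, w)))" "linear (\<lambda>g. fst (\<alpha> (g, 0)))"
      using linear_compose[OF linear_compose[OF _ linear] linear_fst] by (auto simp: comp_def)
  qed
  have "map d [1..<2 * n + 1] = map (\<lambda>w. fst (\<alpha> (0, w))) (map x [1..<n + 1]) @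
      map (\<lambda>g. fst (\<alpha> (g, 0))) (map l [n + 1..<2 * n + 1])"
    unfolding upt_split map_append map_map by (auto simp: d_def simp del: upt_Suc)
  moreover have "zspan (map x [1..<n + 1]) = annihilator \<Gamma> \<Gamma>2"
    "zspan (map l [n + 1..<2 * n + 1]) = \<Gamma>2"
    using zbasis_annihilator zb2 by (simp_all only: zbasis_zspan)
  ultimately have "zspan (map d [1..<2 * n + 1]) = {u + v | u v.
      u \<in> (\<lambda>w. fst (\<alpha> (0, w))) ` annihilator \<Gamma> \<Gamma>2 \<and> v \<in> (\<lambda>g. fst (\<alpha> (g, 0))) ` \<Gamma>2}"
    by (simp only: zspan_append zspan_image[OF lin(1)] zspan_image[OF lin(2)])
  also have "\<dots> = (fst \<circ> \<alpha>) ` (\<Gamma>2 \<times> annihilator \<Gamma> \<Gamma>2)"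
  proof -
    have *: "fst (\<alpha> (g, w)) = fst (\<alpha> (0, w)) + fst (\<alpha> (g, 0))" for g w
      using linear_add[OF linear, of "(0, w)" "(g, 0)"] by simp
    show ?thesis
    proof (intro equalityI subsetI)
      fix u assume "u \<in> {u + v | u v. u \<in> (\<lambda>w. fst (\<alpha> (0, w))) ` annihilator \<Gamma> \<Gamma>2 \<and>
        v \<in> (\<lambda>g. fst (\<alpha> (g, 0))) ` \<Gamma>2}"
      then obtain g w where gw: "u = fst (\<alpha> (0, w)) + fst (\<alpha> (g, 0))" "g \<in> \<Gamma>2" "w \<in> annihilator \<Gamma> \<Gamma>2"
        by blast
      then have "u = (fst \<circ> \<alpha>) (g, w)" "(g, w) \<in> \<Gamma>2 \<times> annihilator \<Gamma> \<Gamma>2"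
        using *[of g w] by simp_all
      then show "u \<in> (fst \<circ> \<alpha>) ` (\<Gamma>2 \<times> annihilator \<Gamma> \<Gamma>2)" by (rule image_eqI)
    next
      fix u assume "u \<in> (fst \<circ> \<alpha>) ` (\<Gamma>2 \<times> annihilator \<Gamma> \<Gamma>2)"
      then obtain g w where gw: "u = fst (\<alpha> (g, w))" "g \<in> \<Gamma>2" "w \<in> annihilator \<Gamma> \<Gamma>2"
        by auto
      then have "u = fst (\<alpha> (0, w)) + fst (\<alpha> (g, 0))" using *[of g w] by simp
      then show "u \<in> {u + v | u v. u \<in> (\<lambda>w. fst (\<alpha> (0, w))) ` annihilator \<Gamma> \<Gamma>2 \<and>
        v \<in> (\<lambda>g. fst (\<alpha> (g, 0))) ` \<Gamma>2}" using gw by blast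
    qed
  qed
  also have "\<dots> = fst ` (\<Delta> \<times> {0 :: 'w dual})" unfolding image_Delta[symmetric] image_comp ..
  also have "\<dots> = \<Delta>" by force
  finally show "\<Delta> = zspan (map d [1..<2 * n + 1])" ..
qed

lemma dual_basis_Delta: "dual_basis \<Delta> [1..<2 * n + 1] d y"
  unfolding dual_basis_def y_eq
proof (intro conjI ballI)
  show "zbasis \<Delta> (map d [1..<2 * n + 1])" by (rule zbasis_Delta)
  show "sorted_wrt (<) [1..<2 * n + 1]" by (simp del: upt_Suc)
  fix i assume "i \<in> set [1..<2 * n + 1]"
  then have i: "i \<in> {1..2 * n}" by auto
  have "snd (\<alpha> (ybar i)) \<in> dual_lattice \<Delta>" using \<alpha>_ybar_in[OF i] by auto
  then show "linear_class \<Delta> (blinfun_apply (snd (\<alpha> (ybar i)))) \<in> cohomology \<int> \<Delta>"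
    by (intro linear_class_cohomology zbasis_add_subgroup[OF zbasis_Delta] coeff_rings)
      (auto simp: dual_lattice_def blinfun.add_right)
  show "homog (Suc 0) (cls (linear_class \<Delta> (blinfun_apply (snd (\<alpha> (ybar i))))))"
    by (rule homog_linear_class)
  fix k assume "k \<in> set [1..<2 * n + 1]"
  then have k: "k \<in> {1..2 * n}" by auto
  then have "d k \<in> \<Delta>"
    using zbasis_subset[OF zbasis_Delta] unfolding set_map_upt by blast
  then show "linear_class \<Delta> (blinfun_apply (snd (\<alpha> (ybar i)))) [d k] = (if i = k then 1 else 0)"
    using snd_\<alpha>_d[OF i k] by simp
qed

lemma T_subset: "T_lattice \<Gamma> \<Gamma>2 \<subseteq> Lam \<Gamma>"
  by (auto simp: T_lattice_def Lam_def annihilator_def)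

lemma T_embed_in: "T_embed \<alpha> ` T_lattice \<Gamma> \<Gamma>2 \<subseteq> \<Gamma> \<times> \<Delta>"
proof
  fix u assume "u \<in> T_embed \<alpha> ` T_lattice \<Gamma> \<Gamma>2"
  then obtain p where p: "p \<in> T_lattice \<Gamma> \<Gamma>2" "u = T_embed \<alpha> p" by blast
  then have "\<alpha> p \<in> Lam \<Delta>" using T_subset Lam_Delta by blast
  then show "u \<in> \<Gamma> \<times> \<Delta>" using p by (auto simp: T_embed_def T_lattice_def Lam_def)
qed

lemma pullback_x:
  "pullback (fst \<circ> T_embed \<alpha>) (T_lattice \<Gamma> \<Gamma>2) (xA \<Gamma> x i) =
    linear_class (T_lattice \<Gamma> \<Gamma>2) (\<lambda>p. blinfun_apply (x i) (fst p))"
proof -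
  have "(fst \<circ> T_embed \<alpha>) ` T_lattice \<Gamma> \<Gamma>2 \<subseteq> \<Gamma>" using T_embed_in by auto
  then show ?thesis
    unfolding xA_def class1_eq_linear_class
    by (subst pullback_linear_class) (auto simp: comp_def T_embed_def)
qed

lemma pullback_y:
  assumes i: "i \<in> {1..2 * n}"
  shows "pullback (snd \<circ> T_embed \<alpha>) (T_lattice \<Gamma> \<Gamma>2) (y i) =
    linear_class (T_lattice \<Gamma> \<Gamma>2) (\<lambda>p. Qform (ybar i) p)"
proof -
  have "(snd \<circ> T_embed \<alpha>) ` T_lattice \<Gamma> \<Gamma>2 \<subseteq> \<Delta>" using T_embed_in by auto
  then have "pullback (snd \<circ> T_embed \<alpha>) (T_lattice \<Gamma> \<Gamma>2) (y i) =
      linear_class (T_lattice \<Gamma> \<Gamma>2) (blinfun_apply (snd (\<alpha> (ybar i))) \<circ> (snd \<circ> T_embed \<alpha>))"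
    unfolding y_eq by (rule pullback_linear_class)
  also have "\<dots> = linear_class (T_lattice \<Gamma> \<Gamma>2) (\<lambda>p. Qform (ybar i) p)"
    using snd_\<alpha>_ybar[OF i] T_subset
    by (intro ext) (auto simp: linear_class_def T_embed_def split: list.split)
  finally show ?thesis .
qed

lemma torus_correspondence:
  assumes "zbasis \<Gamma> as" "zbasis \<Delta> bs" "zbasis (T_lattice \<Gamma> \<Gamma>2) ts" "\<sigma> \<in> duality_signs"
  shows "torus_correspondence n \<Gamma> \<Delta> (T_lattice \<Gamma> \<Gamma>2) (T_embed \<alpha>) l (xA \<Gamma> x) d y as bs ts \<sigma>"
proof
  show "length ts = 3 * n"
    using zbasis_length_eq[OF assms(3) zbasis_T] by (simp add: prod_basis_def del: upt_Suc)
  show "T_embed \<alpha> (u + v) = T_embed \<alpha> u + T_embed \<alpha> v" for u v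
    by (simp add: T_embed_def linear_add[OF linear])
  show "pullback (fst \<circ> T_embed \<alpha>) (T_lattice \<Gamma> \<Gamma>2) (xA \<Gamma> x i) =
      pullback (snd \<circ> T_embed \<alpha>) (T_lattice \<Gamma> \<Gamma>2) (y i)" if "i \<in> {n + 1..2 * n}" for i
  proof -
    have "i \<in> {1..2 * n}" "\<not> i \<le> n" using that by auto
    then show ?thesis by (simp add: pullback_x pullback_y ybar_def Qform_def blinfun.zero_right)
  qed
qed (use assms dual_basis_Gamma dual_basis_Delta T_embed_in in auto)

text \<open>
  For \<open>b\<close> in \<open>\<Gamma>1\<^sup>*\<close> one has \<open>b(a) = \<Sum> x\<^sub>i(a) b(l\<^sub>i)\<close>, which turns the alternating form
  \<open>((a, b), (a', b')) \<mapsto> b'(a) - b(a')\<close> into the sum of the \<open>x\<^sub>i \<union> l\<^sub>i\<close>.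
\<close>

lemma chern1_L:
  "cls (chern1 (T_lattice \<Gamma> \<Gamma>2) (tensor_power poincare_bundle k)) =
    (\<Sum>i\<in>{1..n}. of_int k *\<^sub>R
      (cls (pullback (fst \<circ> T_embed \<alpha>) (T_lattice \<Gamma> \<Gamma>2) (xA \<Gamma> x i)) *
       cls (pullback (snd \<circ> T_embed \<alpha>) (T_lattice \<Gamma> \<Gamma>2) (y i))))"
proof (rule form_eqI)
  fix us
  let ?T = "T_lattice \<Gamma> \<Gamma>2"
  have "form (\<Sum>i\<in>{1..n}. of_int k *\<^sub>R
      (cls (pullback (fst \<circ> T_embed \<alpha>) ?T (xA \<Gamma> x i)) *
       cls (pullback (snd \<circ> T_embed \<alpha>) ?T (y i)))) us =
    (\<Sum>i\<in>{1..n}. of_int k * cup (linear_class ?T (\<lambda>p. blinfun_apply (x i) (fst p)))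
       (linear_class ?T (\<lambda>p. blinfun_apply (snd p) (l i))) us)"
    unfolding form_sum
  proof (intro sum.cong refl)
    fix i assume i: "i \<in> {1..n}"
    then have i': "i \<in> {1..2 * n}" by auto
    have "(\<lambda>p. Qform (ybar i) p) = (\<lambda>p. blinfun_apply (snd p) (l i))"
      using i by (intro ext) (simp add: ybar_def Qform_def blinfun.zero_left)
    then have "pullback (snd \<circ> T_embed \<alpha>) ?T (y i) = linear_class ?T (\<lambda>p. blinfun_apply (snd p) (l i))"
      using pullback_y[OF i'] by simp
    then show "form (of_int k *\<^sub>R (cls (pullback (fst \<circ> T_embed \<alpha>) ?T (xA \<Gamma> x i)) *
         cls (pullback (snd \<circ> T_embed \<alpha>) ?T (y i)))) us =
      of_int k * cup (linear_class ?T (\<lambda>p. blinfun_apply (x i) (fst p)))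
         (linear_class ?T (\<lambda>p. blinfun_apply (snd p) (l i))) us"
      by (simp add: form_simps times_shuffle_algebra.rep_eq pullback_x)
  qed
  also have "\<dots> = chern1 ?T (tensor_power poincare_bundle k) us"
  proof (cases "\<exists>g h. us = [g, h] \<and> g \<in> ?T \<and> h \<in> ?T")
    case True
    then obtain g h where us: "us = [g, h]" and gh: "g \<in> ?T" "h \<in> ?T" by blast
    have exp: "blinfun_apply (snd p) a = (\<Sum>i\<in>{1..n}. blinfun_apply (x i) a * blinfun_apply (snd p) (l i))"
      if "p \<in> ?T" for p a
    proof -
      have "snd p \<in> annihilator \<Gamma> \<Gamma>2" using that by (auto simp: T_lattice_def)
      from arg_cong[OF annihilator_expansion[OF this], of "\<lambda>w. blinfun_apply w a"]
      show ?thesis by (simp add: blinfun.sum_left blinfun.scaleR_left mult.commute)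
    qed
    show ?thesis
      unfolding chern1_poincare_power cup_linear_class_pair us
      using gh by (simp add: exp[OF gh(1), of "fst h"] exp[OF gh(2), of "fst g"]
          sum_subtractf sum_distrib_left right_diff_distrib)
  next
    case False
    then show ?thesis
      unfolding chern1_poincare_power cup_linear_class_pair by (auto split: list.split)
  qed
  finally show "form (cls (chern1 ?T (tensor_power poincare_bundle k))) us =
    form (\<Sum>i\<in>{1..n}. of_int k *\<^sub>R
      (cls (pullback (fst \<circ> T_embed \<alpha>) ?T (xA \<Gamma> x i)) *
       cls (pullback (snd \<circ> T_embed \<alpha>) ?T (y i)))) us" by simp
qed

end

theorem proposition10p8:
  fixes \<Gamma> \<Gamma>1 \<Gamma>2 :: "'v::euclidean_space set" and J :: "'v \<Rightarrow>\<^sub>L 'v"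
    and \<omega> :: "'v form2 \<times> 'v form2"
    and \<Delta> :: "'w::euclidean_space set" and K :: "'w \<Rightarrow>\<^sub>L 'w"
    and \<theta> :: "'w form2 \<times> 'w form2"
    and \<alpha> :: "'v \<times> 'v dual \<Rightarrow> 'w \<times> 'w dual"
    and n :: nat and l :: "nat \<Rightarrow> 'v" and x :: "nat \<Rightarrow> 'v dual"
    and as :: "'v list" and bs :: "'w list" and ts :: "('v \<times> 'v dual) list"
    and \<sigma> :: "nat \<Rightarrow> nat \<Rightarrow> real"
    and \<beta> :: "'v forms \<Rightarrow> 'w forms"
  assumes "well_becoming \<Gamma> J \<omega> \<Gamma>1 \<Gamma>2"
    and "DIM('v) = 2 * n"
    and "canonical_mirror \<Gamma> J \<omega> \<Gamma>1 \<Gamma>2 \<Delta> K \<theta> \<alpha>"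
    and "adapted_bases n \<Gamma>1 \<Gamma>2 l x"
    and "canonical_iso n \<Gamma> \<Delta> \<alpha> l x \<beta>"
    and "complex_oriented \<Gamma> J as" and "complex_oriented \<Delta> K bs"
    and "\<sigma> \<in> duality_signs"
    and "zbasis (T_lattice \<Gamma> \<Gamma>2) ts" and "normalised \<sigma> n \<Gamma> \<Gamma>2 \<Delta> \<alpha> x as bs ts"
  defines "\<xi> \<equiv> kernel_class \<sigma> n \<Gamma> \<Gamma>2 \<Delta> \<alpha> as bs ts"
  shows "\<xi> \<in> cohomology \<int> (\<Gamma> \<times> \<Delta>) \<and>
         (\<forall>h\<in>cohomology \<int> \<Gamma>. \<beta> h = corr \<sigma> \<Gamma> \<Delta> as bs \<xi> h)"
proof -
  have "weak_pair \<Gamma> J \<omega>" and sum: "\<Gamma> = {u + v | u v. u \<in> \<Gamma>1 \<and> v \<in> \<Gamma>2}"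
    using assms(1) unfolding well_becoming_def by - (elim conjE, assumption)+
  then have span: "span \<Gamma> = UNIV"
    unfolding weak_pair_def complex_torus_def by (elim conjE)
  have mirror: "mirror_symmetry \<Gamma> J \<omega> \<Delta> K \<theta> \<alpha>"
    and images: "\<alpha> ` (\<Gamma>2 \<times> annihilator \<Gamma> \<Gamma>2) = \<Delta> \<times> {0}"
      "\<alpha> ` (\<Gamma>1 \<times> annihilator \<Gamma> \<Gamma>1) = {0} \<times> dual_lattice \<Delta>"
    using assms(3) unfolding canonical_mirror_def by - (elim conjE, assumption)+
  have \<alpha>: "linear \<alpha>" "bij_betw \<alpha> (Lam \<Gamma>) (Lam \<Delta>)"
    "\<forall>p\<in>Lam \<Gamma>. \<forall>q\<in>Lam \<Gamma>. Qform (\<alpha> p) (\<alpha> q) = Qform p q"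
    using mirror unfolding mirror_symmetry_def by - (elim conjE, assumption)+
  have zb: "zbasis \<Gamma> as" "zbasis \<Delta> bs"
    using assms(6,7) by (simp_all add: complex_oriented_def)
  interpret mirror_decomposition n \<Gamma> \<Gamma>1 \<Gamma>2 l x \<Delta> \<alpha>
  proof (intro mirror_decomposition.intro adapted_decomposition.intro mirror_decomposition_axioms.intro)
    show "Qform (\<alpha> p) (\<alpha> q) = Qform p q" if "p \<in> Lam \<Gamma>" "q \<in> Lam \<Gamma>" for p q
      using \<alpha>(3) that by blast
    show "\<alpha> ` Lam \<Gamma> \<subseteq> Lam \<Delta>" using \<alpha>(2) by (simp add: bij_betw_def)
  qed (fact sum span assms(4) \<alpha>(1) images)+
  interpret torus_correspondence n \<Gamma> \<Delta> "T_lattice \<Gamma> \<Gamma>2" "T_embed \<alpha>" l "xA \<Gamma> x" d y as bs ts \<sigma>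
    by (rule torus_correspondence[OF zb assms(9,8)])
  let ?T = "T_lattice \<Gamma> \<Gamma>2" and ?k = "(-1) ^ (n - 1) :: real"
  define ch where "ch = chern_character ?T (tensor_power poincare_bundle ((-1) ^ (n - 1)))"
  have \<xi>: "\<xi> = push ch"
    by (simp add: \<xi>_def kernel_class_def j_push_def ch_def)
  have ch: "cls ch = (\<Sum>P\<in>Pow {1..n}. oprod (\<lambda>i. ?k *\<^sub>R (XT i * YT i)) P)"
    unfolding ch_def
  proof (rule chern_character_eq_sum_oprod)
    show "cls (chern1 ?T (tensor_power poincare_bundle ((-1) ^ (n - 1)))) =
        (\<Sum>i\<in>{1..n}. ?k *\<^sub>R (XT i * YT i))"
      unfolding chern1_L by (intro sum.cong refl) (simp add: XT_def YT_def)
    show "homog 2 (?k *\<^sub>R (XT i * YT i))" for i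
      using homog_mult[OF homog_XT[of i] homog_YT[of i]] by (simp add: homog_def form_simps numeral_2_eq_2)
    show "?k *\<^sub>R (XT i * YT i) * (?k *\<^sub>R (XT i * YT i)) = 0" for i
      using pair_square[of i] by simp
  qed
  have chZ: "ch \<in> cohomology \<int> ?T"
  proof -
    have "ch = form (\<Sum>P\<in>Pow {1..n}. oprod (\<lambda>i. ?k *\<^sub>R (XT i * YT i)) P)"
      using ch by (metis form_cls)
    then show ?thesis using exponential_cohomology[of ?k] by simp
  qed
  have yR: "monomial (xB \<Delta> \<alpha> x) R = monomial y R" if "R \<subseteq> {n + 1..2 * n}" for R
    using that finite_subset[OF that] by (intro monomial_cong) (auto simp: y_def subset_iff)
  have yS: "monomial (lB \<Delta> \<alpha> l) S = monomial y S" if "S \<subseteq> {1..n}" for S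
    using that finite_subset[OF that] by (intro monomial_cong) (auto simp: y_def subset_iff)
  have norm: "corr \<sigma> \<Gamma> \<Delta> as bs (push unit_class)
      (cup (monomial (xA \<Gamma> x) R) (cups (map (xA \<Gamma> x) (rev [1..<n + 1])))) = monomial y R"
    if "R \<subseteq> {n + 1..2 * n}" for R
    using assms(10) that yR[OF that] by (simp add: normalised_def j_push_def Let_def del: upt_Suc)
  show ?thesis
  proof (intro conjI ballI)
    show "\<xi> \<in> cohomology \<int> (\<Gamma> \<times> \<Delta>)"
      unfolding \<xi> by (rule push_cohomology[OF chZ])
    fix h assume h: "h \<in> cohomology \<int> \<Gamma>"
    show "\<beta> h = corr \<sigma> \<Gamma> \<Delta> as bs \<xi> h"
      unfolding \<xi>
    proof (rule additive_eq_on_cohomology[OF dual_basis_Gamma _ _ _ h])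
      show "\<beta> (\<lambda>vs. f vs + g vs) = (\<lambda>vs. \<beta> f vs + \<beta> g vs)"
        if "f \<in> cohomology \<int> \<Gamma>" "g \<in> cohomology \<int> \<Gamma>" for f g
        using assms(5) that unfolding canonical_iso_def clifford_module_iso_def by blast
      show "corr \<sigma> \<Gamma> \<Delta> as bs (push ch) (\<lambda>vs. f vs + g vs) =
          (\<lambda>vs. corr \<sigma> \<Gamma> \<Delta> as bs (push ch) f vs + corr \<sigma> \<Gamma> \<Delta> as bs (push ch) g vs)"
        if "f \<in> cohomology \<int> \<Gamma>" "g \<in> cohomology \<int> \<Gamma>" for f g
        using that cohomology_mono[OF Ints_subset_Rats] by (intro corr_push_add chZ) auto
      fix I assume "I \<subseteq> set [1..<2 * n + 1]"
      then have I: "I \<subseteq> {1..2 * n}" by auto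
      define S where "S = I \<inter> {1..n}"
      define R where "R = I \<inter> {n + 1..2 * n}"
      have S: "S \<subseteq> {1..n}" and R: "R \<subseteq> {n + 1..2 * n}" by (auto simp: S_def R_def)
      have I_eq: "I = S \<union> R" using I by (auto simp: S_def R_def)
      have mono: "monomial (xA \<Gamma> x) I = cup (monomial (xA \<Gamma> x) S) (monomial (xA \<Gamma> x) R)"
        unfolding I_eq
      proof (rule monomial_Un)
        show "finite S" "finite R" by (simp_all add: S_def R_def)
        show "i < k" if "i \<in> S" "k \<in> R" for i k using that by (auto simp: S_def R_def)
      qed
      have "\<beta> (cup (monomial (xA \<Gamma> x) S) (monomial (xA \<Gamma> x) R)) =
          (\<lambda>vs. (-1) ^ (card S * card R + (\<Sum>i\<in>S. i - 1)) *
            cup (monomial (xB \<Delta> \<alpha> x) R) (monomial (lB \<Delta> \<alpha> l) ({1..n} - S)) vs)"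
        using assms(5) S R unfolding canonical_iso_def by blast
      also have "\<dots> = corr \<sigma> \<Gamma> \<Delta> as bs (push ch) (cup (monomial (xA \<Gamma> x) S) (monomial (xA \<Gamma> x) R))"
        unfolding yR[OF R] yS[OF Diff_subset]
        by (rule sym, rule corr_monomials[OF ch chZ _ S R]) (rule norm)
      finally show "\<beta> (monomial (xA \<Gamma> x) I) = corr \<sigma> \<Gamma> \<Delta> as bs (push ch) (monomial (xA \<Gamma> x) I)"
        unfolding mono .
    qed
  qed
qed
end
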